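(* Let $w$ be a function from the positive integers to the positive integers such that for every integer $r\ge 1$, every graph of tree-width at least $w(r)$ contains the $r$-wall as a subdivision. Let $G$ be a graph and let $r\ge 1$ be an integer. If $G$ has tree-cut width at least $4r^{10}w(r)$, then $G$ admits a weak immersion of the $r$-wall.
   Context: A function $w$ as in the claim exists by the grid minor theorem of Robertson and Seymour. Graphs are finite and may have multiple (parallel) edges but no loops. $\delta(X)$ denotes the set of edges with exactly one endpoint in $X$. Weak immersion: $G$ admits a weak immersion of $H$ if there is an injection $\pi_v: V(H)\to V(G)$ and a map $\pi_e$ from $E(H)$ to subgraphs of $G$ such that for every edge $f$ of $H$ with endpoints $x,y$, $\pi_e(f)$ is a path with endpoints $\pi_v(x),\pi_v(y)$, and for distinct edges $f,f'$ of $H$ the paths $\pi_e(f),\pi_e(f')$ have no edge in common. $G$ contains $H$ as a subdivision if $H$ can be obtained from a subgraph of $G$ by repeatedly suppressing vertices of degree two (contracting an edge incident with such a vertex and deleting any resulting loop). $r$-wall: $H_r$ has vertex set $\{v^i_j: 1\le i,j\le r\}$; its edges are $v^i_jv^i_{j+1}$ for $1\le i\le r$, $1\le j\le r-1$, together with $v^i_jv^{i+1}_j$ for all $1\le i<r$, $1\le j\le r$ such that $i,j$ are both odd or both even. Tree-cut decomposition: a near-partition of a set is a family of pairwise disjoint, possibly empty, subsets whose union is the whole set. A tree-cut decomposition of $G$ is a pair $(T,\mathcal{X})$ where $T$ is a tree and $\mathcal{X}=\{X_t\subseteq V(G): t\in V(T)\}$ is a near-partition of $V(G)$. For an edge $uv$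 of $T$, let $T_v$ be the component of $T-uv$ containing $v$. The adhesion is $\max_{uv\in E(T)}\left|\delta\left(\bigcup_{t\in V(T_v)}X_t\right)\right|$ if $T$ has at least one edge, and $0$ otherwise. Torso: consolidating a vertex set $Z$ means deleting all edges with both ends in $Z$ and identifying $Z$ to a single vertex. If $|V(T)|=1$, the torso at the unique vertex is $G$. Otherwise, for $t\in V(T)$ let $T_1,\dots,T_l$ be the components of $T-t$ and $Z_i=\bigcup_{x\in V(T_i)}X_x$; the torso at $t$ is obtained from $G$ by consolidating each $Z_i$ to a single vertex $z_i$ (if $Z_i=\emptyset$, $z_i$ is an isolated vertex). 3-center: for a graph $J$ and $X\subseteq V(J)$, the 3-center of $(J,X)$ is the graph $H$ (unique up to isomorphism) that is maximal with respect to containment as a weak immersion among graphs having a weak immersion $(\pi_v,\pi_e)$ in $J$ with $X\subseteq\pi_v(V(H))$ and $\pi_v(x)\in X$ for every $x\in V(H)$ with $\deg_H(x)\le 2$. Tree-cut width: let $\bar H_t$ be the 3-center of $(H_t,X_t)$, where $H_t$ is the torso at $t$. The width of $(T,\mathcal{X})$ is the maximum of its adhesion and the numbers $|V(\bar H_t)|$, $t\in V(T)$. The tree-cut width of $G$ is the minimum width of a tree-cut decomposition of $G$. *)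

theory Defs
  imports Main "HOL-Library.Disjoint_Sets"
begin

text \<open>
  Finite undirected multigraphs without loops: an edge is an abstract object with a
  two-element set of endpoints, so distinct edges may be parallel.
\<close>

record ('v, 'e) mgraph =
  verts :: "'v set"
  edges :: "'e set"
  ends :: "'e \<Rightarrow> 'v set"

definition wf_mgraph :: "('v, 'e) mgraph \<Rightarrow> bool" where
  "wf_mgraph G \<longleftrightarrow> finite (verts G) \<and> finite (edges G) \<and>
     (\<forall>e\<in>edges G. ends G e \<subseteq> verts G \<and> card (ends G e) = 2)"

definition subgraph :: "('v, 'e) mgraph \<Rightarrow> ('v, 'e) mgraph \<Rightarrow> bool" where
  "subgraph S G \<longleftrightarrow> wf_mgraph S \<and> verts S \<subseteq> verts G \<and> edges S \<subseteq> edges G \<and>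
     (\<forall>e\<in>edges S. ends S e = ends G e)"

definition graph_iso :: "('v, 'e) mgraph \<Rightarrow> ('u, 'f) mgraph \<Rightarrow> bool" where
  "graph_iso G H \<longleftrightarrow> (\<exists>p q. bij_betw p (verts G) (verts H) \<and> bij_betw q (edges G) (edges H) \<and>
     (\<forall>e\<in>edges G. ends H (q e) = p ` ends G e))"

definition degree :: "('v, 'e) mgraph \<Rightarrow> 'v \<Rightarrow> nat" where
  "degree G v = card {e \<in> edges G. v \<in> ends G e}"

definition cut :: "('v, 'e) mgraph \<Rightarrow> 'v set \<Rightarrow> 'e set" where
  "cut G A = {e \<in> edges G. card (ends G e \<inter> A) = 1}"

definition path_between :: "('v, 'e) mgraph \<Rightarrow> 'v \<Rightarrow> 'v \<Rightarrow> bool" where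
  "path_between P x y \<longleftrightarrow> (\<exists>vs es. distinct vs \<and> length vs = length es + 1 \<and>
     hd vs = x \<and> last vs = y \<and> verts P = set vs \<and> edges P = set es \<and>
     (\<forall>i<length es. ends P (es ! i) = {vs ! i, vs ! (i + 1)}))"

text \<open>Two parallel edges form a cycle of length two.\<close>

definition is_cycle :: "('v, 'e) mgraph \<Rightarrow> bool" where
  "is_cycle C \<longleftrightarrow> (\<exists>vs es. distinct vs \<and> distinct es \<and> length es = length vs \<and> 2 \<le> length vs \<and>
     verts C = set vs \<and> edges C = set es \<and>
     (\<forall>i<length es. ends C (es ! i) = {vs ! i, vs ! ((i + 1) mod length vs)}))"

definition reachable :: "('v, 'e) mgraph \<Rightarrow> 'v \<Rightarrow> 'v \<Rightarrow> bool" where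
  "reachable G x y \<longleftrightarrow> (\<exists>P. subgraph P G \<and> path_between P x y)"

definition is_tree :: "('t, 'd) mgraph \<Rightarrow> bool" where
  "is_tree T \<longleftrightarrow> wf_mgraph T \<and> verts T \<noteq> {} \<and>
     (\<forall>x\<in>verts T. \<forall>y\<in>verts T. reachable T x y) \<and>
     \<not> (\<exists>C. subgraph C T \<and> is_cycle C)"

text \<open>Components are represented by their vertex sets.\<close>

definition component_of :: "('v, 'e) mgraph \<Rightarrow> 'v \<Rightarrow> 'v set" where
  "component_of G v = {x \<in> verts G. reachable G v x}"

definition components :: "('v, 'e) mgraph \<Rightarrow> 'v set set" where
  "components G = component_of G ` verts G"

definition delete_edge :: "('v, 'e) mgraph \<Rightarrow> 'e \<Rightarrow> ('v, 'e) mgraph" where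
  "delete_edge G e = G\<lparr>edges := edges G - {e}\<rparr>"

definition delete_vertex :: "('v, 'e) mgraph \<Rightarrow> 'v \<Rightarrow> ('v, 'e) mgraph" where
  "delete_vertex G v = G\<lparr>verts := verts G - {v}, edges := {e \<in> edges G. v \<notin> ends G e}\<rparr>"


section \<open>Weak immersions, subdivisions and walls\<close>

definition weak_immersion ::
  "('u, 'f) mgraph \<Rightarrow> ('v, 'e) mgraph \<Rightarrow> ('u \<Rightarrow> 'v) \<Rightarrow> ('f \<Rightarrow> ('v, 'e) mgraph) \<Rightarrow> bool" where
  "weak_immersion H G pv pe \<longleftrightarrow>
     inj_on pv (verts H) \<and> pv ` verts H \<subseteq> verts G \<and>
     (\<forall>f\<in>edges H. subgraph (pe f) G \<and>
        (\<forall>x y. ends H f = {x, y} \<longrightarrow> path_between (pe f) (pv x) (pv y))) \<and>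
     (\<forall>f\<in>edges H. \<forall>f'\<in>edges H. f \<noteq> f' \<longrightarrow> edges (pe f) \<inter> edges (pe f') = {})"

definition admits_weak_immersion :: "('v, 'e) mgraph \<Rightarrow> ('u, 'f) mgraph \<Rightarrow> bool" where
  "admits_weak_immersion G H \<longleftrightarrow> (\<exists>pv pe. weak_immersion H G pv pe)"

text \<open>
  Contracting an edge \<open>e\<close> with ends \<open>u\<close> and \<open>v\<close>: the new vertex is called \<open>u\<close>. The edge \<open>e\<close>
  disappears, and edges that would become loops (that is, get a singleton endpoint set)
  are deleted.
\<close>

definition contract_edge :: "('v, 'e) mgraph \<Rightarrow> 'e \<Rightarrow> 'v \<Rightarrow> 'v \<Rightarrow> ('v, 'e) mgraph" where
  "contract_edge G e u v =
     (let p = (\<lambda>x. if x = v then u else x)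
      in \<lparr>verts = verts G - {v},
          edges = {f \<in> edges G - {e}. card (p ` ends G f) \<noteq> 1},
          ends = (\<lambda>f. p ` ends G f)\<rparr>)"

definition suppress :: "('v, 'e) mgraph \<Rightarrow> ('v, 'e) mgraph \<Rightarrow> bool" where
  "suppress G G' \<longleftrightarrow> (\<exists>v\<in>verts G. degree G v = 2 \<and>
     (\<exists>e\<in>edges G. \<exists>u. u \<noteq> v \<and> ends G e = {u, v} \<and> G' = contract_edge G e u v))"

definition contains_subdivision :: "('v, 'e) mgraph \<Rightarrow> ('u, 'f) mgraph \<Rightarrow> bool" where
  "contains_subdivision G H \<longleftrightarrow> (\<exists>S K. subgraph S G \<and> suppress\<^sup>*\<^sup>* S K \<and> graph_iso K H)"

text \<open>The pair \<open>(i, j)\<close> is the vertex in row \<open>i\<close> and column \<open>j\<close>; the wall is simple, so an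
  edge is its own set of ends.\<close>

definition wall :: "nat \<Rightarrow> (nat \<times> nat, (nat \<times> nat) set) mgraph" where
  "wall r = \<lparr>verts = {1..r} \<times> {1..r},
     edges = {{(i, j), (i, j + 1)} | i j. 1 \<le> i \<and> i \<le> r \<and> 1 \<le> j \<and> j < r} \<union>
             {{(i, j), (i + 1, j)} | i j. 1 \<le> i \<and> i < r \<and> 1 \<le> j \<and> j \<le> r \<and>
                                        (odd i \<longleftrightarrow> odd j)},
     ends = (\<lambda>e. e)\<rparr>"


section \<open>Tree-width\<close>

definition tree_decomposition ::
  "('v, 'e) mgraph \<Rightarrow> ('t, 'd) mgraph \<Rightarrow> ('t \<Rightarrow> 'v set) \<Rightarrow> bool" where
  "tree_decomposition G T B \<longleftrightarrow> is_tree T \<and>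
     (\<Union>t\<in>verts T. B t) = verts G \<and>
     (\<forall>e\<in>edges G. \<exists>t\<in>verts T. ends G e \<subseteq> B t) \<and>
     (\<forall>s\<in>verts T. \<forall>t\<in>verts T. \<forall>P. subgraph P T \<and> path_between P s t \<longrightarrow>
        (\<forall>q\<in>verts P. B s \<inter> B t \<subseteq> B q))"

text \<open>
  Trees are finite, so it suffices to use trees whose nodes and edges are natural numbers.
  Subtraction is truncated: the graph without vertices gets tree-width 0 rather than -1.
\<close>

definition tree_width :: "('v, 'e) mgraph \<Rightarrow> nat" where
  "tree_width G = Inf {Max ((\<lambda>t. card (B t)) ` verts T) - 1 | (T :: (nat, nat) mgraph) B.
     tree_decomposition G T B}"


section \<open>Tree-cut width\<close>

definition tree_cut_decomposition ::
  "('v, 'e) mgraph \<Rightarrow> ('t, 'd) mgraph \<Rightarrow> ('t \<Rightarrow> 'v set) \<Rightarrow> bool" where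
  "tree_cut_decomposition G T X \<longleftrightarrow> is_tree T \<and>
     disjoint_family_on X (verts T) \<and> (\<Union>t\<in>verts T. X t) = verts G"

definition adhesion :: "('v, 'e) mgraph \<Rightarrow> ('t, 'd) mgraph \<Rightarrow> ('t \<Rightarrow> 'v set) \<Rightarrow> nat" where
  "adhesion G T X = (if edges T = {} then 0 else
     Max {card (cut G (\<Union>t\<in>component_of (delete_edge T e) v. X t)) | e v.
            e \<in> edges T \<and> v \<in> ends T e})"

text \<open>
  The torso at \<open>t\<close>: \<open>Inl v\<close> is the vertex \<open>v\<close> of \<open>X t\<close>, and \<open>Inr C\<close> is the vertex to which the
  union of the bags of the component \<open>C\<close> of \<open>T - t\<close> is consolidated; it is present, and isolated,
  if this union is empty. If \<open>T\<close> has only one node then there are no such components, and the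
  torso is \<open>G\<close> with each vertex \<open>v\<close> renamed to \<open>Inl v\<close>.
\<close>

definition torso ::
  "('v, 'e) mgraph \<Rightarrow> ('t, 'd) mgraph \<Rightarrow> ('t \<Rightarrow> 'v set) \<Rightarrow> 't \<Rightarrow> ('v + 't set, 'e) mgraph" where
  "torso G T X t =
     (let Cs = components (delete_vertex T t); Z = (\<lambda>C. \<Union>s\<in>C. X s)
      in \<lparr>verts = Inl ` X t \<union> Inr ` Cs,
          edges = {e \<in> edges G. \<not> (\<exists>C\<in>Cs. ends G e \<subseteq> Z C)},
          ends = (\<lambda>e. Inl ` (ends G e \<inter> X t) \<union> Inr ` {C \<in> Cs. ends G e \<inter> Z C \<noteq> {}})\<rparr>)"

definition three_center_candidate :: "('v, 'e) mgraph \<Rightarrow> 'v set \<Rightarrow> ('v, 'e) mgraph \<Rightarrow> bool" where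
  "three_center_candidate J X H \<longleftrightarrow> wf_mgraph H \<and>
     (\<exists>pv pe. weak_immersion H J pv pe \<and> X \<subseteq> pv ` verts H \<and>
        (\<forall>x\<in>verts H. degree H x \<le> 2 \<longrightarrow> pv x \<in> X))"

definition is_three_center :: "('v, 'e) mgraph \<Rightarrow> 'v set \<Rightarrow> ('v, 'e) mgraph \<Rightarrow> bool" where
  "is_three_center J X H \<longleftrightarrow> three_center_candidate J X H \<and>
     (\<forall>H'. three_center_candidate J X H' \<and> admits_weak_immersion H' H \<longrightarrow>
        admits_weak_immersion H H')"

text \<open>
  A graph with a weak immersion in \<open>J\<close> has at most as many vertices and edges as \<open>J\<close>, so up to
  isomorphism nothing is lost by drawing candidates from the types of \<open>J\<close>. Finite graphs that
  admit weak immersions of each other are isomorphic, so maximality in the preorder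
  is maximality up to isomorphism. The 3-center is unique only up to isomorphism, hence
  the choice operator.
\<close>

definition three_center :: "('v, 'e) mgraph \<Rightarrow> 'v set \<Rightarrow> ('v, 'e) mgraph" where
  "three_center J X = (SOME H. is_three_center J X H)"

definition tree_cut_decomposition_width ::
  "('v, 'e) mgraph \<Rightarrow> ('t, 'd) mgraph \<Rightarrow> ('t \<Rightarrow> 'v set) \<Rightarrow> nat" where
  "tree_cut_decomposition_width G T X =
     Max (insert (adhesion G T X)
       ((\<lambda>t. card (verts (three_center (torso G T X t) (Inl ` X t)))) ` verts T))"

definition tree_cut_width :: "('v, 'e) mgraph \<Rightarrow> nat" where
  "tree_cut_width G = Inf {tree_cut_decomposition_width G T X | (T :: (nat, nat) mgraph) X.
     tree_cut_decomposition G T X}"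

end

theory Submission
  imports Defs
begin

text \<open>
  A graph \<open>G\<close> without a weak immersion of the \<open>r\<close>-wall has tree-cut width at most
  \<open>9 * r ^ 4 * w r\<close>, which is less than \<open>4 * r ^ 10 * w r\<close> as soon as \<open>r \<ge> 2\<close>; for \<open>r = 1\<close> such a graph
  has no vertices.

  Walls are found through a hub. The wall has \<open>r ^ 2\<close> vertices, all of degree at most three.
  Suppose that \<open>S\<close> is a set of \<open>r ^ 2\<close> vertices and \<open>h\<close> a vertex such that every vertex set \<open>A\<close> that misses
  \<open>h\<close> has at least \<open>3 * card (A \<inter> S)\<close> edges in its cut. Then Menger's theorem for edge-disjoint paths
  (\<open>edge_disjoint_links\<close>) links every vertex of \<open>S\<close> to \<open>h\<close> by three paths, all of them edge-disjoint, and
  these paths, joined in pairs at \<open>h\<close>, are the edges of a wall (\<open>immersion_through_hub\<close>).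

  Let \<open>k = 3 * r ^ 2\<close>. Suppose that a minimum cut between two vertices has fewer than \<open>k\<close> edges and at
  least two vertices on each side. By Menger's theorem the two graphs that arise by contracting one side
  are immersed in \<open>G\<close> (\<open>contract_immersed\<close>). They are smaller, so they have decompositions by induction.
  After removal of the contracted vertices the two trees are joined by an edge, which takes the place of
  the removed vertex in each of the two bags.

  If there is no such cut, then any two vertices in the set \<open>B\<close> of vertices of degree at least \<open>k\<close> are
  separated only by cuts with at least \<open>k\<close> edges. Hence, with a hub in \<open>B\<close>, only the sets \<open>A\<close> that miss
  \<open>B\<close> matter. A connected piece of \<open>G - B\<close> with three edges to \<open>B\<close> contains a median,
  a vertex from which three edge-disjoint paths lead through the piece to \<open>B\<close> (\<open>median_vertex\<close>). So \<open>S\<close>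
  may be chosen among the vertices of \<open>B\<close> and the medians of disjoint pieces, and as there is no wall,
  \<open>card B\<close> plus the number of disjoint pieces is less than \<open>r ^ 2\<close> (\<open>few_pieces\<close>). This limits both the
  number of components of \<open>G - B\<close> with three or more edges to \<open>B\<close> and, since a component with many
  edges to \<open>B\<close> and degrees below \<open>k\<close> splits into many pieces (\<open>split_into_pieces\<close>), the number of edges
  from one component to \<open>B\<close>. The decomposition has a central bag \<open>B\<close>, and each component hangs off
  it with a tree taken from a tree-decomposition of \<open>G\<close> of width below \<open>w r\<close>, which exists since a subdivided
  wall is an immersed wall.

  On the side of the definition of width, the 3-center at a node has at most as many vertices as the bag
  plus the number of tree edges at the node whose cuts have at least three edges (\<open>torso_center_le_load\<close>), so
  these two quantities and the cuts are all that has to be controlled.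
\<close>

section \<open>Linking by edge sets, and immersions\<close>

definition adj :: "('v, 'e) mgraph \<Rightarrow> 'e set \<Rightarrow> ('v \<times> 'v) set" where
  "adj G F = {(x, y). \<exists>e\<in>F. ends G e = {x, y}}"

definition linked :: "('v, 'e) mgraph \<Rightarrow> 'e set \<Rightarrow> 'v \<Rightarrow> 'v \<Rightarrow> bool" where
  "linked G F x y \<longleftrightarrow> (x, y) \<in> (adj G F)\<^sup>*"

lemma linked_refl [simp]: "linked G F x x"
  by (simp add: linked_def)

lemma linked_trans [trans]: "linked G F x y \<Longrightarrow> linked G F y z \<Longrightarrow> linked G F x z"
  unfolding linked_def by (rule rtrancl_trans)

lemma linked_edge: "e \<in> F \<Longrightarrow> ends G e = {x, y} \<Longrightarrow> linked G F x y"
  unfolding linked_def adj_def by blast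

lemma linked_sym: "linked G F x y \<Longrightarrow> linked G F y x"
proof -
  have "sym (adj G F)" unfolding sym_def adj_def by (auto simp: insert_commute)
  then show "linked G F x y \<Longrightarrow> linked G F y x"
    unfolding linked_def by (meson sym_rtrancl symD)
qed

lemma linked_mono: "linked G F x y \<Longrightarrow> F \<subseteq> F' \<Longrightarrow> linked G F' x y"
  unfolding linked_def by (rule rtrancl_mono[THEN subsetD]) (auto simp: adj_def)

lemma linked_induct [consumes 1, case_names refl step]:
  assumes "linked G F x y" "P x"
    "\<And>y z e. linked G F x y \<Longrightarrow> P y \<Longrightarrow> e \<in> F \<Longrightarrow> ends G e = {y, z} \<Longrightarrow> P z"
  shows "P y"
  using assms(1) unfolding linked_def
proof (induction rule: rtrancl_induct)
  case (step y z)
  then show ?case using assms(3)[unfolded linked_def] by (auto simp: adj_def)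
qed (rule assms(2))

lemma linked_cong: 
  assumes "\<And>e. e \<in> F \<Longrightarrow> ends G e = ends H e"
  shows "linked G F x y = linked H F x y"
proof -
  have "adj G F = adj H F" using assms by (auto simp: adj_def)
  then show ?thesis by (simp add: linked_def)
qed

text \<open>The way to compare walks in two graphs: it suffices to look at single edges, and
  an edge may be replaced by a walk or collapsed.\<close>
lemma linked_transfer:
  assumes "linked H F x y"
    and "\<And>e a b. e \<in> F \<Longrightarrow> ends H e = {a, b} \<Longrightarrow> linked G F' (p a) (p b)"
  shows "linked G F' (p x) (p y)"
  using assms(1)
proof (induction rule: linked_induct)
  case (step y z e)
  then show ?case using assms(2) linked_trans by metis
qed simp

lemma linked_invariant:
  assumes "linked G F x y" "x \<in> A" "\<And>e a b. e \<in> F \<Longrightarrow> ends G e = {a, b} \<Longrightarrow> a \<in> A \<Longrightarrow> b \<in> A"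
  shows "y \<in> A"
  using assms(1) by (induction rule: linked_induct) (use assms in auto)

lemma path_between_sym: "path_between P x y \<Longrightarrow> path_between P y x"
proof -
  assume "path_between P x y"
  then obtain vs es where *: "distinct vs" "length vs = length es + 1" "hd vs = x" "last vs = y"
     "verts P = set vs" "edges P = set es" "\<forall>i<length es. ends P (es ! i) = {vs ! i, vs ! (i + 1)}"
    unfolding path_between_def by blast
  have ne: "vs \<noteq> []" using *(2) by auto
  show "path_between P y x" unfolding path_between_def
  proof (intro exI[of _ "rev vs"] exI[of _ "rev es"] conjI allI impI)
    fix i assume i: "i < length (rev es)"
    let ?j = "length es - Suc i"
    have "rev es ! i = es ! ?j" "rev vs ! i = vs ! (?j + 1)" "rev vs ! (i+1) = vs ! ?j"
      using i *(2) by (auto simp: rev_nth Suc_diff_Suc)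
    then show "ends P (rev es ! i) = {rev vs ! i, rev vs ! (i + 1)}"
      using *(7) i by (auto simp: insert_commute)
  qed (use * ne in \<open>auto simp: hd_rev last_rev\<close>)
qed

lemma path_between_linked:
  assumes "path_between P x y" 
  shows "linked P (edges P) x y"
proof -
  obtain vs es where *: "distinct vs" "length vs = length es + 1" "hd vs = x" "last vs = y"
     "edges P = set es" "\<forall>i<length es. ends P (es ! i) = {vs ! i, vs ! (i + 1)}"
    using assms unfolding path_between_def by blast
  have ne: "vs \<noteq> []" using *(2) by auto
  have "i \<le> length es \<Longrightarrow> linked P (edges P) (vs ! 0) (vs ! i)" for i
  proof (induction i)
    case (Suc i)
    have "linked P (edges P) (vs ! i) (vs ! Suc i)" 
      by (rule linked_edge[of "es ! i"]) (use Suc * in auto)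
    with Suc show ?case using linked_trans by fastforce
  qed simp
  from this[of "length es"] show "linked P (edges P) x y"
    using * ne by (simp add: hd_conv_nth last_conv_nth)
qed

text \<open>A shortest walk is a path: when the walk is extended by an edge to a vertex that was
  already visited, it is cut back to the first visit.\<close>
lemma linked_path_lists:
  assumes "linked G F x y"
  shows "\<exists>vs es. distinct vs \<and> length vs = length es + 1 \<and> hd vs = x \<and> last vs = y \<and> set es \<subseteq> F \<and>
      (\<forall>i<length es. ends G (es ! i) = {vs ! i, vs ! (i + 1)})"
  using assms
proof (induction rule: linked_induct)
  case refl
  show ?case by (intro exI[of _ "[x]"] exI[of _ "[]"]) simp
next
  case (step y z e)
  then obtain vs es where *: "distinct vs" "length vs = length es + 1" "hd vs = x" "last vs = y"
     "set es \<subseteq> F" "\<forall>i<length es. ends G (es ! i) = {vs ! i, vs ! (i + 1)}"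
    by blast
  have ne: "vs \<noteq> []" using *(2) by auto
  show ?case
  proof (cases "z \<in> set vs")
    case True
    then obtain j where j: "j < length vs" "vs ! j = z" by (auto simp: in_set_conv_nth)
    show ?thesis
    proof (intro exI[of _ "take (Suc j) vs"] exI[of _ "take j es"] conjI allI impI)
      show "last (take (Suc j) vs) = z" using j by (simp add: take_Suc_conv_app_nth)
      show "set (take j es) \<subseteq> F" using *(5) set_take_subset by fastforce
    qed (use * ne j in auto)
  next
    case False
    show ?thesis
    proof (intro exI[of _ "vs @ [z]"] exI[of _ "es @ [e]"] conjI allI impI)
      fix i assume "i < length (es @ [e])"
      then consider "i < length es" | "i = length es" by fastforce
      then show "ends G ((es @ [e]) ! i) = {(vs @ [z]) ! i, (vs @ [z]) ! (i + 1)}"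
      proof cases
        case 2
        then have "vs ! i = y" using * ne by (simp add: last_conv_nth)
        then show ?thesis using 2 * step by (simp add: nth_append)
      qed (use * in \<open>auto simp: nth_append\<close>)
    qed (use * ne False step in auto)
  qed
qed

lemma linked_path:
  assumes G: "wf_mgraph G" and "F \<subseteq> edges G" "linked G F x y" "x \<in> verts G"
  shows "\<exists>P. subgraph P G \<and> path_between P x y \<and> edges P \<subseteq> F \<and> ends P = ends G"
proof -
  obtain vs es where *: "distinct vs" "length vs = length es + 1" "hd vs = x" "last vs = y"
     "set es \<subseteq> F" "\<forall>i<length es. ends G (es ! i) = {vs ! i, vs ! (i + 1)}"
    using linked_path_lists[OF assms(3)] by blast
  let ?P = "\<lparr>verts = set vs, edges = set es, ends = ends G\<rparr>"
  have ne: "vs \<noteq> []" using *(2) by auto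
  have "i < length vs \<Longrightarrow> vs ! i \<in> verts G" for i
  proof (cases i)
    case 0
    then show ?thesis using * ne assms(4) by (simp add: hd_conv_nth)
  next
    case (Suc j)
    assume "i < length vs"
    then have "j < length es" using Suc * by auto
    then have "vs ! i \<in> ends G (es ! j)" using * Suc by auto
    moreover have "es ! j \<in> edges G" using * assms(2) nth_mem[OF \<open>j < length es\<close>] by blast
    ultimately show ?thesis using G by (auto simp: wf_mgraph_def)
  qed
  then have V: "set vs \<subseteq> verts G" by (auto simp: in_set_conv_nth)
  have "ends G e \<subseteq> set vs" if e: "e \<in> set es" for e
  proof -
    obtain i where "i < length es" "es ! i = e" using e by (auto simp: in_set_conv_nth)
    then have "ends G e = {vs ! i, vs ! (i + 1)}" "i < length vs" "i + 1 < length vs" using * by auto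
    then show ?thesis by simp
  qed
  moreover have "set es \<subseteq> edges G" using * assms(2) by blast
  ultimately have "subgraph ?P G" using V G unfolding subgraph_def wf_mgraph_def by auto
  moreover have "path_between ?P x y" unfolding path_between_def using * by auto
  ultimately show ?thesis using * by (intro exI[of _ ?P]) auto
qed

lemma subgraph_path_linked:
  assumes "subgraph P G" "path_between P x y"
  shows "linked G (edges P) x y"
  using path_between_linked[OF assms(2)] linked_cong[of "edges P" P G] assms(1)
  by (auto simp: subgraph_def)

lemma reachable_iff_linked:
  assumes "wf_mgraph G" "x \<in> verts G"
  shows "reachable G x y \<longleftrightarrow> linked G (edges G) x y"
proof
  assume "reachable G x y"
  then obtain P where "subgraph P G" "path_between P x y" by (auto simp: reachable_def)
  then show "linked G (edges G) x y"
    using subgraph_path_linked linked_mono unfolding subgraph_def by metis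
next
  assume "linked G (edges G) x y"
  then show "reachable G x y" using linked_path[of G "edges G" x y] assms by (auto simp: reachable_def)
qed

lemma wf_ends_pair:
  assumes "wf_mgraph G" "e \<in> edges G"
  obtains x y where "ends G e = {x, y}" "x \<noteq> y" "x \<in> verts G" "y \<in> verts G"
proof -
  have "card (ends G e) = 2" "ends G e \<subseteq> verts G" using assms by (auto simp: wf_mgraph_def)
  then show ?thesis using that by (auto simp: card_2_iff)
qed

text \<open>An immersion is determined up to irrelevant choices by disjoint edge sets that link
  the images of the ends; in this form immersions compose without surgery on paths.\<close>
definition links_immersion ::
  "('u, 'f) mgraph \<Rightarrow> ('v, 'e) mgraph \<Rightarrow> ('u \<Rightarrow> 'v) \<Rightarrow> ('f \<Rightarrow> 'e set) \<Rightarrow> bool" where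
  "links_immersion H G p F \<longleftrightarrow> inj_on p (verts H) \<and> p ` verts H \<subseteq> verts G \<and>
     (\<forall>f\<in>edges H. F f \<subseteq> edges G \<and> (\<forall>x y. ends H f = {x, y} \<longrightarrow> linked G (F f) (p x) (p y))) \<and>
     (\<forall>f\<in>edges H. \<forall>f'\<in>edges H. f \<noteq> f' \<longrightarrow> F f \<inter> F f' = {})"

lemma weak_immersion_links:
  assumes "weak_immersion H G p pe"
  shows "links_immersion H G p (\<lambda>f. edges (pe f))"
  using assms subgraph_path_linked unfolding weak_immersion_def links_immersion_def
  by (metis subgraph_def)

lemma links_weak_immersion:
  assumes "wf_mgraph G" "wf_mgraph H" "links_immersion H G p F"
  shows "admits_weak_immersion G H"
proof -
  have "\<exists>P. subgraph P G \<and> edges P \<subseteq> F f \<and> (\<forall>x y. ends H f = {x, y} \<longrightarrow> path_between P (p x) (p y))"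
    if f: "f \<in> edges H" for f
  proof -
    obtain a b where ab: "ends H f = {a, b}" "a \<in> verts H" using wf_ends_pair assms f by metis
    have "F f \<subseteq> edges G" "linked G (F f) (p a) (p b)" "p a \<in> verts G"
      using assms(3) f ab by (auto simp: links_immersion_def)
    from linked_path[OF assms(1) this] obtain P where
      P: "subgraph P G" "path_between P (p a) (p b)" "edges P \<subseteq> F f" by blast
    have "path_between P (p x) (p y)" if "ends H f = {x, y}" for x y
      using that ab P(2) path_between_sym by (auto simp: doubleton_eq_iff)
    with P show ?thesis by blast
  qed
  then obtain pe where pe: "\<And>f. f \<in> edges H \<Longrightarrow> subgraph (pe f) G \<and> edges (pe f) \<subseteq> F f \<and>
      (\<forall>x y. ends H f = {x, y} \<longrightarrow> path_between (pe f) (p x) (p y))" by metis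
  have "weak_immersion H G p pe" unfolding weak_immersion_def
  proof (intro conjI ballI impI)
    fix f f' assume "f \<in> edges H" "f' \<in> edges H" "f \<noteq> f'"
    then have "F f \<inter> F f' = {}" using assms(3) by (auto simp: links_immersion_def)
    then show "edges (pe f) \<inter> edges (pe f') = {}" using pe \<open>f \<in> edges H\<close> \<open>f' \<in> edges H\<close> by blast
  qed (use assms(3) pe in \<open>auto simp: links_immersion_def\<close>)
  then show ?thesis by (auto simp: admits_weak_immersion_def)
qed

lemma admits_iff_links:
  assumes "wf_mgraph G" "wf_mgraph H"
  shows "admits_weak_immersion G H \<longleftrightarrow> (\<exists>p F. links_immersion H G p F)"
  using assms links_weak_immersion weak_immersion_links unfolding admits_weak_immersion_def by metis

lemma links_immersion_trans:
  assumes "links_immersion H K p F" "links_immersion K G q F'"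
  shows "links_immersion H G (q \<circ> p) (\<lambda>f. \<Union>g\<in>F f. F' g)"
  unfolding links_immersion_def
proof (intro conjI ballI allI impI)
  show "inj_on (q \<circ> p) (verts H)"
    using assms unfolding links_immersion_def by (meson comp_inj_on inj_on_subset)
  show "(q \<circ> p) ` verts H \<subseteq> verts G" using assms unfolding links_immersion_def by fastforce
next
  fix f assume f: "f \<in> edges H"
  then have Ff: "F f \<subseteq> edges K" using assms by (auto simp: links_immersion_def)
  then show "(\<Union>g\<in>F f. F' g) \<subseteq> edges G" using assms(2) by (auto simp: links_immersion_def)
  fix x y assume "ends H f = {x, y}"
  then have "linked K (F f) (p x) (p y)" using assms(1) f by (auto simp: links_immersion_def)
  then have "linked G (\<Union>g\<in>F f. F' g) (q (p x)) (q (p y))"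
  proof (rule linked_transfer)
    fix e a b assume e: "e \<in> F f" "ends K e = {a, b}"
    then have "linked G (F' e) (q a) (q b)" using assms(2) Ff by (auto simp: links_immersion_def)
    then show "linked G (\<Union>g\<in>F f. F' g) (q a) (q b)" by (rule linked_mono) (use e in auto)
  qed
  then show "linked G (\<Union>g\<in>F f. F' g) ((q \<circ> p) x) ((q \<circ> p) y)" by simp
next
  fix f f' assume f: "f \<in> edges H" "f' \<in> edges H" "f \<noteq> f'"
  then have "F f \<inter> F f' = {}" "F f \<subseteq> edges K" "F f' \<subseteq> edges K"
    using assms(1) by (auto simp: links_immersion_def)
  moreover have "F' g \<inter> F' g' = {}" if "g \<in> edges K" "g' \<in> edges K" "g \<noteq> g'" for g g'
    using assms(2) that by (auto simp: links_immersion_def)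
  ultimately show "(\<Union>g\<in>F f. F' g) \<inter> (\<Union>g\<in>F f'. F' g) = {}" by blast
qed

lemma admits_weak_immersion_trans:
  assumes "wf_mgraph G" "wf_mgraph K" "wf_mgraph H"
    "admits_weak_immersion G K" "admits_weak_immersion K H"
  shows "admits_weak_immersion G H"
  using assms links_immersion_trans unfolding admits_iff_links[OF assms(1,2)]
    admits_iff_links[OF assms(2,3)] admits_iff_links[OF assms(1,3)] by metis

section \<open>Edge-disjoint paths to a hub\<close>

definition out_arcs :: "('e \<times> 'v \<times> 'v) set \<Rightarrow> 'v set \<Rightarrow> ('e \<times> 'v \<times> 'v) set" where
  "out_arcs D A = {(e, x, y) \<in> D. x \<in> A \<and> y \<notin> A}"

definition demand :: "'i set \<Rightarrow> ('i \<Rightarrow> 'v) \<Rightarrow> 'v set \<Rightarrow> nat" where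
  "demand I src A = card {i \<in> I. src i \<in> A}"

definition enough_arcs :: "('e \<times> 'v \<times> 'v) set \<Rightarrow> 'i set \<Rightarrow> ('i \<Rightarrow> 'v) \<Rightarrow> 'v \<Rightarrow> bool" where
  "enough_arcs D I src h \<longleftrightarrow> (\<forall>A. h \<notin> A \<longrightarrow> demand I src A \<le> card (out_arcs D A))"

lemma finite_out_arcs [simp]: "finite D \<Longrightarrow> finite (out_arcs D A)"
  by (rule finite_subset[of _ D]) (auto simp: out_arcs_def)

lemma demand_modular:
  assumes "finite I"
  shows "demand I src (A \<union> A') + demand I src (A \<inter> A') = demand I src A + demand I src A'"
proof -
  let ?X = "{i \<in> I. src i \<in> A}" and ?X' = "{i \<in> I. src i \<in> A'}"
  have "{i \<in> I. src i \<in> A \<union> A'} = ?X \<union> ?X'" "{i \<in> I. src i \<in> A \<inter> A'} = ?X \<inter> ?X'" by auto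
  moreover have "card ?X + card ?X' = card (?X \<union> ?X') + card (?X \<inter> ?X')"
    by (rule card_Un_Int) (use assms in auto)
  ultimately show ?thesis unfolding demand_def by presburger
qed

text \<open>Arcs between \<open>A - A'\<close> and \<open>A' - A\<close>, in either direction, are lost when the two
  sets are uncrossed.\<close>
lemma out_arcs_submodular:
  assumes D: "finite D"
  shows "card (out_arcs D (A \<union> A')) + card (out_arcs D (A \<inter> A'))
     + card {(e, x, y) \<in> D. x \<in> A - A' \<and> y \<in> A' - A \<or> x \<in> A' - A \<and> y \<in> A - A'}
     \<le> card (out_arcs D A) + card (out_arcs D A')"
proof -
  let ?c = "\<lambda>A. card (out_arcs D A)"
  let ?K = "{(e, x, y) \<in> D. x \<in> A - A' \<and> y \<in> A' - A \<or> x \<in> A' - A \<and> y \<in> A - A'}"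
  have fin: "finite ?K" by (rule finite_subset[OF _ D]) auto
  have sum_out: "card {d \<in> D. Q d} = (\<Sum>d\<in>D. if Q d then 1 else 0)" for Q
    using D by (simp add: sum.If_cases Int_def)
  have e: "out_arcs D X = {d \<in> D. fst (snd d) \<in> X \<and> snd (snd d) \<notin> X}" for X
    by (auto simp: out_arcs_def)
  have k: "?K = {d \<in> D. fst (snd d) \<in> A - A' \<and> snd (snd d) \<in> A' - A
      \<or> fst (snd d) \<in> A' - A \<and> snd (snd d) \<in> A - A'}" by auto
  show ?thesis unfolding e k sum_out sum.distrib[symmetric]
    by (rule sum_mono) auto
qed

lemma tight_union:
  assumes "finite D" "finite I" "enough_arcs D I src h" "h \<notin> A" "h \<notin> A'"
    "demand I src A = card (out_arcs D A)" "demand I src A' = card (out_arcs D A')"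
  shows "demand I src (A \<union> A') = card (out_arcs D (A \<union> A'))"
    and "\<not> (\<exists>(e, x, y) \<in> D. x \<in> A - A' \<and> y \<in> A' - A \<or> x \<in> A' - A \<and> y \<in> A - A')"
proof -
  let ?K = "{(e, x, y) \<in> D. x \<in> A - A' \<and> y \<in> A' - A \<or> x \<in> A' - A \<and> y \<in> A - A'}"
  have fin: "finite ?K" by (rule finite_subset[OF _ assms(1)]) auto
  have "demand I src (A \<union> A') \<le> card (out_arcs D (A \<union> A'))"
    "demand I src (A \<inter> A') \<le> card (out_arcs D (A \<inter> A'))"
    using assms(3-5) by (auto simp: enough_arcs_def)
  then have "demand I src (A \<union> A') = card (out_arcs D (A \<union> A')) \<and> card ?K = 0"
    using out_arcs_submodular[OF assms(1), of A A'] demand_modular[OF assms(2), of src A A'] assms(6,7)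
    by linarith
  with fin show "demand I src (A \<union> A') = card (out_arcs D (A \<union> A'))"
    "\<not> (\<exists>(e, x, y) \<in> D. x \<in> A - A' \<and> y \<in> A' - A \<or> x \<in> A' - A \<and> y \<in> A - A')"
    by (auto simp: card_eq_0_iff)
qed

text \<open>The step of the proof of Menger's theorem: one unit of demand can always be pushed along
  an arc that is then given up. The head \<open>y\<close> has to avoid all tight sets that miss \<open>x\<close>; their
  union is tight, so if it contained all out-neighbours of \<open>x\<close>, adding \<open>x\<close> would violate the
  cut condition.\<close>
lemma push_arc:
  fixes src :: "'i \<Rightarrow> 'v" and D :: "('e \<times> 'v \<times> 'v) set"
  assumes D: "finite D" and I: "finite I" and en: "enough_arcs D I src h"
    and i: "i \<in> I" "src i \<noteq> h"
  obtains e y where "(e, src i, y) \<in> D" "enough_arcs (D - {(e, src i, y)}) I (src(i := y)) h"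
proof -
  let ?x = "src i"
  let ?V = "(fst \<circ> snd) ` D \<union> (snd \<circ> snd) ` D"
  define tight where "tight A \<longleftrightarrow> h \<notin> A \<and> ?x \<notin> A \<and> demand I src A = card (out_arcs D A)" for A
  have tight_V: "tight (A \<inter> ?V)" if "tight A" for A
  proof -
    have "out_arcs D (A \<inter> ?V) = out_arcs D A" by (force simp: out_arcs_def)
    moreover have "demand I src (A \<inter> ?V) \<le> demand I src A"
      unfolding demand_def by (rule card_mono) (use I in auto)
    moreover have "demand I src A \<le> demand I src (A \<inter> ?V)"
    proof -
      have "demand I src (A - ?V) \<le> card (out_arcs D (A - ?V))" 
        using en that by (auto simp: enough_arcs_def tight_def)
      moreover have "out_arcs D (A - ?V) = {}" by (force simp: out_arcs_def)
      ultimately have "demand I src (A - ?V) = 0" by simp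
      moreover have "(A \<inter> ?V) \<union> (A - ?V) = A" by auto
      ultimately show ?thesis using demand_modular[OF I, of src "A \<inter> ?V" "A - ?V"] by simp
    qed
    ultimately show ?thesis using that by (auto simp: tight_def)
  qed
  let ?S = "{A. A \<subseteq> ?V \<and> tight A}"
  have "demand I src {} = 0" "out_arcs D {} = {}" by (auto simp: demand_def out_arcs_def)
  then have "{} \<in> ?S" by (simp add: tight_def)
  then have "\<exists>M\<in>?S. \<forall>A\<in>?S. M \<subseteq> A \<longrightarrow> M = A"
    by (intro finite_has_maximal) (use D in auto)
  then obtain M where "M \<in> ?S" and max': "\<forall>A\<in>?S. M \<subseteq> A \<longrightarrow> M = A" ..
  then have M: "M \<subseteq> ?V" "tight M" by auto
  have max: "A = M" if "A \<subseteq> ?V" "tight A" "M \<subseteq> A" for A using max' that by auto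
  have sub: "A \<inter> ?V \<subseteq> M" if "tight A" for A
  proof -
    have "tight (A \<inter> ?V)" using tight_V that by blast
    then have "tight (M \<union> (A \<inter> ?V))"
      using M tight_union(1)[OF D I en, of M "A \<inter> ?V"] unfolding tight_def by auto
    then show ?thesis using max[of "M \<union> (A \<inter> ?V)"] M by blast
  qed
  have "demand I src (insert ?x M) \<le> card (out_arcs D (insert ?x M))"
    using en M i unfolding enough_arcs_def tight_def by auto
  moreover have "demand I src (insert ?x M) > demand I src M"
    unfolding demand_def by (rule psubset_card_mono) (use I i M in \<open>auto simp: tight_def\<close>)
  ultimately have "card (out_arcs D (insert ?x M)) > card (out_arcs D M)"
    using M by (auto simp: tight_def)
  then have "\<not> out_arcs D (insert ?x M) \<subseteq> out_arcs D M"
    using card_mono[OF finite_out_arcs[OF D]] not_le by blast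
  then obtain e y where ey: "(e, ?x, y) \<in> D" "y \<noteq> ?x" "y \<notin> M" by (auto simp: out_arcs_def)
  let ?D' = "D - {(e, ?x, y)}" and ?s' = "src(i := y)"
  have "demand I ?s' A \<le> card (out_arcs ?D' A)" if h: "h \<notin> A" for A
  proof -
    have dem: "demand I src A \<le> card (out_arcs D A)" using en h by (auto simp: enough_arcs_def)
    have J: "demand I s A = card {j \<in> I - {i}. s j \<in> A} + (if s i \<in> A then 1 else 0)" for s :: "'i \<Rightarrow> 'v"
    proof -
      have "{j \<in> I. s j \<in> A} = {j \<in> I - {i}. s j \<in> A} \<union> (if s i \<in> A then {i} else {})" using i by auto
      then show ?thesis unfolding demand_def using I by (auto simp: card_insert_if)
    qed
    have J': "{j \<in> I - {i}. ?s' j \<in> A} = {j \<in> I - {i}. src j \<in> A}" by auto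
    have eq: "demand I ?s' A + (if ?x \<in> A then 1 else 0) = demand I src A + (if y \<in> A then 1 else 0)"
      using J[of ?s'] J[of src] unfolding J' by simp
    show ?thesis
    proof (cases "?x \<in> A \<and> y \<notin> A")
      case True
      then have "(e, ?x, y) \<in> out_arcs D A" "out_arcs ?D' A = out_arcs D A - {(e, ?x, y)}"
        using ey by (auto simp: out_arcs_def)
      then have "card (out_arcs D A) = Suc (card (out_arcs ?D' A))"
        using card.remove[OF finite_out_arcs[OF D]] by metis
      then show ?thesis using eq dem True by simp
    next
      case False
      then have same: "out_arcs ?D' A = out_arcs D A" by (auto simp: out_arcs_def)
      show ?thesis
      proof (cases "y \<in> A \<and> ?x \<notin> A")
        case True
        have "y \<in> ?V" using ey by force
        then have "\<not> tight A" using sub True ey by blast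
        then have "demand I src A < card (out_arcs D A)" using dem True h by (auto simp: tight_def)
        then show ?thesis using eq same True by simp
      next
        case False
        then show ?thesis using eq same dem \<open>\<not> (?x \<in> A \<and> y \<notin> A)\<close> by (auto split: if_splits)
      qed
    qed
  qed
  with ey that show thesis by (auto simp: enough_arcs_def)
qed

lemma arc_disjoint_walks:
  assumes "finite D" "finite I" "enough_arcs D I src h"
  shows "\<exists>Q. (\<forall>i\<in>I. Q i \<subseteq> D \<and> (src i, h) \<in> {(x, y). \<exists>e. (e, x, y) \<in> Q i}\<^sup>*) \<and>
     (\<forall>i\<in>I. \<forall>j\<in>I. i \<noteq> j \<longrightarrow> Q i \<inter> Q j = {})"
  using assms
proof (induction "card D" arbitrary: D src rule: less_induct)
  case less
  show ?case
  proof (cases "\<forall>i\<in>I. src i = h")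
    case True
    then show ?thesis by (intro exI[of _ "\<lambda>_. {}"]) auto
  next
    case False
    then obtain i where i: "i \<in> I" "src i \<noteq> h" by blast
    obtain e y where ey: "(e, src i, y) \<in> D" "enough_arcs (D - {(e, src i, y)}) I (src(i := y)) h"
      using push_arc[OF less.prems i] .
    let ?a = "(e, src i, y)"
    have "card (D - {?a}) < card D" using ey less.prems by (meson card_Diff1_less)
    then have "\<exists>Q. (\<forall>j\<in>I. Q j \<subseteq> D - {?a} \<and>
          ((src(i := y)) j, h) \<in> {(x, y). \<exists>e. (e, x, y) \<in> Q j}\<^sup>*) \<and>
        (\<forall>j\<in>I. \<forall>j'\<in>I. j \<noteq> j' \<longrightarrow> Q j \<inter> Q j' = {})"
      by (rule less.hyps) (use less.prems ey in \<open>simp_all del: fun_upd_apply\<close>)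
    then obtain Q where Q': "\<forall>j\<in>I. Q j \<subseteq> D - {?a} \<and>
          ((src(i := y)) j, h) \<in> {(x, y). \<exists>e. (e, x, y) \<in> Q j}\<^sup>*"
        "\<forall>j\<in>I. \<forall>j'\<in>I. j \<noteq> j' \<longrightarrow> Q j \<inter> Q j' = {}" by (elim exE conjE)
    then have Q: "\<And>j. j \<in> I \<Longrightarrow> Q j \<subseteq> D - {?a}"
        "\<And>j. j \<in> I \<Longrightarrow> ((src(i := y)) j, h) \<in> {(x, y). \<exists>e. (e, x, y) \<in> Q j}\<^sup>*"
        "\<And>j j'. j \<in> I \<Longrightarrow> j' \<in> I \<Longrightarrow> j \<noteq> j' \<Longrightarrow> Q j \<inter> Q j' = {}" by blast+
    let ?Q = "Q(i := insert ?a (Q i))"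
    have "(src j, h) \<in> {(x, y). \<exists>e. (e, x, y) \<in> ?Q j}\<^sup>*" if "j \<in> I" for j
    proof (cases "j = i")
      case True
      have "(y, h) \<in> {(x, y). \<exists>e. (e, x, y) \<in> Q i}\<^sup>*" using Q(2)[of i] i by simp
      then have "(y, h) \<in> {(x, y). \<exists>e. (e, x, y) \<in> ?Q i}\<^sup>*"
        by (rule rtrancl_mono[THEN subsetD, rotated]) auto
      moreover have "(src i, y) \<in> {(x, y). \<exists>e. (e, x, y) \<in> ?Q i}" by auto
      ultimately have "(src i, h) \<in> {(x, y). \<exists>e. (e, x, y) \<in> ?Q i}\<^sup>*"
        by (rule converse_rtrancl_into_rtrancl[rotated])
      then show ?thesis using True by simp
    next
      case False
      then show ?thesis using Q(2)[OF that] by simp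
    qed
    moreover have "?Q j \<subseteq> D" if "j \<in> I" for j using Q(1) that ey by auto
    moreover have "?Q j \<inter> ?Q j' = {}" if "j \<in> I" "j' \<in> I" "j \<noteq> j'" for j j'
      using Q(1)[OF that(1)] Q(1)[OF that(2)] Q(3)[OF that] that by auto
    ultimately show ?thesis by (intro exI[of _ ?Q]) blast
  qed
qed

text \<open>Edge version of Menger's theorem with one sink and several sources. Each edge is replaced by
  its two arcs and a minimal sufficient set of arcs is kept. It does not contain both
  arcs of an edge: each would leave a tight set, and these two sets would cross with
  an arc between their differences. So arc-disjoint walks are edge-disjoint.\<close>
theorem edge_disjoint_links:
  assumes G: "wf_mgraph G" and I: "finite I"
    and cuts: "\<And>A. A \<subseteq> verts G \<Longrightarrow> h \<notin> A \<Longrightarrow> card {i \<in> I. src i \<in> A} \<le> card (cut G A)"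
    and src: "\<And>i. i \<in> I \<Longrightarrow> src i \<in> verts G"
  shows "\<exists>F. (\<forall>i\<in>I. F i \<subseteq> edges G \<and> linked G (F i) (src i) h) \<and>
    (\<forall>i\<in>I. \<forall>j\<in>I. i \<noteq> j \<longrightarrow> F i \<inter> F j = {})"
proof -
  let ?D0 = "{(e, x, y). e \<in> edges G \<and> ends G e = {x, y} \<and> x \<noteq> y}"
  have "?D0 \<subseteq> edges G \<times> verts G \<times> verts G" using G by (auto simp: wf_mgraph_def)
  then have fin0: "finite ?D0" by (rule finite_subset) (use G in \<open>auto simp: wf_mgraph_def\<close>)
  have "enough_arcs ?D0 I src h" unfolding enough_arcs_def
  proof (intro allI impI)
    fix A assume h: "h \<notin> A"
    have "{i \<in> I. src i \<in> A} = {i \<in> I. src i \<in> A \<inter> verts G}" using src by auto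
    then have "demand I src A \<le> card (cut G (A \<inter> verts G))"
      using cuts[of "A \<inter> verts G"] h by (simp add: demand_def)
    also have "\<dots> \<le> card (out_arcs ?D0 A)"
    proof (rule surj_card_le[OF finite_out_arcs[OF fin0]])
      show "cut G (A \<inter> verts G) \<subseteq> fst ` out_arcs ?D0 A"
      proof
      fix e assume e: "e \<in> cut G (A \<inter> verts G)"
      then have eG: "e \<in> edges G" by (simp add: cut_def)
      obtain x y where xy: "ends G e = {x, y}" "x \<noteq> y" "x \<in> verts G" "y \<in> verts G"
        using wf_ends_pair[OF G eG] .
      have "card ({x, y} \<inter> (A \<inter> verts G)) = 1" using e xy by (simp add: cut_def)
      then have "x \<in> A \<and> y \<notin> A \<or> y \<in> A \<and> x \<notin> A" using xy
        by (cases "x \<in> A"; cases "y \<in> A") auto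
      then show "e \<in> fst ` out_arcs ?D0 A"
      proof
        assume "x \<in> A \<and> y \<notin> A"
        then have "(e, x, y) \<in> out_arcs ?D0 A" using xy eG by (simp add: out_arcs_def)
        then show ?thesis by (rule image_eqI[rotated]) simp
      next
        assume "y \<in> A \<and> x \<notin> A"
        then have "(e, y, x) \<in> out_arcs ?D0 A" using xy eG by (simp add: out_arcs_def insert_commute)
        then show ?thesis by (rule image_eqI[rotated]) simp
      qed
     qed
    qed
    finally show "demand I src A \<le> card (out_arcs ?D0 A)" .
  qed
  then have ne: "?D0 \<in> {D. D \<subseteq> ?D0 \<and> enough_arcs D I src h}" by simp
  have finS: "finite {D. D \<subseteq> ?D0 \<and> enough_arcs D I src h}" using fin0 by simp
  obtain D where D: "D \<subseteq> ?D0" "enough_arcs D I src h"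
    and min: "\<And>D'. D' \<subseteq> D \<Longrightarrow> enough_arcs D' I src h \<Longrightarrow> D' = D"
  proof -
    let ?S = "{D. D \<subseteq> ?D0 \<and> enough_arcs D I src h}"
    have "\<exists>D\<in>?S. \<forall>D'\<in>?S. D' \<subseteq> D \<longrightarrow> D = D'"
      by (rule finite_has_minimal) (use ne finS in auto)
    then obtain D where "D \<in> ?S" "\<forall>D'\<in>?S. D' \<subseteq> D \<longrightarrow> D = D'" ..
    then show thesis using that[of D] subset_trans[of _ D ?D0] by (metis (no_types, lifting) mem_Collect_eq)
  qed
  have fin: "finite D" using D(1) fin0 finite_subset by blast
  have tight: "\<exists>A. h \<notin> A \<and> x \<in> A \<and> y \<notin> A \<and> demand I src A = card (out_arcs D A)"
    if a: "(e, x, y) \<in> D" for e x y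
  proof -
    have "\<not> enough_arcs (D - {(e, x, y)}) I src h" using min[of "D - {(e, x, y)}"] a by auto
    then obtain A where A: "h \<notin> A" "demand I src A > card (out_arcs (D - {(e, x, y)}) A)"
      by (auto simp: enough_arcs_def not_le)
    have le: "demand I src A \<le> card (out_arcs D A)" using D A by (auto simp: enough_arcs_def)
    have "x \<in> A \<and> y \<notin> A"
    proof (rule ccontr)
      assume "\<not> ?thesis"
      then have "out_arcs (D - {(e, x, y)}) A = out_arcs D A" by (auto simp: out_arcs_def)
      then show False using le A by simp
    qed
    moreover have "card (out_arcs D A) \<le> Suc (card (out_arcs (D - {(e, x, y)}) A))"
    proof -
      have "out_arcs D A \<subseteq> insert (e, x, y) (out_arcs (D - {(e, x, y)}) A)" by (auto simp: out_arcs_def)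
      then have "card (out_arcs D A) \<le> card (insert (e, x, y) (out_arcs (D - {(e, x, y)}) A))"
        using fin by (intro card_mono) auto
      then show ?thesis using fin by (auto simp: card_insert_if split: if_splits)
    qed
    ultimately show ?thesis using le A by (intro exI[of _ A]) auto
  qed
  have one: "\<not> ((e, x, y) \<in> D \<and> (e', y, x) \<in> D)" for e e' x y
  proof
    assume *: "(e, x, y) \<in> D \<and> (e', y, x) \<in> D"
    obtain A where A: "h \<notin> A" "x \<in> A" "y \<notin> A" "demand I src A = card (out_arcs D A)" using * tight by blast
    obtain A' where A': "h \<notin> A'" "y \<in> A'" "x \<notin> A'" "demand I src A' = card (out_arcs D A')" using * tight by blast
    show False using tight_union(2)[OF fin I D(2) A(1) A'(1) A(4) A'(4)] * A A' by blast
  qed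
  obtain Q where Q: "\<forall>i\<in>I. Q i \<subseteq> D \<and> (src i, h) \<in> {(x, y). \<exists>e. (e, x, y) \<in> Q i}\<^sup>*"
     "\<forall>i\<in>I. \<forall>j\<in>I. i \<noteq> j \<longrightarrow> Q i \<inter> Q j = {}"
    using arc_disjoint_walks[OF fin I D(2)] by blast
  show ?thesis
  proof (intro exI[of _ "\<lambda>i. fst ` Q i"] conjI ballI impI)
    fix i assume i: "i \<in> I"
    then have Qi: "Q i \<subseteq> ?D0" using Q D(1) by blast
    then show "fst ` Q i \<subseteq> edges G" by auto
    have "{(x, y). \<exists>e. (e, x, y) \<in> Q i} \<subseteq> adj G (fst ` Q i)"
    proof clarify
      fix x y e assume "(e, x, y) \<in> Q i"
      moreover from this have "ends G e = {x, y}" using Qi by blast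
      ultimately show "(x, y) \<in> adj G (fst ` Q i)" unfolding adj_def by force
    qed
    then show "linked G (fst ` Q i) (src i) h"
      unfolding linked_def using Q(1) i rtrancl_mono by blast
    fix j assume j: "j \<in> I" "i \<noteq> j"
    show "fst ` Q i \<inter> fst ` Q j = {}"
    proof (rule ccontr)
      assume "fst ` Q i \<inter> fst ` Q j \<noteq> {}"
      then obtain e x y x' y' where *: "(e, x, y) \<in> Q i" "(e, x', y') \<in> Q j" by force
      then have "(e, x, y) \<in> D" "(e, x', y') \<in> D" using Q(1) i j by blast+
      moreover from this have "{x, y} = {x', y'}" using D(1) by blast
      ultimately have "x = x' \<and> y = y'" using one by (auto simp: doubleton_eq_iff)
      then show False using * Q(2) i j by blast
    qed
  qed
qed

section \<open>Cut conditions that force immersions\<close>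

lemma cut_iff:
  assumes "e \<in> edges G" "ends G e = {x, y}" "x \<noteq> y"
  shows "e \<in> cut G A \<longleftrightarrow> (x \<in> A \<longleftrightarrow> y \<notin> A)"
  using assms by (cases "x \<in> A"; cases "y \<in> A") (auto simp: cut_def)

lemma cut_subset_edges: "cut G A \<subseteq> edges G"
  by (auto simp: cut_def)

lemma finite_cut: "wf_mgraph G \<Longrightarrow> finite (cut G A)"
  by (rule finite_subset[OF cut_subset_edges]) (simp add: wf_mgraph_def)

lemma cut_empty [simp]: "cut G {} = {}"
  by (simp add: cut_def)

lemma cut_complement:
  assumes "wf_mgraph G"
  shows "cut G (verts G - A) = cut G A"
proof -
  have "e \<in> cut G (verts G - A) \<longleftrightarrow> e \<in> cut G A" if e: "e \<in> edges G" for e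
  proof -
    obtain x y where xy: "ends G e = {x, y}" "x \<noteq> y" "x \<in> verts G" "y \<in> verts G"
      using wf_ends_pair[OF assms e] .
    then show ?thesis unfolding cut_iff[OF e xy(1,2)] by auto
  qed
  then show ?thesis using cut_subset_edges[of G] by blast
qed

lemma cut_singleton_degree:
  assumes "wf_mgraph G"
  shows "cut G {v} = {e \<in> edges G. v \<in> ends G e}"
  by (auto simp: cut_def Int_insert_right)

lemma card_cut_singleton: "wf_mgraph G \<Longrightarrow> card (cut G {v}) = degree G v"
  by (simp add: cut_singleton_degree degree_def)

text \<open>Every vertex of \<open>H\<close> sends one path to the hub for each edge at it; the two
  paths of an edge meet at the hub.\<close>
lemma immersion_through_hub:
  fixes G :: "('v, 'e) mgraph" and H :: "('u, 'f) mgraph"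
  assumes G: "wf_mgraph G" and H: "wf_mgraph H"
    and deg: "\<And>u. u \<in> verts H \<Longrightarrow> degree H u \<le> d"
    and p: "inj_on p (verts H)" "p ` verts H \<subseteq> verts G"
    and cuts: "\<And>A. A \<subseteq> verts G \<Longrightarrow> h \<notin> A \<Longrightarrow> d * card (A \<inter> p ` verts H) \<le> card (cut G A)"
  shows "admits_weak_immersion G H"
proof -
  let ?I = "{(u, f). f \<in> edges H \<and> u \<in> ends H f}"
  define src :: "'u \<times> 'f \<Rightarrow> 'v" where "src = p \<circ> fst"
  have HE: "\<And>f. f \<in> edges H \<Longrightarrow> ends H f \<subseteq> verts H" using H by (auto simp: wf_mgraph_def)
  have "?I \<subseteq> verts H \<times> edges H" using HE by auto
  then have I: "finite ?I" by (rule finite_subset) (use H in \<open>auto simp: wf_mgraph_def\<close>)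
  have fV: "finite (verts H)" "finite (edges H)" using H by (auto simp: wf_mgraph_def)
  have dem: "card {i \<in> ?I. src i \<in> A} \<le> card (cut G A)" if A: "A \<subseteq> verts G" "h \<notin> A" for A
  proof -
    let ?U = "{u \<in> verts H. p u \<in> A}"
    have "{i \<in> ?I. src i \<in> A} = (SIGMA u:?U. {f \<in> edges H. u \<in> ends H f})"
      using HE by (auto simp: src_def)
    then have "card {i \<in> ?I. src i \<in> A} = (\<Sum>u\<in>?U. degree H u)"
      using fV by (simp add: degree_def)
    also have "\<dots> \<le> (\<Sum>u\<in>?U. d)" by (rule sum_mono) (use deg in auto)
    also have "\<dots> = d * card ?U" by simp
    also have "card ?U = card (p ` ?U)" using p by (intro card_image[symmetric]) (auto intro: inj_on_subset)
    also have "p ` ?U = A \<inter> p ` verts H" by auto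
    finally show ?thesis using cuts[OF A] by linarith
  qed
  have srcV: "src i \<in> verts G" if "i \<in> ?I" for i
  proof -
    obtain u f where i: "i = (u, f)" "f \<in> edges H" "u \<in> ends H f" using \<open>i \<in> ?I\<close> by auto
    then have "u \<in> verts H" using HE by blast
    then show ?thesis using p i by (auto simp: src_def)
  qed
  obtain F where "\<forall>i\<in>?I. F i \<subseteq> edges G \<and> linked G (F i) (src i) h"
      "\<forall>i\<in>?I. \<forall>j\<in>?I. i \<noteq> j \<longrightarrow> F i \<inter> F j = {}"
  proof -
    have "\<exists>F. (\<forall>i\<in>?I. F i \<subseteq> edges G \<and> linked G (F i) (src i) h) \<and>
        (\<forall>i\<in>?I. \<forall>j\<in>?I. i \<noteq> j \<longrightarrow> F i \<inter> F j = {})"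
      by (rule edge_disjoint_links[OF G I]) (rule dem srcV; assumption)+
    then show thesis using that by (elim exE conjE)
  qed
  then have F: "\<And>i. i \<in> ?I \<Longrightarrow> F i \<subseteq> edges G" "\<And>i. i \<in> ?I \<Longrightarrow> linked G (F i) (src i) h"
    "\<And>i j. i \<in> ?I \<Longrightarrow> j \<in> ?I \<Longrightarrow> i \<noteq> j \<Longrightarrow> F i \<inter> F j = {}"
    by blast+
  let ?F = "\<lambda>f. \<Union>u\<in>ends H f. F (u, f)"
  have "links_immersion H G p ?F" unfolding links_immersion_def
  proof (intro conjI ballI allI impI)
    fix f x y assume f: "f \<in> edges H" "ends H f = {x, y}"
    have "linked G (F (x, f)) (p x) h" "linked G (F (y, f)) (p y) h"
      using F(2)[of "(x, f)"] F(2)[of "(y, f)"] f by (simp_all add: src_def)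
    then have "linked G (?F f) (p x) h" "linked G (?F f) (p y) h"
      using linked_mono[of G "F (x, f)" "p x" h "?F f"] linked_mono[of G "F (y, f)" "p y" h "?F f"] f by auto
    then show "linked G (?F f) (p x) (p y)" using linked_sym linked_trans by metis
  next
    fix f f' assume "f \<in> edges H" "f' \<in> edges H" "f \<noteq> f'"
    then have "F (u, f) \<inter> F (u', f') = {}" if "u \<in> ends H f" "u' \<in> ends H f'" for u u'
      using F(3)[of "(u, f)" "(u', f')"] that by auto
    then show "?F f \<inter> ?F f' = {}" by blast
  next
    fix f assume "f \<in> edges H" then show "?F f \<subseteq> edges G" using F(1) by force
  qed (use p in auto)
  then show ?thesis by (rule links_weak_immersion[OF G H])
qed

text \<open>The contracted vertex is called \<open>v\<close>, a vertex of \<open>W\<close>, so that the induction below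
  stays within one type of vertices.\<close>
definition contract :: "('v, 'e) mgraph \<Rightarrow> 'v set \<Rightarrow> 'v \<Rightarrow> ('v, 'e) mgraph" where
  "contract G W v = \<lparr>verts = insert v (verts G - W), edges = {e \<in> edges G. \<not> ends G e \<subseteq> W},
     ends = \<lambda>e. (\<lambda>x. if x \<in> W then v else x) ` ends G e\<rparr>"

lemma contract_wf:
  assumes G: "wf_mgraph G" and v: "v \<in> W"
  shows "wf_mgraph (contract G W v)"
proof -
  let ?q = "\<lambda>x. if x \<in> W then v else x"
  have "?q ` ends G e \<subseteq> insert v (verts G - W) \<and> card (?q ` ends G e) = 2"
    if e: "e \<in> edges G" "\<not> ends G e \<subseteq> W" for e
  proof -
    obtain x y where "ends G e = {x, y}" "x \<noteq> y" "x \<in> verts G" "y \<in> verts G"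
      using wf_ends_pair[OF G e(1)] .
    moreover from this have "?q x \<noteq> ?q y" using e v by auto
    moreover have "?q ` ends G e = {?q x, ?q y}" unfolding calculation(1) image_insert image_empty ..
    ultimately show ?thesis using v by simp
  qed
  then show ?thesis using G by (auto simp: wf_mgraph_def contract_def)
qed

lemma cut_contract:
  assumes G: "wf_mgraph G" and Z: "Z \<inter> W = {}" and v: "v \<in> W"
  shows "cut (contract G W v) Z = cut G Z"
proof -
  let ?q = "\<lambda>x. if x \<in> W then v else x"
  have "e \<in> cut (contract G W v) Z \<longleftrightarrow> e \<in> cut G Z" if e: "e \<in> edges G" for e
  proof -
    obtain x y where xy: "ends G e = {x, y}" "x \<noteq> y" "x \<in> verts G" "y \<in> verts G"
      using wf_ends_pair[OF G e] .
    show ?thesis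
    proof (cases "ends G e \<subseteq> W")
      case True
      then have "ends G e \<inter> Z = {}" using Z by blast
      then show ?thesis using True by (simp add: contract_def cut_def)
    next
      case False
      then have eC: "e \<in> edges (contract G W v)" using e by (simp add: contract_def)
      have eq: "ends (contract G W v) e = {?q x, ?q y}" using xy by (simp add: contract_def)
      have ne: "?q x \<noteq> ?q y" using xy v False by auto
      show ?thesis unfolding cut_iff[OF e xy(1,2)] cut_iff[OF eC eq ne] using Z v by auto
    qed
  qed
  then show ?thesis using cut_subset_edges[of G] by (auto simp: cut_def contract_def)
qed

text \<open>If no cut around \<open>v\<close> inside \<open>W\<close> is smaller than the cut of \<open>W\<close>, then the edges leaving \<open>W\<close>
  extend to edge-disjoint paths inside \<open>W\<close> that end in \<open>v\<close>.\<close>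
lemma contract_immersed:
  assumes G: "wf_mgraph G" and W: "W \<subseteq> verts G" "v \<in> W"
    and min: "\<And>Z. v \<in> Z \<Longrightarrow> Z \<subseteq> W \<Longrightarrow> card (cut G W) \<le> card (cut G Z)"
  shows "admits_weak_immersion G (contract G W v)"
proof -
  define src where "src e = (SOME x. x \<in> ends G e \<inter> W)" for e
  have src: "src e \<in> ends G e \<inter> W" if "e \<in> cut G W" for e
  proof -
    have "ends G e \<inter> W \<noteq> {}" using that by (auto simp: cut_def)
    then show ?thesis unfolding src_def by (meson all_not_in_conv someI_ex)
  qed
  have srcE: "\<exists>b. ends G e = {src e, b} \<and> b \<notin> W \<and> b \<in> verts G" if e: "e \<in> cut G W" for e
  proof -
    have eG: "e \<in> edges G" using e by (simp add: cut_def)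
    obtain x y where xy: "ends G e = {x, y}" "x \<noteq> y" "x \<in> verts G" "y \<in> verts G"
      using wf_ends_pair[OF G eG] .
    then show ?thesis using src[OF e] e cut_iff[OF eG xy(1,2), of W] by (auto simp: insert_commute)
  qed
  let ?GW = "\<lparr>verts = W, edges = {e \<in> edges G. ends G e \<subseteq> W}, ends = ends G\<rparr>"
  have GW: "wf_mgraph ?GW" using G W finite_subset by (auto simp: wf_mgraph_def)
  have I: "finite (cut G W)" using finite_cut[OF G] .
  have dem: "card {e \<in> cut G W. src e \<in> A} \<le> card (cut ?GW A)" if A: "A \<subseteq> W" "v \<notin> A" for A
  proof -
    have sub: "cut G (W - A) \<subseteq> {e \<in> cut G W. src e \<notin> A} \<union> cut ?GW A"
    proof
      fix e assume e: "e \<in> cut G (W - A)"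
      then have eG: "e \<in> edges G" by (simp add: cut_def)
      obtain x y where xy: "ends G e = {x, y}" "x \<in> W - A" "y \<notin> W - A" "x \<noteq> y"
      proof -
        obtain a b where "ends G e = {a, b}" "a \<noteq> b" using wf_ends_pair[OF G eG] .
        then show thesis using that e cut_iff[OF eG, of a b "W - A"] by (auto simp: insert_commute)
      qed
      show "e \<in> {e \<in> cut G W. src e \<notin> A} \<union> cut ?GW A"
      proof (cases "y \<in> A")
        case True
        then show ?thesis using xy A eG cut_iff[of e ?GW x y A] by auto
      next
        case False
        then have "e \<in> cut G W" using cut_iff[OF eG xy(1) xy(4), of W] xy by auto
        moreover have "src e \<notin> A" using src[OF calculation] xy False by auto
        ultimately show ?thesis by blast
      qed
    qed
    have "card (cut G W) = card {e \<in> cut G W. src e \<in> A} + card {e \<in> cut G W. src e \<notin> A}"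
    proof -
      have "card (cut G W) = card ({e \<in> cut G W. src e \<in> A} \<union> {e \<in> cut G W. src e \<notin> A})"
        by (rule arg_cong[where f = card]) auto
      also have "\<dots> = card {e \<in> cut G W. src e \<in> A} + card {e \<in> cut G W. src e \<notin> A}"
        by (rule card_Un_disjoint) (use I in auto)
      finally show ?thesis .
    qed
    moreover have "card (cut G W) \<le> card (cut G (W - A))" using min A W by auto
    moreover have "card (cut G (W - A)) \<le> card {e \<in> cut G W. src e \<notin> A} + card (cut ?GW A)"
      by (rule order_trans[OF card_mono[OF _ sub] card_Un_le]) (use I finite_cut[OF GW] in auto)
    ultimately show ?thesis by linarith
  qed
  have srcW: "src e \<in> verts ?GW" if "e \<in> cut G W" for e using src[OF that] by simp
  obtain F where "\<forall>e\<in>cut G W. F e \<subseteq> edges ?GW \<and> linked ?GW (F e) (src e) v"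
      "\<forall>e\<in>cut G W. \<forall>e'\<in>cut G W. e \<noteq> e' \<longrightarrow> F e \<inter> F e' = {}"
    using edge_disjoint_links[OF GW I, of v src, OF _ srcW] dem by auto
  then have F: "\<And>e. e \<in> cut G W \<Longrightarrow> F e \<subseteq> edges ?GW"
      "\<And>e. e \<in> cut G W \<Longrightarrow> linked ?GW (F e) (src e) v"
      "\<And>e e'. e \<in> cut G W \<Longrightarrow> e' \<in> cut G W \<Longrightarrow> e \<noteq> e' \<Longrightarrow> F e \<inter> F e' = {}"
    by blast+
  let ?F = "\<lambda>e. if e \<in> cut G W then insert e (F e) else {e}"
  have "links_immersion (contract G W v) G id ?F" unfolding links_immersion_def
  proof (intro conjI ballI allI impI)
    show "id ` verts (contract G W v) \<subseteq> verts G" using W by (auto simp: contract_def)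
  next
    fix e assume e: "e \<in> edges (contract G W v)"
    then show "?F e \<subseteq> edges G" using F(1) by (auto simp: contract_def)
    fix x y assume xy: "ends (contract G W v) e = {x, y}"
    have eG: "e \<in> edges G" "\<not> ends G e \<subseteq> W" using e by (auto simp: contract_def)
    show "linked G (?F e) (id x) (id y)"
    proof (cases "e \<in> cut G W")
      case True
      obtain b where b: "ends G e = {src e, b}" "b \<notin> W" using srcE[OF True] by blast
      have "linked G (F e) (src e) v" using F(2)[OF True] by (simp add: linked_cong[of _ ?GW G])
      then have 1: "linked G (?F e) (src e) v" by (rule linked_mono) (use True in auto)
      have 2: "linked G (?F e) (src e) b" by (rule linked_edge[OF _ b(1)]) (use True in auto)
      have "{x, y} = {v, b}" using xy b src[OF True] by (auto simp: contract_def)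
      then show ?thesis using linked_trans[OF linked_sym[OF 1] 2] linked_sym
        by (auto simp: doubleton_eq_iff)
    next
      case False
      obtain a b where ab: "ends G e = {a, b}" "a \<noteq> b" using wf_ends_pair[OF G eG(1)] .
      then have "a \<notin> W" "b \<notin> W" using eG False cut_iff[OF eG(1) ab] by auto
      then have "ends G e = {x, y}" using xy ab by (simp add: contract_def)
      then show ?thesis using False by (auto intro: linked_edge)
    qed
  next
    fix e e' assume e: "e \<in> edges (contract G W v)" "e' \<in> edges (contract G W v)" "e \<noteq> e'"
    have "e \<notin> F e'" if "e' \<in> cut G W" using F(1)[OF that] e(1) by (auto simp: contract_def)
    moreover have "e' \<notin> F e" if "e \<in> cut G W" using F(1)[OF that] e(2) by (auto simp: contract_def)
    ultimately show "?F e \<inter> ?F e' = {}" using F(3)[OF _ _ e(3)] e(3) by auto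
  qed auto
  then show ?thesis by (rule links_weak_immersion[OF G contract_wf[OF G W(2)]])
qed

section \<open>Walls, subdivisions and tree-width\<close>

lemma wall_wf: "wf_mgraph (wall r)"
proof -
  have sub: "edges (wall r) \<subseteq> Pow ({1..r} \<times> {1..r})" by (auto simp: wall_def)
  then have "finite (edges (wall r))" by (rule finite_subset) simp
  moreover have "card e = 2" if "e \<in> edges (wall r)" for e using that by (auto simp: wall_def)
  moreover have "ends (wall r) e = e" for e by (simp add: wall_def)
  ultimately show ?thesis using sub unfolding wf_mgraph_def by (auto simp: wall_def)
qed

lemma card_verts_wall: "card (verts (wall r)) = r ^ 2"
  by (simp add: wall_def power2_eq_square)

text \<open>At \<open>(i, j)\<close> only one of the two vertical edges can be present, depending on parity.\<close>
lemma degree_wall: "degree (wall r) v \<le> 3"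
proof -
  obtain i j where v: "v = (i, j)" by (cases v)
  let ?S = "{{(i, j), (i, j + 1)}, {(i, j - 1), (i, j)},
     (if odd i = odd j then {(i, j), (i + 1, j)} else {(i - 1, j), (i, j)})}"
  have "{e \<in> edges (wall r). v \<in> ends (wall r) e} \<subseteq> ?S"
  proof
    fix e assume "e \<in> {e \<in> edges (wall r). v \<in> ends (wall r) e}"
    then have ve: "(i, j) \<in> e" and "e \<in> edges (wall r)" by (simp_all add: v wall_def)
    then consider a b where "e = {(a, b), (a, b + 1)}" | a b where "e = {(a, b), (a + 1, b)}" "odd a = odd b"
      unfolding wall_def by auto
    then show "e \<in> ?S"
    proof cases
      case (1 a b)
      then have "i = a \<and> (j = b \<or> j = b + 1)" using ve by auto
      then show ?thesis using 1 by auto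
    next
      case (2 a b)
      then have "j = b \<and> (i = a \<or> i = a + 1)" using ve by auto
      then show ?thesis using 2 by auto
    qed
  qed
  then have "degree (wall r) v \<le> card ?S" unfolding degree_def by (intro card_mono) auto
  also have "\<dots> \<le> 3" by (intro order_trans[OF card_insert_le_m1] ) (auto simp: card_insert_if)
  finally show ?thesis .
qed

text \<open>The two edges at a suppressed vertex form the path that replaces the surviving edge.\<close>
lemma suppress_immersed:
  assumes S: "wf_mgraph S" and "suppress S S'"
  shows "wf_mgraph S' \<and> admits_weak_immersion S S'"
proof -
  obtain v e u where v: "v \<in> verts S" "degree S v = 2" and e: "e \<in> edges S" "u \<noteq> v" "ends S e = {u, v}"
    and S': "S' = contract_edge S e u v" using assms(2) by (auto simp: suppress_def)
  let ?q = "\<lambda>x. if x = v then u else x"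
  have S'_eq: "verts S' = verts S - {v}" "edges S' = {f \<in> edges S - {e}. card (?q ` ends S f) \<noteq> 1}"
    "ends S' = (\<lambda>f. ?q ` ends S f)" by (simp_all add: S' contract_edge_def)
  have u: "u \<in> verts S" using e S by (auto simp: wf_mgraph_def)
  have f2: "card (?q ` ends S f) = 2 \<and> ?q ` ends S f \<subseteq> verts S - {v}" if f: "f \<in> edges S'" for f
  proof -
    have fS: "f \<in> edges S" "card (?q ` ends S f) \<noteq> 1" using f S'_eq by auto
    obtain a b where "ends S f = {a, b}" "a \<noteq> b" "a \<in> verts S" "b \<in> verts S"
      using wf_ends_pair[OF S fS(1)] .
    moreover have eq: "?q ` ends S f = {?q a, ?q b}" unfolding calculation(1) image_insert image_empty ..
    moreover have "?q a \<noteq> ?q b" using fS(2) unfolding eq by force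
    ultimately show ?thesis using u e by simp
  qed
  have wf: "wf_mgraph S'"
    unfolding wf_mgraph_def using f2 S by (auto simp: S'_eq wf_mgraph_def)
  let ?F = "\<lambda>f. if v \<in> ends S f then {e, f} else {f}"
  have one: "f = f'" if "f \<in> edges S'" "f' \<in> edges S'" "v \<in> ends S f" "v \<in> ends S f'" for f f'
  proof (rule ccontr)
    assume ne: "f \<noteq> f'"
    have "{e, f, f'} \<subseteq> {g \<in> edges S. v \<in> ends S g}" using that e by (auto simp: S'_eq)
    then have "card {e, f, f'} \<le> degree S v" unfolding degree_def
      by (rule card_mono[rotated]) (use S in \<open>auto simp: wf_mgraph_def\<close>)
    moreover have "card {e, f, f'} = 3" using ne that by (auto simp: S'_eq)
    ultimately show False using v by simp
  qed
  have "links_immersion S' S id ?F" unfolding links_immersion_def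
  proof (intro conjI ballI allI impI)
    fix f assume f: "f \<in> edges S'"
    then show "?F f \<subseteq> edges S" using e by (auto simp: S'_eq)
    fix x y assume xy: "ends S' f = {x, y}"
    have fS: "f \<in> edges S" using f by (auto simp: S'_eq)
    show "linked S (?F f) (id x) (id y)"
    proof (cases "v \<in> ends S f")
      case True
      obtain b where b: "ends S f = {v, b}" "b \<noteq> v"
      proof -
        obtain x y where "ends S f = {x, y}" "x \<noteq> y" using wf_ends_pair[OF S fS] .
        then show thesis using True that[of x] that[of y] by (auto simp: insert_commute)
      qed
      have "{x, y} = {u, b}" using xy b by (auto simp: S'_eq)
      moreover have "linked S (?F f) u v" "linked S (?F f) v b"
        using linked_edge[OF _ e(3), of "?F f"] linked_edge[OF _ b(1), of "?F f"] True by auto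
      then have "linked S (?F f) u b" by (rule linked_trans)
      ultimately show ?thesis using linked_sym by (auto simp: doubleton_eq_iff)
    next
      case False
      then have "?q ` ends S f = id ` ends S f" by (intro image_cong) auto
      then have "ends S f = {x, y}" using xy by (simp add: S'_eq)
      then show ?thesis using False by (auto intro: linked_edge)
    qed
  next
    fix f f' assume f: "f \<in> edges S'" "f' \<in> edges S'" "f \<noteq> f'"
    then show "?F f \<inter> ?F f' = {}" using one[OF f(1,2)] by (auto simp: S'_eq)
  qed (auto simp: S'_eq)
  then show ?thesis using wf links_weak_immersion[OF S wf] by blast
qed

lemma weak_immersion_refl: "wf_mgraph G \<Longrightarrow> admits_weak_immersion G G"
  by (rule links_weak_immersion[of G G id "\<lambda>f. {f}"]) (auto simp: links_immersion_def intro: linked_edge)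

lemma subdivision_immersed:
  assumes G: "wf_mgraph G" and H: "wf_mgraph H" and "contains_subdivision G H"
  shows "admits_weak_immersion G H"
proof -
  obtain S K where SK: "subgraph S G" "suppress\<^sup>*\<^sup>* S K" "graph_iso K H"
    using assms(3) by (auto simp: contains_subdivision_def)
  have S: "wf_mgraph S" using SK by (simp add: subgraph_def)
  have "links_immersion S G id (\<lambda>f. {f})"
    using SK(1) by (auto simp: links_immersion_def subgraph_def intro: linked_edge)
  then have GS: "admits_weak_immersion G S" by (rule links_weak_immersion[OF G S])
  from SK(2) have K: "wf_mgraph K \<and> admits_weak_immersion S K"
  proof (induction rule: rtranclp_induct)
    case base
    then show ?case using S weak_immersion_refl by blast
  next
    case (step K K')
    then show ?case using suppress_immersed admits_weak_immersion_trans[OF S] by blast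
  qed
  obtain p q where pq: "bij_betw p (verts K) (verts H)" "bij_betw q (edges K) (edges H)"
     "\<forall>e\<in>edges K. ends H (q e) = p ` ends K e" using SK(3) by (auto simp: graph_iso_def)
  let ?p = "inv_into (verts K) p" and ?q = "inv_into (edges K) q"
  have bp: "bij_betw ?p (verts H) (verts K)" "bij_betw ?q (edges H) (edges K)"
    using pq bij_betw_inv_into by blast+
  have "links_immersion H K ?p (\<lambda>f. {?q f})" unfolding links_immersion_def
  proof (intro conjI ballI allI impI)
    fix f assume f: "f \<in> edges H"
    then show "{?q f} \<subseteq> edges K" using bp(2) by (auto simp: bij_betw_def)
    fix x y assume xy: "ends H f = {x, y}"
    have qf: "?q f \<in> edges K" "q (?q f) = f" using bp(2) pq(2) f
      by (auto simp: bij_betw_def f_inv_into_f)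
    then have "p ` ends K (?q f) = {x, y}" using pq(3) xy by metis
    moreover have "ends K (?q f) \<subseteq> verts K" using K qf by (auto simp: wf_mgraph_def)
    ultimately have "ends K (?q f) = {?p x, ?p y}"
      using inv_into_image_cancel[of p "verts K" "ends K (?q f)"] pq(1) by (auto simp: bij_betw_def)
    then show "linked K {?q f} (?p x) (?p y)" by (auto intro: linked_edge)
  next
    fix f f' assume "f \<in> edges H" "f' \<in> edges H" "f \<noteq> f'"
    then show "{?q f} \<inter> {?q f'} = {}" using bp(2) by (auto simp: bij_betw_def inj_on_def)
  qed (use bp in \<open>auto simp: bij_betw_def\<close>)
  then have "admits_weak_immersion K H" using links_weak_immersion K H by blast
  then show ?thesis using admits_weak_immersion_trans GS K S G H by blast
qed

lemma is_tree_single: "is_tree \<lparr>verts = {t}, edges = {}, ends = en\<rparr>"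
proof -
  let ?T = "\<lparr>verts = {t}, edges = {}, ends = en\<rparr>"
  have wf: "wf_mgraph ?T" by (simp add: wf_mgraph_def)
  have "\<not> (\<exists>C. subgraph C ?T \<and> is_cycle C)" by (auto simp: subgraph_def is_cycle_def)
  then show ?thesis unfolding is_tree_def using wf reachable_iff_linked[OF wf] by simp
qed

lemma tree_width_attained:
  assumes K: "wf_mgraph K"
  obtains T :: "(nat, nat) mgraph" and B where "tree_decomposition K T B"
    "tree_width K = Max ((\<lambda>t. card (B t)) ` verts T) - 1"
proof -
  let ?S = "{Max ((\<lambda>t. card (B t)) ` verts T) - 1 | (T :: (nat, nat) mgraph) B. tree_decomposition K T B}"
  let ?T = "\<lparr>verts = {0}, edges = {}, ends = (\<lambda>_. {})\<rparr> :: (nat, nat) mgraph"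
  have "tree_decomposition K ?T (\<lambda>_. verts K)"
    using K is_tree_single[of 0] unfolding tree_decomposition_def by (auto simp: wf_mgraph_def)
  then have "Max ((\<lambda>t. card (verts K)) ` verts ?T) - 1 \<in> ?S"
    by (intro CollectI exI[of _ ?T] exI[of _ "\<lambda>_. verts K"]) simp
  then have "tree_width K \<in> ?S" unfolding tree_width_def by (intro Inf_nat_def1) blast
  then show thesis using that by blast
qed

text \<open>The hypothesis on \<open>w\<close> concerns graphs on natural numbers, of which every finite graph
  has a copy.\<close>
lemma nat_copy:
  fixes G :: "('v, 'e) mgraph"
  assumes G: "wf_mgraph G"
  obtains K :: "(nat, nat) mgraph" and p where "wf_mgraph K" "admits_weak_immersion G K"
    "inj_on p (verts G)" "verts K = p ` verts G"
    "\<And>e. e \<in> edges G \<Longrightarrow> \<exists>e'\<in>edges K. ends K e' = p ` ends G e"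
proof -
  have fin: "finite (verts G)" "finite (edges G)" using G by (auto simp: wf_mgraph_def)
  obtain p :: "'v \<Rightarrow> nat" where p: "inj_on p (verts G)"
    using finite_imp_inj_to_nat_seg[OF fin(1)] by blast
  obtain q :: "'e \<Rightarrow> nat" where q: "inj_on q (edges G)"
    using finite_imp_inj_to_nat_seg[OF fin(2)] by blast
  let ?q = "inv_into (edges G) q" and ?p = "inv_into (verts G) p"
  let ?K = "\<lparr>verts = p ` verts G, edges = q ` edges G, ends = \<lambda>n. p ` ends G (?q n)\<rparr>"
  have sub: "ends G e \<subseteq> verts G" "card (ends G e) = 2" if "e \<in> edges G" for e
    using G that by (auto simp: wf_mgraph_def)
  have "wf_mgraph ?K" unfolding wf_mgraph_def
    using fin sub q p by (auto simp: card_image inj_on_subset image_mono)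
  moreover have "links_immersion ?K G ?p (\<lambda>n. {?q n})" unfolding links_immersion_def
  proof (intro conjI ballI allI impI)
    fix n assume n: "n \<in> edges ?K"
    then have qn: "?q n \<in> edges G" using q by auto
    then show "{?q n} \<subseteq> edges G" by simp
    fix x y assume "ends ?K n = {x, y}"
    then have "?p ` p ` ends G (?q n) = {?p x, ?p y}" by simp
    then have "ends G (?q n) = {?p x, ?p y}"
      using inv_into_image_cancel[OF p sub(1)[OF qn]] by simp
    then show "linked G {?q n} (?p x) (?p y)" by (auto intro: linked_edge)
  qed (use p q in \<open>auto intro: inj_on_inv_into inv_into_into\<close>)
  then have "admits_weak_immersion G ?K" using links_weak_immersion G \<open>wf_mgraph ?K\<close> by blast
  ultimately show thesis using that[of ?K p] p q by auto
qed

text \<open>Tree-decompositions restated with tree edges in place of tree paths: a cut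
  will be bounded through the two bags at a tree edge.\<close>
definition bag_separation ::
  "('v, 'e) mgraph \<Rightarrow> ('t, 'd) mgraph \<Rightarrow> ('t \<Rightarrow> 'v set) \<Rightarrow> bool" where
  "bag_separation G T B \<longleftrightarrow> is_tree T \<and> verts G \<subseteq> (\<Union>t\<in>verts T. B t) \<and>
     (\<forall>e\<in>edges G. \<exists>t\<in>verts T. ends G e \<subseteq> B t) \<and>
     (\<forall>d\<in>edges T. \<forall>s\<in>verts T. \<forall>t\<in>verts T. \<not> linked T (edges T - {d}) s t \<longrightarrow>
        (\<forall>q\<in>ends T d. B s \<inter> B t \<subseteq> B q))"

lemma tree_decomposition_separation:
  assumes td: "tree_decomposition G T B"
  shows "bag_separation G T B"
proof -
  have T: "is_tree T" using td by (simp add: tree_decomposition_def)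
  have "B s \<inter> B t \<subseteq> B q"
    if d: "d \<in> edges T" "s \<in> verts T" "t \<in> verts T" "\<not> linked T (edges T - {d}) s t" "q \<in> ends T d" for d s t q
  proof -
    obtain P where P: "subgraph P T" "path_between P s t"
      using T d unfolding is_tree_def reachable_def by metis
    have "linked T (edges P) s t" using subgraph_path_linked[OF P] .
    then have "d \<in> edges P" using d(4) linked_mono P(1) unfolding subgraph_def by (metis Diff_insert0 insert_Diff_single subset_insert subset_insert_iff)
    then have "q \<in> verts P" using P(1) d(5) unfolding subgraph_def wf_mgraph_def by fastforce
    then show ?thesis using td P d unfolding tree_decomposition_def by blast
  qed
  then show ?thesis using td unfolding tree_decomposition_def bag_separation_def by blast
qed

lemma no_wall_bag_separation:
  fixes G :: "('v, 'e) mgraph"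
  assumes wall: "\<And>K :: (nat, nat) mgraph. wf_mgraph K \<Longrightarrow> tree_width K \<ge> w \<Longrightarrow> contains_subdivision K (wall r)"
    and G: "wf_mgraph G" and no: "\<not> admits_weak_immersion G (wall r)"
  obtains T :: "(nat, nat) mgraph" and B where "bag_separation G T B"
    "\<And>t. t \<in> verts T \<Longrightarrow> finite (B t) \<and> card (B t) \<le> w"
proof -
  obtain K :: "(nat, nat) mgraph" and p where K: "wf_mgraph K" "admits_weak_immersion G K"
    "inj_on p (verts G)" "verts K = p ` verts G"
    "\<And>e. e \<in> edges G \<Longrightarrow> \<exists>e'\<in>edges K. ends K e' = p ` ends G e"
    using nat_copy[OF G] by metis
  have "\<not> contains_subdivision K (wall r)"
    using no subdivision_immersed[OF K(1) wall_wf] admits_weak_immersion_trans[OF G K(1) wall_wf K(2)] by blast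
  then have less: "tree_width K < w" using wall[OF K(1)] by (meson not_le)
  obtain T :: "(nat, nat) mgraph" and B where T: "tree_decomposition K T B"
    "tree_width K = Max ((\<lambda>t. card (B t)) ` verts T) - 1" using tree_width_attained[OF K(1)] .
  have sep: "bag_separation K T B" using tree_decomposition_separation[OF T(1)] .
  have finT: "finite (verts T)" using sep by (simp add: bag_separation_def is_tree_def wf_mgraph_def)
  let ?B = "\<lambda>t. {x \<in> verts G. p x \<in> B t}"
  have "bag_separation G T ?B"
  proof -
    have "\<exists>t\<in>verts T. ends G e \<subseteq> ?B t" if e: "e \<in> edges G" for e
    proof -
      obtain e' where "e' \<in> edges K" "ends K e' = p ` ends G e" using K(5)[OF e] by blast
      then obtain t where "t \<in> verts T" "p ` ends G e \<subseteq> B t" using sep by (auto simp: bag_separation_def)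
      moreover have "ends G e \<subseteq> verts G" using G e by (auto simp: wf_mgraph_def)
      ultimately show ?thesis by blast
    qed
    moreover have "verts G \<subseteq> (\<Union>t\<in>verts T. ?B t)"
    proof
      fix x assume x: "x \<in> verts G"
      then have "p x \<in> (\<Union>t\<in>verts T. B t)" using sep K(4) unfolding bag_separation_def by blast
      then show "x \<in> (\<Union>t\<in>verts T. ?B t)" using x by blast
    qed
    moreover have "?B s \<inter> ?B t \<subseteq> ?B q"
      if "d \<in> edges T" "s \<in> verts T" "t \<in> verts T" "\<not> linked T (edges T - {d}) s t" "q \<in> ends T d" for d s t q
    proof -
      have "B s \<inter> B t \<subseteq> B q" using sep that unfolding bag_separation_def by blast
      then show ?thesis by blast
    qed
    ultimately show ?thesis using sep unfolding bag_separation_def by blast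
  qed
  moreover have "finite (?B t) \<and> card (?B t) \<le> w" if t: "t \<in> verts T" for t
  proof -
    have BK: "B t \<subseteq> verts K" using T(1) t by (auto simp: tree_decomposition_def)
    then have fB: "finite (B t)" using K(1) finite_subset by (auto simp: wf_mgraph_def)
    have "card (?B t) = card (p ` ?B t)"
      using K(3) by (intro card_image[symmetric]) (auto intro: inj_on_subset)
    also have "\<dots> \<le> card (B t)" using fB by (intro card_mono) auto
    also have "\<dots> \<le> Max ((\<lambda>t. card (B t)) ` verts T)" using t finT by auto
    also have "\<dots> \<le> w" using less T(2) by linarith
    finally show ?thesis using G by (auto simp: wf_mgraph_def)
  qed
  ultimately show thesis by (rule that)
qed

section \<open>Connected pieces attached to highly connected vertices\<close>

text \<open>Connected vertex sets, generated by adding leaves so that induction removes a vertex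
  without disconnecting the rest.\<close>
inductive conn :: "('v, 'e) mgraph \<Rightarrow> 'v set \<Rightarrow> bool" for G where
  single: "conn G {x}"
| leaf: "conn G P \<Longrightarrow> z \<in> P \<Longrightarrow> y \<notin> P \<Longrightarrow> e \<in> edges G \<Longrightarrow> ends G e = {y, z} \<Longrightarrow> conn G (insert y P)"

lemma conn_finite: "conn G P \<Longrightarrow> finite P"
  by (induction rule: conn.induct) auto

definition inner_cut :: "('v, 'e) mgraph \<Rightarrow> 'v set \<Rightarrow> 'v set \<Rightarrow> 'e set" where
  "inner_cut G P A = {e \<in> cut G A. ends G e \<subseteq> P}"

lemma finite_inner_cut: "wf_mgraph G \<Longrightarrow> finite (inner_cut G P A)"
  unfolding inner_cut_def by (drule finite_cut[of G A]) auto

lemma inner_cut_mono: "P \<subseteq> Q \<Longrightarrow> inner_cut G P A \<subseteq> inner_cut G Q A"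
  by (auto simp: inner_cut_def)

lemma conn_inner_cut:
  assumes "conn G P" "A \<inter> P \<noteq> {}" "\<not> P \<subseteq> A"
  shows "inner_cut G P A \<noteq> {}"
  using assms
proof (induction rule: conn.induct)
  case (leaf P z y e)
  show ?case
  proof (cases "A \<inter> P \<noteq> {} \<and> \<not> P \<subseteq> A")
    case True
    then show ?thesis using leaf.IH inner_cut_mono[of P "insert y P" G A] by blast
  next
    case False
    then have "y \<in> A \<longleftrightarrow> z \<notin> A" using leaf.prems leaf.hyps by blast
    moreover have "y \<noteq> z" using leaf.hyps by blast
    ultimately have "e \<in> cut G A" using cut_iff[OF leaf.hyps(4,5)] by simp
    then show ?thesis using leaf.hyps by (auto simp: inner_cut_def)
  qed
qed auto

text \<open>The median of three attachments. A leaf of weight at least two is itself a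
  median; a lighter leaf hands its weight to its neighbour, and the edge between them
  makes up for the loss when a cut separates them.\<close>
lemma median_vertex:
  fixes \<omega> :: "'v \<Rightarrow> nat"
  assumes "wf_mgraph G" "conn G P" "3 \<le> sum \<omega> P"
  shows "\<exists>x\<in>P. \<forall>A. x \<in> A \<longrightarrow> 3 \<le> card (inner_cut G P A) + sum \<omega> (A \<inter> P)"
  using assms(2,3)
proof (induction arbitrary: \<omega> rule: conn.induct)
  case (single x)
  then show ?case by auto
next
  case (leaf P z y e)
  have fin: "finite P" using leaf.hyps conn_finite by blast
  have yz: "y \<noteq> z" using leaf.hyps by blast
  have sumI: "sum \<omega> (insert y P) = \<omega> y + sum \<omega> P" using fin leaf.hyps by simp
  show ?case
  proof (cases "\<omega> y \<ge> 2")
    case True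
    have "3 \<le> card (inner_cut G (insert y P) A) + sum \<omega> (A \<inter> insert y P)" if y: "y \<in> A" for A
    proof (cases "insert y P \<subseteq> A")
      case True
      then have "A \<inter> insert y P = insert y P" by blast
      then show ?thesis using leaf.prems by simp
    next
      case False
      have "conn G (insert y P)" using conn.leaf leaf.hyps by metis
      then have "inner_cut G (insert y P) A \<noteq> {}" using conn_inner_cut False y by blast
      then have "card (inner_cut G (insert y P) A) \<ge> 1"
        using finite_inner_cut[OF assms(1), of "insert y P" A] by (simp add: card_gt_0_iff Suc_le_eq)
      moreover have "\<omega> y \<le> sum \<omega> (A \<inter> insert y P)"
        by (rule member_le_sum) (use y fin in auto)
      ultimately show ?thesis using \<open>\<omega> y \<ge> 2\<close> by linarith
    qed
    then show ?thesis by blast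
  next
    case False
    let ?w = "\<omega>(z := \<omega> z + \<omega> y)"
    have sum_w: "sum ?w X = sum \<omega> X + (if z \<in> X then \<omega> y else 0)" if "finite X" for X
      using that by (induction X rule: finite_induct) auto
    have "3 \<le> sum ?w P" using sum_w[OF fin] leaf.hyps leaf.prems sumI by simp
    from leaf.IH[OF this] obtain x where x: "x \<in> P"
      "\<And>A. x \<in> A \<Longrightarrow> 3 \<le> card (inner_cut G P A) + sum ?w (A \<inter> P)" by blast
    have "3 \<le> card (inner_cut G (insert y P) A) + sum \<omega> (A \<inter> insert y P)" if A: "x \<in> A" for A
    proof -
      let ?old = "inner_cut G P A" and ?new = "inner_cut G (insert y P) A"
      have sub: "?old \<subseteq> ?new" by (rule inner_cut_mono) auto
      have fnew: "finite ?new" using finite_inner_cut[OF assms(1)] .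
      have old: "3 \<le> card ?old + sum \<omega> (A \<inter> P) + (if z \<in> A then \<omega> y else 0)"
        using x(2)[OF A] sum_w[of "A \<inter> P"] fin leaf.hyps by auto
      show ?thesis
      proof (cases "y \<in> A")
        case True
        then have "A \<inter> insert y P = insert y (A \<inter> P)" by blast
        then have "sum \<omega> (A \<inter> insert y P) = \<omega> y + sum \<omega> (A \<inter> P)" using fin leaf.hyps by simp
        then show ?thesis using old card_mono[OF fnew sub] by (auto split: if_splits)
      next
        case yA: False
        then have eq: "A \<inter> insert y P = A \<inter> P" by blast
        show ?thesis
        proof (cases "z \<in> A")
          case True
          have "e \<in> ?new" using cut_iff[OF leaf.hyps(4,5) yz, of A] True yA leaf.hyps by (auto simp: inner_cut_def)
          moreover have "e \<notin> ?old" using leaf.hyps by (auto simp: inner_cut_def)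
          ultimately have "?old \<subset> ?new" using sub by blast
          then have "card ?old < card ?new" using psubset_card_mono[OF fnew] by blast
          then show ?thesis using old eq False True by simp
        next
          case False
          then show ?thesis using old eq card_mono[OF fnew sub] by simp
        qed
      qed
    qed
    then show ?thesis using x(1) by blast
  qed
qed

text \<open>A connected set of bounded degree and large weight falls into many connected pieces of
  weight at least three. A leaf of weight at least three is cut off as a piece; a lighter leaf hands
  its weight to its neighbour, whose degree drops, so that the bound \<open>M\<close> on weight plus twice the
  degree is kept.\<close>
lemma split_into_pieces:
  fixes \<omega> :: "'v \<Rightarrow> nat"
  assumes "wf_mgraph G" "conn G P"
    "\<And>x. x \<in> P \<Longrightarrow> \<omega> x + 2 * card {e \<in> edges G. ends G e \<subseteq> P \<and> x \<in> ends G e} \<le> M"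
  shows "\<exists>\<P>. finite \<P> \<and> disjoint \<P> \<and> (\<forall>Q\<in>\<P>. conn G Q \<and> Q \<subseteq> P \<and> 3 \<le> sum \<omega> Q) \<and>
     sum \<omega> P \<le> M * card \<P> + 2"
  using assms(2,3)
proof (induction arbitrary: \<omega> rule: conn.induct)
  case (single x)
  show ?case
  proof (cases "3 \<le> \<omega> x")
    case True
    then show ?thesis using single[of x] conn.single[of G x]
      by (intro exI[of _ "{{x}}"]) (auto simp: disjoint_def)
  next
    case False
    then show ?thesis by (intro exI[of _ "{}"]) auto
  qed
next
  case (leaf P z y e)
  have fin: "finite P" using leaf.hyps conn_finite by blast
  have yz: "y \<noteq> z" using leaf.hyps by blast
  have fE: "finite (edges G)" using assms(1) by (simp add: wf_mgraph_def)
  let ?d = "\<lambda>P x. card {e \<in> edges G. ends G e \<subseteq> P \<and> x \<in> ends G e}"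
  have dmono: "?d P x \<le> ?d (insert y P) x" for x by (rule card_mono) (use fE in auto)
  have sumI: "sum \<omega> (insert y P) = \<omega> y + sum \<omega> P" using fin leaf.hyps by simp
  show ?case
  proof (cases "3 \<le> \<omega> y")
    case True
    have "\<omega> x + 2 * ?d P x \<le> M" if "x \<in> P" for x
      using leaf.prems[of x] that dmono[of x] by simp
    from leaf.IH[OF this] obtain \<P> where P: "finite \<P>" "disjoint \<P>" "sum \<omega> P \<le> M * card \<P> + 2"
      "\<forall>Q\<in>\<P>. conn G Q \<and> Q \<subseteq> P \<and> 3 \<le> sum \<omega> Q" by blast
    have "{y} \<notin> \<P>" using P leaf.hyps by blast
    then have c: "card (insert {y} \<P>) = Suc (card \<P>)" using P by simp
    have "\<omega> y \<le> M" using leaf.prems[of y] by simp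
    then have "sum \<omega> (insert y P) \<le> M * card (insert {y} \<P>) + 2" using P(3) sumI c by simp
    moreover have "disjoint (insert {y} \<P>)" using P(2,4) leaf.hyps unfolding disjoint_def by blast
    moreover have "\<forall>Q\<in>insert {y} \<P>. conn G Q \<and> Q \<subseteq> insert y P \<and> 3 \<le> sum \<omega> Q"
      using P(4) True conn.single[of G y] by auto
    ultimately show ?thesis using P(1) by blast
  next
    case False
    let ?w = "\<omega>(z := \<omega> z + \<omega> y)"
    have sum_w: "sum ?w X = sum \<omega> X + (if z \<in> X then \<omega> y else 0)" if "finite X" for X
      using that by (induction X rule: finite_induct) auto
    have "?w x + 2 * ?d P x \<le> M" if x: "x \<in> P" for x
    proof (cases "x = z")
      case True
      have "{e \<in> edges G. ends G e \<subseteq> P \<and> z \<in> ends G e} \<subset> {e \<in> edges G. ends G e \<subseteq> insert y P \<and> z \<in> ends G e}"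
        using leaf.hyps by auto
      then have "?d P z < ?d (insert y P) z" using fE by (intro psubset_card_mono) auto
      then show ?thesis using leaf.prems[of z] leaf.hyps(2) True False by simp
    next
      case False
      then show ?thesis using leaf.prems[of x] x dmono[of x] by simp
    qed
    from leaf.IH[OF this] obtain \<P> where P: "finite \<P>" "disjoint \<P>" "sum ?w P \<le> M * card \<P> + 2"
      "\<forall>Q\<in>\<P>. conn G Q \<and> Q \<subseteq> P \<and> 3 \<le> sum ?w Q" by blast
    let ?f = "\<lambda>Q. if z \<in> Q then insert y Q else Q"
    have yP: "y \<notin> Q" if "Q \<in> \<P>" for Q using that P(4) leaf.hyps by blast
    have inj: "inj_on ?f \<P>"
    proof (rule inj_onI)
      fix Q Q' assume *: "Q \<in> \<P>" "Q' \<in> \<P>" "?f Q = ?f Q'"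
      have "?f Q - {y} = Q" "?f Q' - {y} = Q'" using yP[OF *(1)] yP[OF *(2)] by auto
      then show "Q = Q'" using *(3) by metis
    qed
    have "disjoint (?f ` \<P>)" unfolding disjoint_def
    proof (intro ballI impI)
      fix X X' assume "X \<in> ?f ` \<P>" "X' \<in> ?f ` \<P>" "X \<noteq> X'"
      then obtain Q Q' where Q: "Q \<in> \<P>" "Q' \<in> \<P>" "X = ?f Q" "X' = ?f Q'" "Q \<noteq> Q'" by blast
      have "Q \<inter> Q' = {}" using Q P(2) by (auto simp: disjoint_def)
      then show "X \<inter> X' = {}" using Q yP[OF Q(1)] yP[OF Q(2)] by auto
    qed
    moreover have "\<forall>X\<in>?f ` \<P>. conn G X \<and> X \<subseteq> insert y P \<and> 3 \<le> sum \<omega> X"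
    proof (intro ballI, elim imageE)
      fix X Q assume X: "X = ?f Q" and Q: "Q \<in> \<P>"
      have cQ: "conn G Q" "Q \<subseteq> P" "3 \<le> sum ?w Q" using P(4) Q by auto
      have "conn G (insert y Q)" if "z \<in> Q" using conn.leaf[OF cQ(1) that yP[OF Q] leaf.hyps(4,5)] .
      then show "conn G X \<and> X \<subseteq> insert y P \<and> 3 \<le> sum \<omega> X"
        using X cQ sum_w[of Q] yP[OF Q] conn_finite[OF cQ(1)] by auto
    qed
    moreover have "sum \<omega> (insert y P) \<le> M * card (?f ` \<P>) + 2"
      using P(3) sum_w[OF fin] leaf.hyps(2) sumI card_image[OF inj] by simp
    moreover have "finite (?f ` \<P>)" using P(1) by simp
    ultimately show ?thesis by blast
  qed
qed

definition joining :: "('v, 'e) mgraph \<Rightarrow> 'v set \<Rightarrow> 'v set \<Rightarrow> 'e set" where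
  "joining G Q B = {e \<in> edges G. ends G e \<inter> Q \<noteq> {} \<and> ends G e \<inter> B \<noteq> {}}"

lemma finite_joining: "wf_mgraph G \<Longrightarrow> finite (joining G Q B)"
  by (simp add: joining_def wf_mgraph_def)

lemma card_joining:
  assumes G: "wf_mgraph G" and Q: "finite Q" "Q \<inter> B = {}"
  shows "card (joining G Q B) = (\<Sum>x\<in>Q. card (joining G {x} B))"
proof -
  have "joining G Q B = (\<Union>x\<in>Q. joining G {x} B)" by (auto simp: joining_def)
  moreover have "joining G {x} B \<inter> joining G {y} B = {}" if "x \<in> Q" "y \<in> Q" "x \<noteq> y" for x y
  proof (rule ccontr)
    assume "\<not> ?thesis"
    then obtain e where e: "e \<in> edges G" "x \<in> ends G e" "y \<in> ends G e" "ends G e \<inter> B \<noteq> {}"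
      by (auto simp: joining_def)
    obtain a b where "ends G e = {a, b}" using wf_ends_pair[OF G e(1)] .
    then show False using e that Q by auto
  qed
  ultimately show ?thesis using Q(1) finite_joining[OF G] by (simp add: card_UN_disjoint)
qed

text \<open>The hub is any vertex of \<open>B\<close>. A set \<open>A\<close> that misses the hub either separates \<open>B\<close> and
  has a large cut, or misses \<open>B\<close>; then each median in \<open>A\<close> contributes three edges of its
  own piece.\<close>
lemma few_pieces:
  fixes G :: "('v, 'e) mgraph" and H :: "('u, 'f) mgraph"
  assumes G: "wf_mgraph G" and H: "wf_mgraph H" "verts H \<noteq> {}"
    and deg: "\<And>u. u \<in> verts H \<Longrightarrow> degree H u \<le> 3"
    and no: "\<not> admits_weak_immersion G H"
    and B: "B \<subseteq> verts G"
    and sep: "\<And>A. A \<inter> B \<noteq> {} \<Longrightarrow> \<not> B \<subseteq> A \<Longrightarrow> 3 * card (verts H) \<le> card (cut G A)"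
    and P: "finite \<P>" "disjoint \<P>"
      "\<And>Q. Q \<in> \<P> \<Longrightarrow> conn G Q \<and> Q \<subseteq> verts G - B \<and> 3 \<le> card (joining G Q B)"
  shows "card B + card \<P> < card (verts H)"
proof (rule ccontr)
  assume large: "\<not> ?thesis"
  let ?\<omega> = "\<lambda>x. card (joining G {x} B)"
  have finB: "finite B" using B G finite_subset by (auto simp: wf_mgraph_def)
  have joinQ: "card (joining G X B) = sum ?\<omega> X" if X: "Q \<in> \<P>" "X \<subseteq> Q" for Q X
  proof (rule card_joining[OF G])
    have "finite Q" using P(3)[OF X(1)] conn_finite by auto
    then show "finite X" using X(2) by (rule finite_subset[rotated])
    show "X \<inter> B = {}" using P(3)[OF X(1)] X(2) by blast
  qed
  have "\<forall>Q\<in>\<P>. \<exists>x\<in>Q. \<forall>A. x \<in> A \<longrightarrow> 3 \<le> card (inner_cut G Q A) + sum ?\<omega> (A \<inter> Q)"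
  proof (intro ballI median_vertex[OF G])
    fix Q assume "Q \<in> \<P>"
    then show "conn G Q" "3 \<le> sum ?\<omega> Q" using P(3)[of Q] joinQ[of Q Q] by (simp, metis order_refl)
  qed
  then obtain m where m: "\<And>Q. Q \<in> \<P> \<Longrightarrow> m Q \<in> Q"
    "\<And>Q A. Q \<in> \<P> \<Longrightarrow> m Q \<in> A \<Longrightarrow> 3 \<le> card (inner_cut G Q A) + sum ?\<omega> (A \<inter> Q)" by metis
  have inj: "inj_on m \<P>" using m(1) P(2) unfolding inj_on_def disjoint_def by (metis disjoint_iff)
  have "m ` \<P> \<inter> B = {}" using m(1) P(3) by blast
  then have "card (B \<union> m ` \<P>) = card B + card \<P>"
    using finB P(1) card_image[OF inj] by (subst card_Un_disjoint) auto
  then have "card (verts H) \<le> card (B \<union> m ` \<P>)" using large by simp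
  then obtain S where S: "S \<subseteq> B \<union> m ` \<P>" "card S = card (verts H)" "finite S"
    by (rule obtain_subset_with_card_n)
  have "finite (verts H)" using H by (simp add: wf_mgraph_def)
  then obtain p where p: "bij_betw p (verts H) S"
    using S(2,3) finite_same_card_bij by metis
  then have pS: "p ` verts H = S" "inj_on p (verts H)" by (auto simp: bij_betw_def)
  have "B \<noteq> {}"
  proof
    assume "B = {}"
    then have "\<P> = {}" using P(3) by (auto simp: joining_def)
    then show False using large \<open>B = {}\<close> H \<open>finite (verts H)\<close> by simp
  qed
  then obtain h where h: "h \<in> B" by blast
  have "3 * card (A \<inter> S) \<le> card (cut G A)" if A: "A \<subseteq> verts G" "h \<notin> A" for A
  proof (cases "A \<inter> B = {}")
    case False
    have "card (A \<inter> S) \<le> card (verts H)" using S card_mono[of S "A \<inter> S"] by simp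
    then show ?thesis using sep[OF False] A h by fastforce
  next
    case True
    let ?Q = "{Q \<in> \<P>. m Q \<in> A}"
    let ?E = "\<lambda>Q. inner_cut G Q A \<union> joining G (A \<inter> Q) B"
    have "A \<inter> S \<subseteq> m ` ?Q" using S(1) True by blast
    then have "card (A \<inter> S) \<le> card ?Q" using P(1) by (intro surj_card_le) auto
    moreover have "3 * card ?Q \<le> card (\<Union>Q\<in>?Q. ?E Q)"
    proof -
      have "card (?E Q) \<ge> 3" if Q: "Q \<in> ?Q" for Q
      proof -
        have "inner_cut G Q A \<inter> joining G (A \<inter> Q) B = {}"
          using Q P(3)[of Q] by (auto simp: inner_cut_def joining_def)
        then have "card (?E Q) = card (inner_cut G Q A) + card (joining G (A \<inter> Q) B)"
          using finite_inner_cut[OF G] finite_joining[OF G] by (simp add: card_Un_disjoint)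
        then show ?thesis using m(2)[of Q A] joinQ[of Q "A \<inter> Q"] Q by auto
      qed
      then have "(\<Sum>Q\<in>?Q. 3) \<le> (\<Sum>Q\<in>?Q. card (?E Q))" by (intro sum_mono)
      also have "\<dots> = card (\<Union>Q\<in>?Q. ?E Q)"
      proof (rule card_UN_disjoint[symmetric])
        show "\<forall>Q\<in>?Q. \<forall>Q'\<in>?Q. Q \<noteq> Q' \<longrightarrow> ?E Q \<inter> ?E Q' = {}"
        proof (intro ballI impI)
          fix Q Q' assume Q: "Q \<in> ?Q" "Q' \<in> ?Q" "Q \<noteq> Q'"
          then have dis: "Q \<inter> Q' = {}" "Q \<inter> B = {}" "Q' \<inter> B = {}"
            using P(2) P(3)[of Q] P(3)[of Q'] by (auto simp: disjoint_def)
          have E: "ends G e \<inter> X \<noteq> {} \<and> ends G e \<subseteq> X \<union> B"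
            if e: "e \<in> inner_cut G X A \<union> joining G (A \<inter> X) B" "X \<inter> B = {}" for e X
          proof -
            have eG: "e \<in> edges G" using e by (auto simp: inner_cut_def joining_def cut_def)
            obtain a b where "ends G e = {a, b}" using wf_ends_pair[OF G eG] .
            then show ?thesis using e by (auto simp: inner_cut_def joining_def)
          qed
          show "?E Q \<inter> ?E Q' = {}" using E[of _ Q] E[of _ Q'] dis by blast
        qed
      qed (use P(1) finite_inner_cut[OF G] finite_joining[OF G] in auto)
      finally show ?thesis by simp
    qed
    moreover have "(\<Union>Q\<in>?Q. ?E Q) \<subseteq> cut G A"
    proof
      fix e assume "e \<in> (\<Union>Q\<in>?Q. ?E Q)"
      then obtain Q where "e \<in> inner_cut G Q A \<or> e \<in> joining G (A \<inter> Q) B" by blast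
      then show "e \<in> cut G A"
      proof
        assume e: "e \<in> joining G (A \<inter> Q) B"
        then have eG: "e \<in> edges G" by (simp add: joining_def)
        obtain a b where ab: "ends G e = {a, b}" "a \<noteq> b" using wf_ends_pair[OF G eG] .
        show ?thesis using cut_iff[OF eG ab] e ab True by (auto simp: joining_def)
      qed (simp add: inner_cut_def)
    qed
    then have "card (\<Union>Q\<in>?Q. ?E Q) \<le> card (cut G A)" using finite_cut[OF G] by (intro card_mono)
    ultimately show ?thesis by linarith
  qed
  then have cuts: "3 * card (A \<inter> p ` verts H) \<le> card (cut G A)" if "A \<subseteq> verts G" "h \<notin> A" for A
    using that pS(1) by simp
  have "m ` \<P> \<subseteq> verts G" using P(3) m(1) by blast
  then have "p ` verts H \<subseteq> verts G" using pS(1) S(1) B by blast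
  then have "admits_weak_immersion G H"
    using immersion_through_hub[OF G H(1) deg pS(2) _ cuts] by blast
  then show False using no by blast
qed

section \<open>Trees\<close>

lemma is_tree_wf: "is_tree T \<Longrightarrow> wf_mgraph T"
  by (simp add: is_tree_def)

lemma is_tree_linked:
  assumes "is_tree T" "x \<in> verts T" "y \<in> verts T"
  shows "linked T (edges T) x y"
  using assms reachable_iff_linked[of T x y] by (simp add: is_tree_def)

text \<open>A connected graph is a tree if and only if every edge is a bridge. With this, linking
  replaces cycles in everything that follows.\<close>
lemma is_tree_bridge:
  assumes T: "is_tree T" and e: "e \<in> edges T" "ends T e = {x, y}"
  shows "\<not> linked T (edges T - {e}) x y"
proof
  assume "linked T (edges T - {e}) x y"
  from linked_path_lists[OF this] obtain vs es where *: "distinct vs" "length vs = length es + 1"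
      "hd vs = x" "last vs = y" "set es \<subseteq> edges T - {e}"
      "\<forall>i<length es. ends T (es ! i) = {vs ! i, vs ! (i + 1)}"
    by (elim exE conjE)
  have ne: "vs \<noteq> []" using *(2) by auto
  have wf: "wf_mgraph T" using is_tree_wf[OF T] .
  have "x \<noteq> y" using wf e by (auto simp: wf_mgraph_def card_insert_if split: if_splits)
  then have len: "length es \<ge> 1" using * ne by (cases es; cases vs) auto
  have xy: "vs ! 0 = x" "vs ! length es = y" using * ne by (simp_all add: hd_conv_nth last_conv_nth)
  let ?es = "es @ [e]"
  let ?C = "\<lparr>verts = set vs, edges = set ?es, ends = ends T\<rparr>"
  have cyc: "ends T (?es ! i) = {vs ! i, vs ! ((i + 1) mod length vs)}" if "i < length ?es" for i
  proof (cases "i < length es")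
    case True
    then show ?thesis using * by (simp add: nth_append)
  next
    case False
    then have "i = length es" using that by simp
    then show ?thesis using xy e *(2) by (simp add: insert_commute)
  qed
  have "distinct es"
  proof (rule ccontr)
    assume "\<not> distinct es"
    then obtain i j where ij: "i < j" "j < length es" "es ! i = es ! j"
      by (metis distinct_conv_nth linorder_neqE_nat)
    then have "{vs ! i, vs ! (i + 1)} = {vs ! j, vs ! (j + 1)}" using *(6) by (metis order_less_trans)
    then have "vs ! i = vs ! j \<or> vs ! i = vs ! (j + 1)" by (auto simp: doubleton_eq_iff)
    then show False using ij *(1,2) by (auto simp: nth_eq_iff_index_eq)
  qed
  then have "is_cycle ?C" unfolding is_cycle_def
    using * len cyc by (intro exI[of _ vs] exI[of _ ?es]) auto
  moreover have "subgraph ?C T"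
  proof -
    have E: "set ?es \<subseteq> edges T" using * e by auto
    have ends_in: "ends T f \<subseteq> set vs" if f: "f \<in> set ?es" for f
    proof -
      obtain i where i: "i < length ?es" "?es ! i = f" using f by (auto simp only: in_set_conv_nth)
      have "i < length vs" "(i + 1) mod length vs < length vs" using i *(2) by auto
      then show ?thesis using cyc[OF i(1)] i(2) by simp
    qed
    then have V: "set vs \<subseteq> verts T"
    proof -
      have "vs ! i \<in> verts T" if "i < length vs" for i
      proof -
        have "i < length ?es" using that * by simp
        then have "vs ! i \<in> ends T (?es ! i)" "?es ! i \<in> set ?es" using cyc nth_mem[of i ?es] by auto
        then show ?thesis using E wf by (auto simp only: wf_mgraph_def)
      qed
      then show ?thesis by (auto simp: in_set_conv_nth)
    qed
    show ?thesis using E V ends_in wf unfolding subgraph_def wf_mgraph_def by auto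
  qed
  ultimately show False using T by (auto simp: is_tree_def)
qed

lemma is_treeI:
  assumes wf: "wf_mgraph T" and ne: "verts T \<noteq> {}"
    and con: "\<And>x y. x \<in> verts T \<Longrightarrow> y \<in> verts T \<Longrightarrow> linked T (edges T) x y"
    and bridge: "\<And>e x y. e \<in> edges T \<Longrightarrow> ends T e = {x, y} \<Longrightarrow> \<not> linked T (edges T - {e}) x y"
  shows "is_tree T"
proof -
  have "\<not> (subgraph C T \<and> is_cycle C)" for C
  proof
    assume C: "subgraph C T \<and> is_cycle C"
    then obtain vs es where *: "distinct vs" "distinct es" "length es = length vs" "2 \<le> length vs"
       "edges C = set es"
       "\<forall>i<length es. ends C (es ! i) = {vs ! i, vs ! ((i + 1) mod length vs)}"
      by (auto simp: is_cycle_def)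
    let ?n = "length es"
    let ?e = "es ! (?n - 1)"
    have E: "es ! i \<in> edges T" "ends T (es ! i) = ends C (es ! i)" if "i < ?n" for i
      using that C * by (auto simp: subgraph_def)
    have "i < ?n \<Longrightarrow> linked T (edges T - {?e}) (vs ! 0) (vs ! i)" for i
    proof (induction i)
      case (Suc i)
      have "es ! i \<noteq> ?e" using Suc.prems *(2) by (subst nth_eq_iff_index_eq) auto
      moreover have "ends T (es ! i) = {vs ! i, vs ! Suc i}"
        using E(2)[of i] *(3,6) Suc.prems by simp
      ultimately have "linked T (edges T - {?e}) (vs ! i) (vs ! Suc i)"
        using E(1)[of i] Suc.prems by (intro linked_edge[of "es ! i"]) auto
      then show ?case using Suc linked_trans by fastforce
    qed simp
    moreover have "?n - 1 < ?n" using * by auto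
    moreover have "ends T ?e = {vs ! 0, vs ! (?n - 1)}"
    proof -
      have "?n - 1 + 1 = length vs" using * by simp
      then have "(?n - 1 + 1) mod length vs = 0" by simp
      then show ?thesis using E(2)[of "?n - 1"] *(6) \<open>?n - 1 < ?n\<close> by (metis insert_commute)
    qed
    ultimately show False using bridge[of ?e] E(1)[of "?n - 1"] by blast
  qed
  then show ?thesis using assms reachable_iff_linked[OF wf] by (simp add: is_tree_def)
qed

text \<open>The part of the tree that deleting \<open>e\<close> cuts off from the root \<open>\<rho>\<close>.\<close>
definition away :: "('t, 'd) mgraph \<Rightarrow> 't \<Rightarrow> 'd \<Rightarrow> 't set" where
  "away T \<rho> e = {x \<in> verts T. \<not> linked T (edges T - {e}) \<rho> x}"

lemma linked_to_an_end:
  assumes "linked T (edges T) x y" "e \<in> edges T" "ends T e = {a, b}"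
    "linked T (edges T - {e}) a x \<or> linked T (edges T - {e}) b x"
  shows "linked T (edges T - {e}) a y \<or> linked T (edges T - {e}) b y"
  using assms(1)
proof (induction rule: linked_induct)
  case refl
  show ?case using assms(4) .
next
  case (step y z d)
  show ?case
  proof (cases "d = e")
    case True
    then have "z \<in> {a, b}" using step assms(3) by auto
    then show ?thesis by auto
  next
    case False
    then have "linked T (edges T - {e}) y z" using step by (intro linked_edge) auto
    then show ?thesis using step linked_trans by metis
  qed
qed

text \<open>Deleting an edge leaves two parts; which of them lies away from the root is all that
  depends on the root.\<close>
lemma away_complement:
  assumes T: "is_tree T" and e: "e \<in> edges T" and r: "\<rho> \<in> verts T" "\<rho>' \<in> verts T"
  shows "away T \<rho>' e = (if \<rho>' \<in> away T \<rho> e then verts T - away T \<rho> e else away T \<rho> e)"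
proof -
  let ?L = "linked T (edges T - {e})"
  obtain a b where ab: "ends T e = {a, b}" "a \<noteq> b" "a \<in> verts T" "b \<in> verts T"
    using wf_ends_pair[OF is_tree_wf[OF T] e] .
  have nb: "\<not> ?L a b" using is_tree_bridge[OF T e ab(1)] .
  have one: "?L a x \<or> ?L b x" if "x \<in> verts T" for x
    using linked_to_an_end[OF is_tree_linked[OF T ab(3) that] e ab(1)] by auto
  have tr: "?L x y \<longleftrightarrow> (?L a x \<longleftrightarrow> ?L a y)" if "x \<in> verts T" "y \<in> verts T" for x y
    using one[OF that(1)] one[OF that(2)] nb linked_trans linked_sym by metis
  show ?thesis using tr r unfolding away_def by auto
qed

lemma away_subset: "away T \<rho> e \<subseteq> verts T"
  by (auto simp: away_def)

lemma root_not_away: "\<rho> \<notin> away T \<rho> e"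
  by (simp add: away_def)

section \<open>Rooted decompositions of part of a graph\<close>

definition region :: "('t, 'd) mgraph \<Rightarrow> ('t \<Rightarrow> 'v set) \<Rightarrow> 't \<Rightarrow> 'd \<Rightarrow> 'v set" where
  "region T X \<rho> e = (\<Union>t\<in>away T \<rho> e. X t)"

definition load :: "('v, 'e) mgraph \<Rightarrow> ('t, 'd) mgraph \<Rightarrow> ('t \<Rightarrow> 'v set) \<Rightarrow> 't \<Rightarrow> 't \<Rightarrow> nat" where
  "load G T X \<rho> t = card (X t) + card {e \<in> edges T. t \<in> ends T e \<and> 3 \<le> card (cut G (region T X \<rho> e))}"

text \<open>All cuts are taken in the whole graph \<open>G\<close>, although the bags cover only part of it. Seen from
  the root, the uncovered part lies on the root side of every tree edge, which is where
  further trees get attached; only the bound \<open>m\<close> for the root has to leave room for them.\<close>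
definition rooted_decomposition ::
  "('v, 'e) mgraph \<Rightarrow> nat \<Rightarrow> ('t, 'd) mgraph \<Rightarrow> ('t \<Rightarrow> 'v set) \<Rightarrow> 't \<Rightarrow> nat \<Rightarrow> bool" where
  "rooted_decomposition G n T X \<rho> m \<longleftrightarrow> is_tree T \<and> \<rho> \<in> verts T \<and> disjoint_family_on X (verts T) \<and>
     (\<forall>e\<in>edges T. card (cut G (region T X \<rho> e)) \<le> n) \<and>
     (\<forall>t\<in>verts T - {\<rho>}. load G T X \<rho> t \<le> n) \<and> load G T X \<rho> \<rho> \<le> m"

definition decomposable :: "('v, 'e) mgraph \<Rightarrow> nat \<Rightarrow> 'v set \<Rightarrow> nat \<Rightarrow> bool" where
  "decomposable G n A m \<longleftrightarrow> (\<exists>(T :: (nat, nat) mgraph) X \<rho>.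
     rooted_decomposition G n T X \<rho> m \<and> (\<Union>t\<in>verts T. X t) = A)"

lemma decomposable_single: "decomposable G n A (card A)"
proof -
  let ?T = "\<lparr>verts = {0}, edges = {}, ends = \<lambda>_. {}\<rparr> :: (nat, nat) mgraph"
  have "rooted_decomposition G n ?T (\<lambda>_. A) 0 (card A)"
    using is_tree_single[of "0 :: nat"] by (simp add: rooted_decomposition_def load_def disjoint_family_on_def)
  then show ?thesis unfolding decomposable_def by fastforce
qed

lemma decomposable_mono: "decomposable G n A m \<Longrightarrow> m \<le> m' \<Longrightarrow> decomposable G n A m'"
  unfolding decomposable_def rooted_decomposition_def using order_trans by blast

lemma region_complement:
  assumes "disjoint_family_on X (verts T)" and all: "(\<Union>t\<in>verts T. X t) = verts G"
  shows "(\<Union>t\<in>verts T - away T \<rho> e. X t) = verts G - region T X \<rho> e"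
proof -
  have "X s \<inter> X t = {}" if "s \<in> verts T - away T \<rho> e" "t \<in> away T \<rho> e" for s t
    using assms(1) that away_subset[of T \<rho> e] unfolding disjoint_family_on_def by (metis DiffE subsetD)
  then show ?thesis unfolding region_def all[symmetric] by auto
qed

text \<open>If the bags cover the whole graph, moving the root only swaps the two sides of some cuts.\<close>
lemma reroot:
  assumes G: "wf_mgraph G" and D: "rooted_decomposition G n T X \<rho> n" and all: "(\<Union>t\<in>verts T. X t) = verts G"
    and r: "\<rho>' \<in> verts T"
  shows "rooted_decomposition G n T X \<rho>' n"
proof -
  have T: "is_tree T" and r0: "\<rho> \<in> verts T" and dis: "disjoint_family_on X (verts T)"
    using D by (auto simp: rooted_decomposition_def)
  have eq: "cut G (region T X \<rho>' e) = cut G (region T X \<rho> e)" if e: "e \<in> edges T" for e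
  proof (cases "\<rho>' \<in> away T \<rho> e")
    case True
    then have "region T X \<rho>' e = verts G - region T X \<rho> e"
      using region_complement[OF dis all, of \<rho> e] away_complement[OF T e r0 r] by (simp add: region_def)
    then show ?thesis using cut_complement[OF G] by simp
  next
    case False
    then show ?thesis by (simp add: region_def away_complement[OF T e r0 r])
  qed
  have "load G T X \<rho>' t = load G T X \<rho> t" for t
    unfolding load_def by (intro arg_cong2[where f = "(+)"] arg_cong[where f = card]) (use eq in auto)
  then show ?thesis using D r eq unfolding rooted_decomposition_def by auto
qed

definition relabel :: "('t \<Rightarrow> 's) \<Rightarrow> ('d \<Rightarrow> 'c) \<Rightarrow> ('t, 'd) mgraph \<Rightarrow> ('s, 'c) mgraph" where
  "relabel f g T = \<lparr>verts = f ` verts T, edges = g ` edges T, ends = \<lambda>e. f ` ends T (inv g e)\<rparr>"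

lemma linked_relabel:
  assumes f: "inj f" and g: "inj g"
  shows "linked (relabel f g T) (g ` F) (f x) (f y) \<longleftrightarrow> linked T F x y"
proof
  assume "linked (relabel f g T) (g ` F) (f x) (f y)"
  then have "linked T F (inv f (f x)) (inv f (f y))"
  proof (rule linked_transfer)
    fix e a b assume "e \<in> g ` F" "ends (relabel f g T) e = {a, b}"
    then obtain d where d: "d \<in> F" "f ` ends T d = {a, b}" using g by (auto simp: relabel_def)
    then have "inv f ` f ` ends T d = {inv f a, inv f b}" by simp
    then have "ends T d = {inv f a, inv f b}" using f by (simp add: image_image)
    then show "linked T F (inv f a) (inv f b)" by (rule linked_edge[OF d(1)])
  qed
  then show "linked T F x y" using f by simp
next
  assume "linked T F x y"
  then show "linked (relabel f g T) (g ` F) (f x) (f y)"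
  proof (rule linked_transfer)
    fix e a b assume "e \<in> F" "ends T e = {a, b}"
    then show "linked (relabel f g T) (g ` F) (f a) (f b)"
      using g by (intro linked_edge[of "g e"]) (auto simp: relabel_def)
  qed
qed

lemma relabel_decomposition:
  assumes f: "inj f" and g: "inj g" and D: "rooted_decomposition G n T X \<rho> m"
  shows "rooted_decomposition G n (relabel f g T) (X \<circ> inv f) (f \<rho>) m"
    and "(\<Union>t\<in>verts (relabel f g T). (X \<circ> inv f) t) = (\<Union>t\<in>verts T. X t)"
proof -
  let ?T = "relabel f g T" and ?X = "X \<circ> inv f"
  have T: "is_tree T" using D by (simp add: rooted_decomposition_def)
  have wf: "wf_mgraph T" using is_tree_wf[OF T] .
  have sel: "verts ?T = f ` verts T" "edges ?T = g ` edges T" "ends ?T (g e) = f ` ends T e" for e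
    using g by (simp_all add: relabel_def)
  have diff: "g ` edges T - {g e} = g ` (edges T - {e})" for e using g by (auto simp: inj_def)
  have "is_tree ?T"
  proof (rule is_treeI)
    show "wf_mgraph ?T" using wf f g
      by (auto simp: wf_mgraph_def relabel_def card_image inj_on_subset image_mono)
    show "verts ?T \<noteq> {}" using T by (simp add: sel is_tree_def)
    show "linked ?T (edges ?T) x y" if "x \<in> verts ?T" "y \<in> verts ?T" for x y
      using that is_tree_linked[OF T] linked_relabel[OF f g] by (auto simp: sel)
    show "\<not> linked ?T (edges ?T - {e}) x y" if e: "e \<in> edges ?T" "ends ?T e = {x, y}" for e x y
    proof -
      obtain d where d: "d \<in> edges T" "e = g d" using e by (auto simp: sel)
      obtain a b where ab: "ends T d = {a, b}" using wf_ends_pair[OF wf d(1)] .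
      have nl: "\<not> linked T (edges T - {d}) a b" using is_tree_bridge[OF T d(1) ab] .
      have "\<not> linked ?T (edges ?T - {e}) (f a) (f b)"
        unfolding sel d diff linked_relabel[OF f g] by (rule nl)
      moreover have "{x, y} = {f a, f b}" using e(2) d ab by (simp add: sel)
      ultimately show ?thesis using linked_sym by (metis doubleton_eq_iff)
    qed
  qed
  moreover have aw: "away ?T (f \<rho>) (g e) = f ` away T \<rho> e" for e
    unfolding away_def sel diff using linked_relabel[OF f g] by auto
  have reg: "region ?T ?X (f \<rho>) (g e) = region T X \<rho> e" for e
    unfolding region_def aw using f by auto
  have "load G ?T ?X (f \<rho>) (f t) = load G T X \<rho> t" for t
  proof -
    have "{e \<in> edges ?T. f t \<in> ends ?T e \<and> 3 \<le> card (cut G (region ?T ?X (f \<rho>) e))}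
        = g ` {e \<in> edges T. t \<in> ends T e \<and> 3 \<le> card (cut G (region T X \<rho> e))}"
      using f by (auto simp: sel reg inj_image_mem_iff)
    then show ?thesis unfolding load_def using f g by (simp add: card_image inj_on_subset)
  qed
  moreover have "disjoint_family_on ?X (verts ?T)"
  proof -
    have "X s \<inter> X t = {}" if "s \<in> verts T" "t \<in> verts T" "f s \<noteq> f t" for s t
      using D that unfolding rooted_decomposition_def disjoint_family_on_def by metis
    then show ?thesis using f unfolding disjoint_family_on_def by (simp add: sel)
  qed
  moreover have "f \<rho> \<in> verts ?T" using D by (simp add: sel rooted_decomposition_def)
  moreover have "f ` verts T - {f \<rho>} = f ` (verts T - {\<rho>})" using f by (auto simp: inj_def)
  ultimately show "rooted_decomposition G n ?T ?X (f \<rho>) m"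
    using D unfolding rooted_decomposition_def by (auto simp: sel reg)
  show "(\<Union>t\<in>verts ?T. ?X t) = (\<Union>t\<in>verts T. X t)" using f by (simp add: sel)
qed

definition join :: "('t, 'd) mgraph \<Rightarrow> ('t, 'd) mgraph \<Rightarrow> 't \<Rightarrow> 't \<Rightarrow> 'd \<Rightarrow> ('t, 'd) mgraph" where
  "join T1 T2 \<rho>1 \<rho>2 d = \<lparr>verts = verts T1 \<union> verts T2, edges = insert d (edges T1 \<union> edges T2),
     ends = \<lambda>e. if e = d then {\<rho>1, \<rho>2} else if e \<in> edges T1 then ends T1 e else ends T2 e\<rparr>"

locale joinable =
  fixes T1 T2 :: "('t, 'd) mgraph" and \<rho>1 \<rho>2 d
  assumes T1: "is_tree T1" and T2: "is_tree T2"
    and V: "verts T1 \<inter> verts T2 = {}" and E: "edges T1 \<inter> edges T2 = {}" "d \<notin> edges T1" "d \<notin> edges T2"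
    and r1: "\<rho>1 \<in> verts T1" and r2: "\<rho>2 \<in> verts T2"
begin

abbreviation "J \<equiv> join T1 T2 \<rho>1 \<rho>2 d"

lemma sel: "verts J = verts T1 \<union> verts T2" "edges J = insert d (edges T1 \<union> edges T2)"
   "ends J d = {\<rho>1, \<rho>2}" "e \<in> edges T1 \<Longrightarrow> ends J e = ends T1 e" "e \<in> edges T2 \<Longrightarrow> ends J e = ends T2 e"
  using E by (auto simp: join_def)

lemma vert1_not_vert2: "x \<in> verts T1 \<Longrightarrow> x \<notin> verts T2"
  using V by blast

lemma ends1: "e \<in> edges T1 \<Longrightarrow> ends T1 e \<subseteq> verts T1"
  using T1 by (simp add: is_tree_def wf_mgraph_def)

lemma ends2: "e \<in> edges T2 \<Longrightarrow> ends T2 e \<subseteq> verts T2"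
  using T2 by (simp add: is_tree_def wf_mgraph_def)

lemma linked1: "F \<subseteq> edges T1 \<Longrightarrow> linked T1 F x y \<Longrightarrow> F \<subseteq> F' \<Longrightarrow> linked J F' x y"
  using linked_cong[of F T1 J] linked_mono sel(4) by (metis subsetD)

lemma linked2: "F \<subseteq> edges T2 \<Longrightarrow> linked T2 F x y \<Longrightarrow> F \<subseteq> F' \<Longrightarrow> linked J F' x y"
  using linked_cong[of F T2 J] linked_mono sel(5) by (metis subsetD)

text \<open>Collapsing one of the two trees to its root turns walks of the union into walks of the other.\<close>
lemma collapse2:
  assumes "linked J F x y" "F \<subseteq> edges J"
  shows "linked T1 (F \<inter> edges T1) (if x \<in> verts T2 then \<rho>1 else x) (if y \<in> verts T2 then \<rho>1 else y)"
  using assms(1)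
proof (rule linked_transfer[where p = "\<lambda>x. if x \<in> verts T2 then \<rho>1 else x"])
  fix e a b assume e: "e \<in> F" "ends J e = {a, b}"
  then consider "e = d" | "e \<in> edges T1" | "e \<in> edges T2" using assms(2) sel by blast
  then show "linked T1 (F \<inter> edges T1) (if a \<in> verts T2 then \<rho>1 else a) (if b \<in> verts T2 then \<rho>1 else b)"
  proof cases
    case 1
    then have "{a, b} = {\<rho>1, \<rho>2}" using e sel by simp
    then show ?thesis using r1 r2 V by (auto simp: doubleton_eq_iff)
  next
    case 2
    then have ab: "ends T1 e = {a, b}" using e sel by simp
    then have "a \<notin> verts T2" "b \<notin> verts T2" using ends1[OF 2] V by auto
    then show ?thesis using ab 2 e by (auto intro: linked_edge)
  next
    case 3
    then have "a \<in> verts T2" "b \<in> verts T2" using ends2[OF 3] e sel by auto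
    then show ?thesis by simp
  qed
qed

lemma collapse1:
  assumes "linked J F x y" "F \<subseteq> edges J"
  shows "linked T2 (F \<inter> edges T2) (if x \<in> verts T1 then \<rho>2 else x) (if y \<in> verts T1 then \<rho>2 else y)"
  using assms(1)
proof (rule linked_transfer[where p = "\<lambda>x. if x \<in> verts T1 then \<rho>2 else x"])
  fix e a b assume e: "e \<in> F" "ends J e = {a, b}"
  then consider "e = d" | "e \<in> edges T1" | "e \<in> edges T2" using assms(2) sel by blast
  then show "linked T2 (F \<inter> edges T2) (if a \<in> verts T1 then \<rho>2 else a) (if b \<in> verts T1 then \<rho>2 else b)"
  proof cases
    case 1
    then have "{a, b} = {\<rho>1, \<rho>2}" using e sel by simp
    then show ?thesis using r1 r2 V by (auto simp: doubleton_eq_iff)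
  next
    case 3
    then have ab: "ends T2 e = {a, b}" using e sel by simp
    then have "a \<notin> verts T1" "b \<notin> verts T1" using ends2[OF 3] V by auto
    then show ?thesis using ab 3 e by (auto intro: linked_edge)
  next
    case 2
    then have "a \<in> verts T1" "b \<in> verts T1" using ends1[OF 2] e sel by auto
    then show ?thesis by simp
  qed
qed

lemma d_bridge: "linked J (edges J - {d}) x y \<Longrightarrow> x \<in> verts T1 \<Longrightarrow> y \<in> verts T1"
proof (erule linked_invariant)
  fix e a b assume e: "e \<in> edges J - {d}" "ends J e = {a, b}" "a \<in> verts T1"
  have "e \<notin> edges T2"
  proof
    assume "e \<in> edges T2"
    then have "a \<in> verts T2" using e(2) ends2[of e] sel(5)[of e] by auto
    then show False using e(3) V by blast
  qed
  then have "e \<in> edges T1" using e sel by auto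
  then show "b \<in> verts T1" using ends1[of e] sel(4)[of e] e by auto
qed

lemma root1: "x \<in> verts T1 \<Longrightarrow> e \<notin> edges T1 \<Longrightarrow> linked J (edges J - {e}) \<rho>1 x"
  by (rule linked1[OF _ is_tree_linked[OF T1 r1]]) (auto simp: sel)

lemma root2: "x \<in> verts T2 \<Longrightarrow> e \<in> edges T1 \<Longrightarrow> linked J (edges J - {e}) \<rho>1 x"
proof -
  assume *: "x \<in> verts T2" "e \<in> edges T1"
  have "linked J (edges J - {e}) \<rho>2 x"
    by (rule linked2[OF _ is_tree_linked[OF T2 r2]]) (use * E in \<open>auto simp: sel\<close>)
  moreover have "linked J (edges J - {e}) \<rho>1 \<rho>2"
    by (rule linked_edge[of d]) (use * E in \<open>auto simp: sel\<close>)
  ultimately show ?thesis using linked_trans by metis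
qed

lemma is_tree_join: "is_tree J"
proof (rule is_treeI)
  show "wf_mgraph J"
    using is_tree_wf[OF T1] is_tree_wf[OF T2] r1 r2 V E unfolding wf_mgraph_def
    by (auto simp: join_def card_insert_if)
  show "verts J \<noteq> {}" using r1 by (auto simp: sel)
  have "linked J (edges J) \<rho>1 x" if "x \<in> verts J" for x
  proof (cases "x \<in> verts T1")
    case True
    show ?thesis by (rule linked1[OF _ is_tree_linked[OF T1 r1 True]]) (auto simp: sel)
  next
    case False
    have "linked J (edges J) \<rho>2 x"
      by (rule linked2[OF _ is_tree_linked[OF T2 r2]]) (use False that in \<open>auto simp: sel\<close>)
    moreover have "linked J (edges J) \<rho>1 \<rho>2" by (rule linked_edge[of d]) (auto simp: sel)
    ultimately show ?thesis using linked_trans by metis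
  qed
  then show "linked J (edges J) x y" if "x \<in> verts J" "y \<in> verts J" for x y
    using that linked_trans linked_sym by metis
  show "\<not> linked J (edges J - {e}) x y" if e: "e \<in> edges J" "ends J e = {x, y}" for e x y
  proof
    assume l: "linked J (edges J - {e}) x y"
    consider "e = d" | "e \<in> edges T1" | "e \<in> edges T2" using e sel by blast
    then show False
    proof cases
      case 1
      then have "{x, y} = {\<rho>1, \<rho>2}" using e sel by simp
      then show False using d_bridge[of x y] d_bridge[of y x] l linked_sym[OF l] 1 r1 r2 V
        by (auto simp: doubleton_eq_iff)
    next
      case 2
      have xy: "ends T1 e = {x, y}" using 2 e sel by simp
      then have "x \<notin> verts T2" "y \<notin> verts T2" using ends1[OF 2] V by auto
      then have "linked T1 ((edges J - {e}) \<inter> edges T1) x y" using collapse2[OF l] by auto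
      then have "linked T1 (edges T1 - {e}) x y" by (rule linked_mono) auto
      then show False using is_tree_bridge[OF T1 2 xy] by blast
    next
      case 3
      have xy: "ends T2 e = {x, y}" using 3 e sel by simp
      then have "x \<notin> verts T1" "y \<notin> verts T1" using ends2[OF 3] V by auto
      then have "linked T2 ((edges J - {e}) \<inter> edges T2) x y" using collapse1[OF l] by auto
      then have "linked T2 (edges T2 - {e}) x y" by (rule linked_mono) auto
      then show False using is_tree_bridge[OF T2 3 xy] by blast
    qed
  qed
qed

lemma away_d: "away J \<rho>1 d = verts T2"
  using d_bridge[of \<rho>1] root1[of _ d] r1 V E by (auto simp: away_def sel)

lemma away1:
  assumes e: "e \<in> edges T1"
  shows "away J \<rho>1 e = away T1 \<rho>1 e"
proof -
  have "linked J (edges J - {e}) \<rho>1 x \<longleftrightarrow> linked T1 (edges T1 - {e}) \<rho>1 x" if x: "x \<in> verts T1" for x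
  proof
    assume "linked J (edges J - {e}) \<rho>1 x"
    then have "linked T1 ((edges J - {e}) \<inter> edges T1) \<rho>1 x"
      using collapse2[of "edges J - {e}" \<rho>1 x] x vert1_not_vert2[of x] by auto
    then show "linked T1 (edges T1 - {e}) \<rho>1 x" by (rule linked_mono) auto
  qed (rule linked1, auto simp: sel)
  then show ?thesis using root2[OF _ e] by (auto simp: away_def sel)
qed

lemma away2:
  assumes e: "e \<in> edges T2"
  shows "away J \<rho>1 e = away T2 \<rho>2 e"
proof -
  have "linked J (edges J - {e}) \<rho>1 x \<longleftrightarrow> linked T2 (edges T2 - {e}) \<rho>2 x" if x: "x \<in> verts T2" for x
  proof
    assume "linked J (edges J - {e}) \<rho>1 x"
    then have "linked T2 ((edges J - {e}) \<inter> edges T2) \<rho>2 x"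
      using collapse1[of "edges J - {e}" \<rho>1 x] x vert1_not_vert2[of x] r1 by (cases "x \<in> verts T1") auto
    then show "linked T2 (edges T2 - {e}) \<rho>2 x" by (rule linked_mono) auto
  next
    assume "linked T2 (edges T2 - {e}) \<rho>2 x"
    then have "linked J (edges J - {e}) \<rho>2 x" by (rule linked2[rotated]) (auto simp: sel)
    moreover have "linked J (edges J - {e}) \<rho>1 \<rho>2"
      by (rule linked_edge[of d]) (use e E in \<open>auto simp: sel\<close>)
    ultimately show "linked J (edges J - {e}) \<rho>1 x" using linked_trans by metis
  qed
  moreover have "e \<notin> edges T1" using e E by blast
  ultimately show ?thesis using root1[of _ e] V by (auto simp: away_def sel)
qed

end

text \<open>Joining the two roots by an edge creates one new region, \<open>A2\<close>, and leaves the others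
  alone, because they are seen from the roots. If its cut has three or more edges, the new edge counts
  at both of its ends.\<close>
lemma decomposable_join:
  assumes D1: "decomposable G n A1 m1" and D2: "decomposable G n A2 m2" and dis: "A1 \<inter> A2 = {}"
    and c: "card (cut G A2) \<le> n" and m2: "m2 < n"
  shows "decomposable G n (A1 \<union> A2) (m1 + (if 3 \<le> card (cut G A2) then 1 else 0))"
proof -
  obtain T1' :: "(nat, nat) mgraph" and X1' \<rho>1' where
    1: "rooted_decomposition G n T1' X1' \<rho>1' m1" "(\<Union>t\<in>verts T1'. X1' t) = A1"
    using D1 by (auto simp: decomposable_def)
  obtain T2' :: "(nat, nat) mgraph" and X2' \<rho>2' where
    2: "rooted_decomposition G n T2' X2' \<rho>2' m2" "(\<Union>t\<in>verts T2'. X2' t) = A2"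
    using D2 by (auto simp: decomposable_def)
  \<comment> \<open>Even and odd labels keep the two trees apart, and 0 remains for the new edge.\<close>
  let ?f1 = "\<lambda>x :: nat. 2 * x" and ?f2 = "\<lambda>x :: nat. 2 * x + 1" and ?g2 = "\<lambda>x :: nat. 2 * x + 2"
  have inj: "inj ?f1" "inj ?f2" "inj ?g2" by (auto simp: inj_def)
  define T1 T2 where T: "T1 = relabel ?f1 ?f2 T1'" "T2 = relabel ?f2 ?g2 T2'"
  define X1 X2 where X: "X1 = X1' \<circ> inv ?f1" "X2 = X2' \<circ> inv ?f2"
  define \<rho>1 \<rho>2 where r: "\<rho>1 = ?f1 \<rho>1'" "\<rho>2 = ?f2 \<rho>2'"
  have R1: "rooted_decomposition G n T1 X1 \<rho>1 m1" "(\<Union>t\<in>verts T1. X1 t) = A1"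
    using relabel_decomposition[OF inj(1,2) 1(1)] 1(2) unfolding T X r by auto
  have R2: "rooted_decomposition G n T2 X2 \<rho>2 m2" "(\<Union>t\<in>verts T2. X2 t) = A2"
    using relabel_decomposition[OF inj(2,3) 2(1)] 2(2) unfolding T X r by auto
  have V: "verts T1 \<inter> verts T2 = {}" "edges T1 \<inter> edges T2 = {}"
    unfolding T relabel_def by (auto, presburger+)
  have d: "0 \<notin> edges T1" "0 \<notin> edges T2" unfolding T relabel_def by auto
  interpret joinable T1 T2 \<rho>1 \<rho>2 0
    by unfold_locales (use R1 R2 V d in \<open>auto simp: rooted_decomposition_def\<close>)
  define X where "X t = (if t \<in> verts T1 then X1 t else X2 t)" for t
  have XX: "t \<in> verts T1 \<Longrightarrow> X t = X1 t" "t \<in> verts T2 \<Longrightarrow> X t = X2 t" for t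
    using V by (auto simp: X_def)
  have reg1: "region J X \<rho>1 e = region T1 X1 \<rho>1 e" if "e \<in> edges T1" for e
    unfolding region_def away1[OF that] using XX away_subset[of T1 \<rho>1 e] by (auto simp: subset_iff)
  have reg2: "region J X \<rho>1 e = region T2 X2 \<rho>2 e" if "e \<in> edges T2" for e
    unfolding region_def away2[OF that] using XX away_subset[of T2 \<rho>2 e] by (auto simp: subset_iff)
  have regd: "region J X \<rho>1 0 = A2"
    unfolding region_def away_d R2(2)[symmetric] using XX by auto
  have all: "(\<Union>t\<in>verts J. X t) = A1 \<union> A2"
    unfolding sel R1(2)[symmetric] R2(2)[symmetric] using XX by auto
  let ?B1 = "\<lambda>t. {e \<in> edges T1. t \<in> ends T1 e \<and> 3 \<le> card (cut G (region T1 X1 \<rho>1 e))}"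
  let ?B2 = "\<lambda>t. {e \<in> edges T2. t \<in> ends T2 e \<and> 3 \<le> card (cut G (region T2 X2 \<rho>2 e))}"
  let ?b = "if 3 \<le> card (cut G A2) then 1 else 0 :: nat"
  have fin: "finite (?B1 t)" "finite (?B2 t)" for t
    using is_tree_wf[OF T1] is_tree_wf[OF T2] by (auto simp: wf_mgraph_def)
  have bold1: "{e \<in> edges J. t \<in> ends J e \<and> 3 \<le> card (cut G (region J X \<rho>1 e))}
      = ?B1 t \<union> (if t = \<rho>1 \<and> 3 \<le> card (cut G A2) then {0} else {})" if t: "t \<in> verts T1" for t
  proof -
    have "t \<noteq> \<rho>2" "\<And>e. e \<in> edges T2 \<Longrightarrow> t \<notin> ends T2 e" using t V r2 ends2 by blast+
    then show ?thesis using d by (auto simp: sel reg1 reg2 regd split: if_splits)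
  qed
  have bold2: "{e \<in> edges J. t \<in> ends J e \<and> 3 \<le> card (cut G (region J X \<rho>1 e))}
      = ?B2 t \<union> (if t = \<rho>2 \<and> 3 \<le> card (cut G A2) then {0} else {})" if t: "t \<in> verts T2" for t
  proof -
    have "t \<noteq> \<rho>1" "\<And>e. e \<in> edges T1 \<Longrightarrow> t \<notin> ends T1 e" using t V r1 ends1 by blast+
    then show ?thesis using d by (auto simp: sel reg1 reg2 regd split: if_splits)
  qed
  have load1: "load G J X \<rho>1 t = load G T1 X1 \<rho>1 t + (if t = \<rho>1 then ?b else 0)" if t: "t \<in> verts T1" for t
    unfolding load_def bold1[OF t] using XX(1)[OF t] fin d by (auto simp: card_insert_if)
  have load2: "load G J X \<rho>1 t = load G T2 X2 \<rho>2 t + (if t = \<rho>2 then ?b else 0)" if t: "t \<in> verts T2" for t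
    unfolding load_def bold2[OF t] using XX(2)[OF t] fin d by (auto simp: card_insert_if)
  have "load G J X \<rho>1 t \<le> n" if t: "t \<in> verts J - {\<rho>1}" for t
  proof (cases "t \<in> verts T1")
    case True
    then show ?thesis using load1[OF True] R1(1) t by (auto simp: rooted_decomposition_def)
  next
    case False
    then have t2: "t \<in> verts T2" using t sel by auto
    show ?thesis
    proof (cases "t = \<rho>2")
      case True
      then have "load G T2 X2 \<rho>2 t \<le> m2" using R2(1) by (simp add: rooted_decomposition_def)
      then show ?thesis using load2[OF t2] m2 by (auto split: if_splits)
    next
      case False
      then show ?thesis using load2[OF t2] R2(1) t2 by (auto simp: rooted_decomposition_def)
    qed
  qed
  moreover have "load G J X \<rho>1 \<rho>1 \<le> m1 + ?b"
    using load1[OF r1] R1(1) by (auto simp: rooted_decomposition_def)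
  moreover have "card (cut G (region J X \<rho>1 e)) \<le> n" if "e \<in> edges J" for e
    using that R1(1) R2(1) c reg1 reg2 regd unfolding sel rooted_decomposition_def by auto
  moreover have "disjoint_family_on X (verts J)" unfolding disjoint_family_on_def
  proof (intro ballI impI)
    fix s t assume st: "s \<in> verts J" "t \<in> verts J" "s \<noteq> t"
    have "disjoint_family_on X1 (verts T1)" "disjoint_family_on X2 (verts T2)"
      using R1(1) R2(1) by (auto simp: rooted_decomposition_def)
    moreover have "X1 a \<inter> X2 b = {}" if "a \<in> verts T1" "b \<in> verts T2" for a b
      using that dis R1(2) R2(2) by blast
    ultimately show "X s \<inter> X t = {}"
      using st unfolding sel disjoint_family_on_def Un_iff by (elim disjE) (simp_all add: XX Int_commute)
  qed
  ultimately have "rooted_decomposition G n J X \<rho>1 (m1 + ?b)"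
    using is_tree_join r1 unfolding rooted_decomposition_def by (auto simp: sel)
  then show ?thesis using all unfolding decomposable_def by blast
qed

text \<open>The contracted vertex \<open>v\<close> stands for the uncovered part, so the root moves to its bag,
  and its removal frees one unit there.\<close>
lemma decomposable_uncontract:
  assumes G: "wf_mgraph G" and v: "v \<in> W" and D: "decomposable (contract G W v) n (verts (contract G W v)) n"
  shows "decomposable G n (verts G - W) (n - 1)" "n > 0"
proof -
  let ?C = "contract G W v"
  have C: "wf_mgraph ?C" using contract_wf[OF G v] .
  obtain T :: "(nat, nat) mgraph" and X \<rho>0 where T: "rooted_decomposition ?C n T X \<rho>0 n"
    "(\<Union>t\<in>verts T. X t) = verts ?C" using D by (auto simp: decomposable_def)
  have "v \<in> verts ?C" by (simp add: contract_def)
  then obtain \<rho> where r: "\<rho> \<in> verts T" "v \<in> X \<rho>" using T(2) by blast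
  have R: "rooted_decomposition ?C n T X \<rho> n" using reroot[OF C T r(1)] .
  then have dis: "disjoint_family_on X (verts T)" by (simp add: rooted_decomposition_def)
  have only: "v \<notin> X t" if "t \<in> verts T" "t \<noteq> \<rho>" for t
    using dis r that unfolding disjoint_family_on_def by blast
  have sub: "X t - {v} \<subseteq> verts G - W" if "t \<in> verts T" for t
    using that T(2) by (auto simp: contract_def)
  let ?X = "\<lambda>t. X t - {v}"
  have reg: "region T ?X \<rho> e = region T X \<rho> e" for e
  proof -
    have "X t - {v} = X t" if "t \<in> away T \<rho> e" for t
    proof -
      have "t \<in> verts T" "t \<noteq> \<rho>" using that by (auto simp: away_def)
      then show ?thesis using only by simp
    qed
    then show ?thesis unfolding region_def by simp
  qed
  have cut_eq: "cut ?C (region T X \<rho> e) = cut G (region T X \<rho> e)" for e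
  proof (rule cut_contract[OF G _ v])
    show "region T X \<rho> e \<inter> W = {}"
      unfolding reg[symmetric] using sub away_subset[of T \<rho> e] by (force simp: region_def)
  qed
  have "finite (X \<rho>)" using C T(2) r finite_subset[of "X \<rho>" "verts ?C"] by (auto simp: wf_mgraph_def)
  then have rho: "load G T ?X \<rho> \<rho> < load ?C T X \<rho> \<rho>"
    unfolding load_def reg cut_eq using card_Diff1_less[of "X \<rho>" v] r by linarith
  have "load G T ?X \<rho> t = load ?C T X \<rho> t" if "t \<in> verts T - {\<rho>}" for t
    unfolding load_def reg cut_eq using only[of t] that by simp
  moreover have "disjoint_family_on ?X (verts T)" using dis unfolding disjoint_family_on_def by blast
  moreover have "load ?C T X \<rho> \<rho> \<le> n" using R by (simp add: rooted_decomposition_def)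
  ultimately have "rooted_decomposition G n T ?X \<rho> (n - 1)"
    using R rho unfolding rooted_decomposition_def reg cut_eq by auto
  moreover have "(\<Union>t\<in>verts T. ?X t) = verts G - W"
  proof -
    have "(\<Union>t\<in>verts T. ?X t) = (\<Union>t\<in>verts T. X t) - {v}" by blast
    then show ?thesis unfolding T(2) using v by (auto simp: contract_def)
  qed
  ultimately show "decomposable G n (verts G - W) (n - 1)" unfolding decomposable_def by blast
  show "n > 0" using rho \<open>load ?C T X \<rho> \<rho> \<le> n\<close> by simp
qed

section \<open>Bounding the tree-cut width\<close>

lemma linked_last_edge:
  assumes "linked G F x y" "x \<noteq> y"
  shows "\<exists>e\<in>F. y \<in> ends G e"
  using assms(1)[unfolded linked_def] by (rule rtranclE) (use assms(2) in \<open>auto simp: adj_def\<close>)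

lemma linked_first_edge: "linked G F x y \<Longrightarrow> x \<noteq> y \<Longrightarrow> \<exists>e\<in>F. x \<in> ends G e"
  using linked_last_edge linked_sym by metis

lemma immersion_first_edges:
  assumes H: "wf_mgraph H" and I: "links_immersion H J p F"
  shows "\<exists>g. \<forall>x. \<forall>f\<in>edges H. x \<in> ends H f \<longrightarrow> g x f \<in> F f \<and> p x \<in> ends J (g x f)"
proof -
  have "\<exists>e. e \<in> F f \<and> p x \<in> ends J e" if f: "f \<in> edges H" "x \<in> ends H f" for f x
  proof -
    obtain a b where ab: "ends H f = {a, b}" "a \<noteq> b" "a \<in> verts H" "b \<in> verts H"
      using wf_ends_pair[OF H f(1)] .
    obtain y where y: "ends H f = {x, y}" "x \<noteq> y" "x \<in> verts H" "y \<in> verts H"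
      using ab f(2) by (cases "x = a") (auto simp: insert_commute)
    then have "p x \<noteq> p y" "linked J (F f) (p x) (p y)"
      using I f(1) by (auto simp: links_immersion_def inj_on_def)
    then show ?thesis using linked_first_edge by metis
  qed
  then have "\<forall>x. \<forall>f\<in>edges H. x \<in> ends H f \<longrightarrow>
      (SOME e. e \<in> F f \<and> p x \<in> ends J e) \<in> F f \<and> p x \<in> ends J (SOME e. e \<in> F f \<and> p x \<in> ends J e)"
  proof (intro allI ballI impI)
    fix x f assume f: "f \<in> edges H" "x \<in> ends H f"
    then have "\<exists>e. e \<in> F f \<and> p x \<in> ends J e"
      using \<open>\<And>f x. f \<in> edges H \<Longrightarrow> x \<in> ends H f \<Longrightarrow> \<exists>e. e \<in> F f \<and> p x \<in> ends J e\<close> by blast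
    then show "(SOME e. e \<in> F f \<and> p x \<in> ends J e) \<in> F f \<and> p x \<in> ends J (SOME e. e \<in> F f \<and> p x \<in> ends J e)"
      by (rule someI_ex)
  qed
  then show ?thesis by (intro exI[of _ "\<lambda>x f. SOME e. e \<in> F f \<and> p x \<in> ends J e"])
qed

lemma immersion_degree:
  assumes H: "wf_mgraph H" and I: "links_immersion H J p F" and J: "finite (edges J)"
  shows "degree H x \<le> degree J (p x)"
proof -
  obtain g where "\<forall>x. \<forall>f\<in>edges H. x \<in> ends H f \<longrightarrow> g x f \<in> F f \<and> p x \<in> ends J (g x f)"
    using immersion_first_edges[OF H I] by (elim exE)
  then have g: "\<And>f x. f \<in> edges H \<Longrightarrow> x \<in> ends H f \<Longrightarrow> g x f \<in> F f \<and> p x \<in> ends J (g x f)" by blast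
  let ?E = "{f \<in> edges H. x \<in> ends H f}"
  have "inj_on (g x) ?E"
  proof (rule inj_onI)
    fix f f' assume "f \<in> ?E" "f' \<in> ?E" "g x f = g x f'"
    then show "f = f'" using g[of f x] g[of f' x] I unfolding links_immersion_def
      by (metis (mono_tags, lifting) IntI empty_iff mem_Collect_eq)
  qed
  moreover have "g x ` ?E \<subseteq> {e \<in> edges J. p x \<in> ends J e}"
  proof clarify
    fix f assume f: "f \<in> edges H" "x \<in> ends H f"
    then have "F f \<subseteq> edges J" using I by (simp add: links_immersion_def)
    then show "g x f \<in> edges J \<and> p x \<in> ends J (g x f)" using g[OF f] by blast
  qed
  moreover have "finite {e \<in> edges J. p x \<in> ends J e}" using J by simp
  ultimately show ?thesis unfolding degree_def by (rule card_inj_on_le)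
qed

lemma immersion_edge_injection:
  assumes H: "wf_mgraph H" and I: "links_immersion H J p F"
  shows "\<exists>g. (\<forall>f\<in>edges H. g f \<in> F f) \<and> inj_on g (edges H) \<and> g ` edges H \<subseteq> edges J"
proof -
  obtain g where "\<forall>x. \<forall>f\<in>edges H. x \<in> ends H f \<longrightarrow> g x f \<in> F f \<and> p x \<in> ends J (g x f)"
    using immersion_first_edges[OF H I] by (elim exE)
  then have g: "\<And>f x. f \<in> edges H \<Longrightarrow> x \<in> ends H f \<Longrightarrow> g x f \<in> F f \<and> p x \<in> ends J (g x f)" by blast
  let ?g = "\<lambda>f. g (SOME x. x \<in> ends H f) f"
  have gF: "?g f \<in> F f" if f: "f \<in> edges H" for f
  proof -
    obtain a b where "ends H f = {a, b}" using wf_ends_pair[OF H f] .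
    then have "(SOME x. x \<in> ends H f) \<in> ends H f" using someI[of "\<lambda>x. x \<in> ends H f" a] by simp
    then show ?thesis using g f by blast
  qed
  moreover have "inj_on ?g (edges H)"
  proof (rule inj_onI)
    fix f f' assume "f \<in> edges H" "f' \<in> edges H" "?g f = ?g f'"
    moreover from this have "?g f \<in> F f \<inter> F f'" using gF[of f] gF[of f'] by simp
    ultimately show "f = f'" using I unfolding links_immersion_def by blast
  qed
  moreover have "?g ` edges H \<subseteq> edges J"
  proof (rule image_subsetI)
    fix f assume f: "f \<in> edges H"
    then have "F f \<subseteq> edges J" using I by (simp add: links_immersion_def)
    then show "?g f \<in> edges J" using gF[OF f] by blast
  qed
  moreover have "\<forall>f\<in>edges H. ?g f \<in> F f" using gF by (rule ballI)
  ultimately show ?thesis by (intro exI[of _ ?g] conjI)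
qed

lemma immersion_sizes:
  assumes H: "wf_mgraph H" and I: "links_immersion H J p F"
    and J: "finite (verts J)" "finite (edges J)"
  shows "card (verts H) \<le> card (verts J)" "card (edges H) \<le> card (edges J)"
proof -
  show "card (verts H) \<le> card (verts J)"
    by (rule card_inj_on_le[of p]) (use I J in \<open>auto simp: links_immersion_def\<close>)
  obtain g where "inj_on g (edges H)" "g ` edges H \<subseteq> edges J"
    using immersion_edge_injection[OF H I] by (elim exE conjE)
  then show "card (edges H) \<le> card (edges J)" by (rule card_inj_on_le) (rule J)
qed

text \<open>Between graphs with equally many vertices and edges, an immersion uses every path with just
  one edge and is an isomorphism.\<close>
lemma immersion_same_size_reverse:
  assumes H: "wf_mgraph H" and K: "wf_mgraph K" and "admits_weak_immersion K H"
    and c: "card (verts K) = card (verts H)" "card (edges K) = card (edges H)"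
  shows "admits_weak_immersion H K"
proof -
  obtain p F where I: "links_immersion H K p F" using assms(3) admits_iff_links[OF K H] by blast
  have fin: "finite (verts K)" "finite (edges K)" using K by (auto simp: wf_mgraph_def)
  have p: "inj_on p (verts H)" "p ` verts H = verts K"
    using I c fin unfolding links_immersion_def by (auto simp: card_image card_subset_eq)
  obtain g where g: "\<forall>f\<in>edges H. g f \<in> F f" "inj_on g (edges H)" "g ` edges H \<subseteq> edges K"
    using immersion_edge_injection[OF H I] by (elim exE conjE)
  then have gK: "g ` edges H = edges K" using c fin by (simp add: card_image card_subset_eq)
  have Fg: "F f = {g f}" if f: "f \<in> edges H" for f
  proof -
    have "e = g f" if e: "e \<in> F f" for e
    proof -
      have "e \<in> edges K" using I f e by (auto simp: links_immersion_def)
      then obtain f' where f': "f' \<in> edges H" "e = g f'" using gK by blast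
      have "e \<in> F f \<inter> F f'" using e g(1) f' by blast
      then have "f = f'" using I f f'(1) unfolding links_immersion_def by blast
      then show ?thesis using f'(2) by simp
    qed
    then show ?thesis using g(1) f by blast
  qed
  let ?p = "inv_into (verts H) p" and ?g = "inv_into (edges H) g"
  have gg: "?g e \<in> edges H" "g (?g e) = e" if "e \<in> edges K" for e
    using that gK by (metis inv_into_into, metis f_inv_into_f)
  have "links_immersion K H ?p (\<lambda>e. {?g e})" unfolding links_immersion_def
  proof (intro conjI ballI allI impI)
    fix e assume e: "e \<in> edges K"
    show "{?g e} \<subseteq> edges H" using gg[OF e] by simp
    fix a b assume ab: "ends K e = {a, b}"
    obtain x y where xy: "ends H (?g e) = {x, y}" "x \<noteq> y" "x \<in> verts H" "y \<in> verts H"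
      using wf_ends_pair[OF H gg(1)[OF e]] .
    have "linked K {e} (p x) (p y)"
      using I gg[OF e] Fg[OF gg(1)[OF e]] xy unfolding links_immersion_def by metis
    moreover have ne: "p x \<noteq> p y" using xy p by (simp add: inj_on_eq_iff)
    ultimately have "p x \<in> ends K e" "p y \<in> ends K e"
      using linked_first_edge linked_last_edge by fastforce+
    then have "{a, b} = {p x, p y}" using ab ne by auto
    then have "{?p a, ?p b} = {x, y}"
      using xy inv_into_f_f[OF p(1)] by (auto simp: doubleton_eq_iff)
    then show "linked H {?g e} (?p a) (?p b)" using xy(1) by (auto intro: linked_edge)
  next
    fix e e' assume "e \<in> edges K" "e' \<in> edges K" "e \<noteq> e'"
    then show "{?g e} \<inter> {?g e'} = {}" using gg by (metis disjoint_insert(2) inf_bot_right singletonD)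
  next
    show "inj_on ?p (verts K)" using p by (metis inj_on_inv_into order_refl)
    show "?p ` verts K \<subseteq> verts H" using p by (metis inv_into_into image_subsetI)
  qed
  then show ?thesis by (rule links_weak_immersion[OF H K])
qed

text \<open>A candidate with as many vertices and edges as possible is maximal under immersion.\<close>
lemma three_center_exists:
  assumes J: "finite (verts J)" "finite (edges J)" and X: "X \<subseteq> verts J"
  shows "\<exists>H. is_three_center J X H"
proof -
  let ?H0 = "\<lparr>verts = X, edges = {}, ends = ends J\<rparr>"
  let ?m = "\<lambda>H. card (verts H) + card (edges H)"
  have "weak_immersion ?H0 J id (\<lambda>_. J)" using X by (auto simp: weak_immersion_def)
  then have "three_center_candidate J X ?H0"
    unfolding three_center_candidate_def using J X finite_subset
    by (intro conjI exI[of _ id] exI[of _ "\<lambda>_. J"]) (auto simp: wf_mgraph_def)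
  moreover have bound: "?m H < Suc (?m J)" if H: "three_center_candidate J X H" for H
  proof -
    obtain p pe where "wf_mgraph H" "weak_immersion H J p pe" using H by (auto simp: three_center_candidate_def)
    then have "card (verts H) \<le> card (verts J) \<and> card (edges H) \<le> card (edges J)"
      using immersion_sizes[OF _ weak_immersion_links J] by blast
    then show ?thesis by simp
  qed
  ultimately obtain H where H: "three_center_candidate J X H"
    and max: "\<And>H'. three_center_candidate J X H' \<Longrightarrow> ?m H' \<le> ?m H"
    using ex_has_greatest_nat[of "three_center_candidate J X" ?H0 ?m "Suc (?m J)"] by blast
  have "admits_weak_immersion H H'" if H': "three_center_candidate J X H'" "admits_weak_immersion H' H" for H'
  proof -
    have wf: "wf_mgraph H" "wf_mgraph H'" using H H' by (auto simp: three_center_candidate_def)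
    have fin: "finite (verts H')" "finite (edges H')" using wf by (auto simp: wf_mgraph_def)
    obtain p F where "links_immersion H H' p F" using H'(2) admits_iff_links[OF wf(2,1)] by blast
    then have "card (verts H) \<le> card (verts H')" "card (edges H) \<le> card (edges H')"
      using immersion_sizes[OF wf(1) _ fin] by blast+
    then have "card (verts H') = card (verts H)" "card (edges H') = card (edges H)"
      using max[OF H'(1)] by linarith+
    then show ?thesis using immersion_same_size_reverse[OF wf H'(2)] by blast
  qed
  then show ?thesis using H unfolding is_three_center_def by blast
qed

text \<open>Immersions do not decrease degrees, so a vertex of the 3-center that lies outside \<open>X\<close> uses
  a vertex of degree at least three.\<close>
lemma card_three_center:
  assumes J: "finite (verts J)" "finite (edges J)" and X: "X \<subseteq> verts J"
  shows "card (verts (three_center J X)) \<le> card X + card {z \<in> verts J - X. 3 \<le> degree J z}"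
proof -
  let ?H = "three_center J X"
  have "is_three_center J X ?H" unfolding three_center_def by (rule someI_ex[OF three_center_exists[OF assms]])
  then obtain p pe where wf: "wf_mgraph ?H" and I: "weak_immersion ?H J p pe"
    and deg: "\<forall>x\<in>verts ?H. degree ?H x \<le> 2 \<longrightarrow> p x \<in> X"
    by (auto simp: is_three_center_def three_center_candidate_def)
  have L: "links_immersion ?H J p (\<lambda>f. edges (pe f))" using weak_immersion_links[OF I] .
  let ?Z = "{z \<in> verts J - X. 3 \<le> degree J z}"
  have "p x \<in> X \<union> ?Z" if x: "x \<in> verts ?H" for x
  proof (cases "degree ?H x \<le> 2")
    case False
    then have "3 \<le> degree J (p x)" using immersion_degree[OF wf L J(2), of x] by simp
    moreover have "p x \<in> verts J" using L x by (auto simp: links_immersion_def)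
    ultimately show ?thesis by blast
  qed (use deg x in blast)
  then have "p ` verts ?H \<subseteq> X \<union> ?Z" by blast
  moreover have "inj_on p (verts ?H)" using L by (simp add: links_immersion_def)
  moreover have "finite (X \<union> ?Z)" using J X finite_subset by auto
  ultimately have "card (verts ?H) \<le> card (X \<union> ?Z)" by (intro card_inj_on_le)
  also have "\<dots> \<le> card X + card ?Z" by (rule card_Un_le)
  finally show ?thesis .
qed

lemma linked_avoiding:
  assumes "linked T F x y" "x \<noteq> t"
  shows "linked T {e \<in> F. t \<notin> ends T e} x y \<or>
    (\<exists>e\<in>F. \<exists>s. ends T e = {t, s} \<and> linked T {e \<in> F. t \<notin> ends T e} x s)"
  using assms(1)
proof (induction rule: linked_induct)
  case (step y z e)
  let ?F = "{e \<in> F. t \<notin> ends T e}"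
  from step.IH show ?case
  proof
    assume l: "linked T ?F x y"
    have "y \<noteq> t" using linked_last_edge[OF l] assms(2) by blast
    show ?thesis
    proof (cases "z = t")
      case True
      then have "ends T e = {t, y}" using step.hyps by (simp add: insert_commute)
      then show ?thesis using l step.hyps by blast
    next
      case False
      then have "e \<in> ?F" using step.hyps \<open>y \<noteq> t\<close> by simp
      then have "linked T ?F y z" using step.hyps(3) by (rule linked_edge)
      then show ?thesis using linked_trans[OF l] by simp
    qed
  qed simp
qed simp

text \<open>The components of \<open>T - t\<close> are the parts cut off from \<open>t\<close> by the edges at \<open>t\<close>.\<close>
lemma component_is_away:
  assumes T: "is_tree T" and t: "t \<in> verts T" and C: "C \<in> components (delete_vertex T t)"
  shows "\<exists>e\<in>edges T. t \<in> ends T e \<and> C = away T t e"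
proof -
  let ?D = "delete_vertex T t" and ?E = "{e \<in> edges T. t \<notin> ends T e}"
  have wf: "wf_mgraph T" using is_tree_wf[OF T] .
  have D: "wf_mgraph ?D" using wf by (auto simp: wf_mgraph_def delete_vertex_def)
  have sel: "verts ?D = verts T - {t}" "edges ?D = ?E" by (auto simp: delete_vertex_def)
  obtain v where v: "v \<in> verts T" "v \<noteq> t" "C = component_of ?D v"
    using C sel by (auto simp: components_def)
  have "linked ?D ?E x y \<longleftrightarrow> linked T ?E x y" for x y
    by (rule linked_cong) (simp add: delete_vertex_def)
  then have Ceq: "C = {x \<in> verts T - {t}. linked T ?E v x}"
    using v reachable_iff_linked[OF D, of v] by (auto simp: component_of_def sel)
  have "\<not> linked T ?E v t" using linked_last_edge[of T ?E v t] v by auto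
  then obtain e s where e: "e \<in> edges T" "ends T e = {t, s}" "linked T ?E v s"
    using linked_avoiding[OF is_tree_linked[OF T v(1) t] v(2)] by auto
  let ?L = "linked T (edges T - {e})"
  have nb: "\<not> ?L t s" using is_tree_bridge[OF T e(1,2)] .
  have st: "s \<noteq> t" using nb by auto
  have mono: "?L x y" if "linked T ?E x y" for x y using that by (rule linked_mono) (use e in auto)
  have "x \<in> C \<longleftrightarrow> \<not> ?L t x" if x: "x \<in> verts T" for x
  proof
    assume "x \<in> C"
    then have "linked T ?E s x" using Ceq e(3) linked_sym linked_trans by (metis (no_types, lifting) mem_Collect_eq)
    then have "?L x s" using mono linked_sym by metis
    then show "\<not> ?L t x" using nb linked_trans by metis
  next
    assume n: "\<not> ?L t x"
    then have sx: "?L s x" using linked_to_an_end[OF is_tree_linked[OF T t x] e(1,2)] by auto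
    have "\<not> (\<exists>d\<in>edges T - {e}. \<exists>s'. ends T d = {t, s'} \<and> linked T {d \<in> edges T - {e}. t \<notin> ends T d} s s')"
    proof
      assume "\<exists>d\<in>edges T - {e}. \<exists>s'. ends T d = {t, s'} \<and> linked T {d \<in> edges T - {e}. t \<notin> ends T d} s s'"
      then obtain d s' where d: "d \<in> edges T - {e}" "ends T d = {t, s'}"
        "linked T {d \<in> edges T - {e}. t \<notin> ends T d} s s'" by blast
      have "?L s s'" using d(3) by (rule linked_mono) auto
      moreover have "?L t s'" using linked_edge[OF d(1,2)] .
      ultimately show False using nb linked_sym linked_trans by metis
    qed
    then have "linked T {d \<in> edges T - {e}. t \<notin> ends T d} s x"
      using linked_avoiding[OF sx st] by argo
    then have "linked T ?E s x" by (rule linked_mono) auto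
    then have "linked T ?E v x" by (rule linked_trans[OF e(3)])
    moreover have "x \<noteq> t" using n by auto
    ultimately show "x \<in> C" using Ceq x by simp
  qed
  then have "C = away T t e" using Ceq by (auto simp: away_def)
  then show ?thesis using e by blast
qed

text \<open>The degree of a consolidated vertex of the torso is at most the size of the
  cut of its part, which is the region of an edge at \<open>t\<close> when \<open>t\<close> is the root.\<close>
lemma torso_center_le_load:
  assumes G: "wf_mgraph G" and T: "is_tree T" and t: "t \<in> verts T"
    and all: "(\<Union>t\<in>verts T. X t) = verts G"
  shows "card (verts (three_center (torso G T X t) (Inl ` X t))) \<le> load G T X t t"
proof -
  let ?J = "torso G T X t" and ?Cs = "components (delete_vertex T t)"
  let ?Z = "\<lambda>C. \<Union>s\<in>C. X s"
  have sel: "verts ?J = Inl ` X t \<union> Inr ` ?Cs" "edges ?J = {e \<in> edges G. \<not> (\<exists>C\<in>?Cs. ends G e \<subseteq> ?Z C)}"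
     "ends ?J = (\<lambda>e. Inl ` (ends G e \<inter> X t) \<union> Inr ` {C \<in> ?Cs. ends G e \<inter> ?Z C \<noteq> {}})"
    by (simp_all add: torso_def Let_def)
  have finT: "finite (verts T)" "finite (edges T)" using is_tree_wf[OF T] by (auto simp: wf_mgraph_def)
  have finX: "finite (X t)" using all t G finite_subset[of "X t" "verts G"] by (auto simp: wf_mgraph_def)
  have finC: "finite ?Cs" using finT by (simp add: components_def delete_vertex_def)
  have fin: "finite (verts ?J)" "finite (edges ?J)"
    using finX finC G by (auto simp: sel wf_mgraph_def)
  let ?B = "{e \<in> edges T. t \<in> ends T e \<and> 3 \<le> card (cut G (region T X t e))}"
  have deg: "degree ?J (Inr C) \<le> card (cut G (?Z C))" if C: "C \<in> ?Cs" for C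
  proof -
    have "{e \<in> edges ?J. Inr C \<in> ends ?J e} \<subseteq> cut G (?Z C)"
    proof
      fix e assume e: "e \<in> {e \<in> edges ?J. Inr C \<in> ends ?J e}"
      then have eG: "e \<in> edges G" "\<not> ends G e \<subseteq> ?Z C" "ends G e \<inter> ?Z C \<noteq> {}" using C by (auto simp: sel)
      obtain a b where ab: "ends G e = {a, b}" "a \<noteq> b" using wf_ends_pair[OF G eG(1)] .
      show "e \<in> cut G (?Z C)" using cut_iff[OF eG(1) ab] eG ab by auto
    qed
    then show ?thesis unfolding degree_def using finite_cut[OF G] by (intro card_mono)
  qed
  have "{z \<in> verts ?J - Inl ` X t. 3 \<le> degree ?J z} \<subseteq> Inr ` (away T t ` ?B)"
  proof
    fix z assume z: "z \<in> {z \<in> verts ?J - Inl ` X t. 3 \<le> degree ?J z}"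
    then obtain C where C: "C \<in> ?Cs" "z = Inr C" by (auto simp: sel)
    obtain e where e: "e \<in> edges T" "t \<in> ends T e" "C = away T t e"
      using component_is_away[OF T t C(1)] by blast
    have "3 \<le> card (cut G (?Z C))" using deg[OF C(1)] z C(2) by auto
    then have "e \<in> ?B" using e by (simp add: region_def)
    then show "z \<in> Inr ` (away T t ` ?B)" using C(2) e(3) by blast
  qed
  then have "card {z \<in> verts ?J - Inl ` X t. 3 \<le> degree ?J z} \<le> card (Inr ` (away T t ` ?B) :: ('a + 'c set) set)"
    using finT by (intro card_mono) auto
  also have "\<dots> \<le> card (away T t ` ?B)" by (rule card_image_le) (use finT in auto)
  also have "\<dots> \<le> card ?B" by (rule card_image_le) (use finT in auto)
  finally have "card {z \<in> verts ?J - Inl ` X t. 3 \<le> degree ?J z} \<le> card ?B" .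
  moreover have "card (Inl ` X t :: ('a + 'c set) set) = card (X t)" by (simp add: card_image)
  moreover have "Inl ` X t \<subseteq> verts ?J" by (simp add: sel)
  ultimately show ?thesis
    using card_three_center[OF fin, of "Inl ` X t"] unfolding load_def by linarith
qed

lemma tree_cut_width_le:
  assumes G: "wf_mgraph G" and D: "decomposable G n (verts G) n"
  shows "tree_cut_width G \<le> n"
proof -
  obtain T :: "(nat, nat) mgraph" and X \<rho> where R: "rooted_decomposition G n T X \<rho> n"
    and all: "(\<Union>t\<in>verts T. X t) = verts G" using D by (auto simp: decomposable_def)
  have T: "is_tree T" and dis: "disjoint_family_on X (verts T)" and r: "\<rho> \<in> verts T"
    using R by (auto simp: rooted_decomposition_def)
  have wf: "wf_mgraph T" using is_tree_wf[OF T] .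
  have finT: "finite (verts T)" "finite (edges T)" using wf by (auto simp: wf_mgraph_def)
  have "adhesion G T X \<le> n"
  proof (cases "edges T = {}")
    case False
    let ?c = "\<lambda>e v. card (cut G (\<Union>t\<in>component_of (delete_edge T e) v. X t))"
    let ?S = "{?c e v | e v. e \<in> edges T \<and> v \<in> ends T e}"
    have "?S = (\<lambda>(e, v). ?c e v) ` (SIGMA e:edges T. ends T e)" by auto
    moreover have "finite (ends T e)" if "e \<in> edges T" for e
      using that wf finite_subset[OF _ finT(1)] unfolding wf_mgraph_def by blast
    ultimately have fin: "finite ?S" using finT by simp
    have le: "?c e v \<le> n" if e: "e \<in> edges T" and v: "v \<in> ends T e" for e v
    proof -
      have vT: "v \<in> verts T" using wf e v by (auto simp: wf_mgraph_def)
      have wfd: "wf_mgraph (delete_edge T e)" using wf by (auto simp: wf_mgraph_def delete_edge_def)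
      have "linked (delete_edge T e) (edges T - {e}) x y \<longleftrightarrow> linked T (edges T - {e}) x y" for x y
        by (rule linked_cong) (simp add: delete_edge_def)
      then have "component_of (delete_edge T e) v = verts T - away T v e"
        using reachable_iff_linked[OF wfd, of v] vT by (auto simp: component_of_def away_def delete_edge_def)
      then have "(\<Union>t\<in>component_of (delete_edge T e) v. X t) = verts G - region T X v e"
        using region_complement[OF dis all] by metis
      then have "?c e v = card (cut G (region T X v e))" using cut_complement[OF G] by simp
      then show ?thesis using reroot[OF G R all vT] e by (auto simp: rooted_decomposition_def)
    qed
    obtain e where e: "e \<in> edges T" using False by blast
    then obtain v where "v \<in> ends T e" using wf_ends_pair[OF wf e] by blast
    then have "?S \<noteq> {}" using e by blast
    then have "Max ?S \<le> n" using fin le by (subst Max_le_iff) auto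
    then show ?thesis using False by (simp add: adhesion_def)
  qed (simp add: adhesion_def)
  moreover have "card (verts (three_center (torso G T X t) (Inl ` X t))) \<le> n" if t: "t \<in> verts T" for t
    using torso_center_le_load[OF G T t all] reroot[OF G R all t] by (simp add: rooted_decomposition_def)
  ultimately have "tree_cut_decomposition_width G T X \<le> n"
    unfolding tree_cut_decomposition_width_def using finT by (subst Max_le_iff) auto
  moreover have "tree_cut_decomposition G T X" using T dis all by (simp add: tree_cut_decomposition_def)
  then have "tree_cut_width G \<le> tree_cut_decomposition_width G T X"
    unfolding tree_cut_width_def by (intro cInf_lower) auto
  ultimately show ?thesis by simp
qed

section \<open>Components of bounded degree\<close>

text \<open>Only the last edge of the path from \<open>q\<close> to \<open>t\<close> separates them among the edges at \<open>t\<close>.\<close>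
lemma one_separating_edge:
  assumes T: "is_tree T" and q: "q \<in> verts T" "t \<in> verts T"
  shows "card {e \<in> edges T. t \<in> ends T e \<and> \<not> linked T (edges T - {e}) q t} \<le> 1"
proof -
  have "linked T (edges T) t q" using is_tree_linked[OF T] q by blast
  then have "\<exists>e0. \<forall>e\<in>edges T. t \<in> ends T e \<longrightarrow> e \<noteq> e0 \<longrightarrow> linked T (edges T - {e}) q t"
  proof (induction rule: linked_induct)
    case (step y z f)
    then obtain e0 where e0: "\<forall>e\<in>edges T. t \<in> ends T e \<longrightarrow> e \<noteq> e0 \<longrightarrow> linked T (edges T - {e}) y t" by blast
    have f: "linked T (edges T - {e}) z y" if "e \<noteq> f" for e
      using linked_edge[of f "edges T - {e}" T z y] step.hyps that by (auto simp: insert_commute)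
    show ?case
    proof (cases "y = t \<or> z = t")
      case True
      then show ?thesis using f by (metis linked_refl)
    next
      case False
      then have "t \<notin> ends T f" using step.hyps by auto
      then show ?thesis using e0 f linked_trans by metis
    qed
  qed simp
  then obtain e0 where "\<forall>e\<in>edges T. t \<in> ends T e \<longrightarrow> e \<noteq> e0 \<longrightarrow> linked T (edges T - {e}) q t" by blast
  then have "{e \<in> edges T. t \<in> ends T e \<and> \<not> linked T (edges T - {e}) q t} \<subseteq> {e0}" by blast
  then have "card {e \<in> edges T. t \<in> ends T e \<and> \<not> linked T (edges T - {e}) q t} \<le> card {e0}"
    by (intro card_mono) auto
  then show ?thesis by simp
qed

text \<open>Every vertex of \<open>C\<close> is put into one node whose bag contains it. An edge inside \<open>C\<close> that
  crosses a tree edge then has an end in both bags at that tree edge, so the degree bound limits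
  the cuts. The root is the node of a vertex of \<open>C\<close>: then no region is all of \<open>C\<close>, and
  by connectivity each nonempty region is left by an edge inside \<open>C\<close> with an end in the bag; such
  an edge serves at most two of the tree edges at the node.\<close>
lemma connected_set_decomposable:
  fixes T :: "(nat, nat) mgraph"
  assumes G: "wf_mgraph G" and sep: "bag_separation G T Bg"
    and bags: "\<And>t. t \<in> verts T \<Longrightarrow> finite (Bg t) \<and> card (Bg t) \<le> w"
    and C: "conn G C" "C \<subseteq> verts G" and deg: "\<And>x. x \<in> C \<Longrightarrow> degree G x \<le> d"
    and n: "w * d + card (cut G C) \<le> n" "w + 2 * (w * d) \<le> n"
  shows "decomposable G n C (w + 2 * (w * d))"
proof -
  have T: "is_tree T" using sep by (simp add: bag_separation_def)
  have finT: "finite (edges T)" using is_tree_wf[OF T] by (simp add: wf_mgraph_def)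
  have "\<forall>x\<in>C. \<exists>t\<in>verts T. x \<in> Bg t" using sep C(2) unfolding bag_separation_def by blast
  then obtain \<phi> where \<phi>: "\<forall>x\<in>C. \<phi> x \<in> verts T \<and> x \<in> Bg (\<phi> x)" by metis
  have "C \<noteq> {}" using C(1) by (cases rule: conn.cases) auto
  then obtain x0 where x0: "x0 \<in> C" by blast
  define \<rho> where "\<rho> = \<phi> x0"
  have r: "\<rho> \<in> verts T" using \<phi> x0 by (simp add: \<rho>_def)
  let ?X = "\<lambda>t. {x \<in> C. \<phi> x = t}"
  let ?Z = "\<lambda>e. {x \<in> C. \<phi> x \<in> away T \<rho> e}"
  have reg: "region T ?X \<rho> e = ?Z e" for e by (auto simp: region_def)
  let ?F = "\<lambda>t. {f \<in> edges G. ends G f \<inter> (Bg t \<inter> C) \<noteq> {}}"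
  have finG: "finite (edges G)" using G by (simp add: wf_mgraph_def)
  have cardF: "card (?F t) \<le> w * d" if t: "t \<in> verts T" for t
  proof -
    have fin: "finite (Bg t \<inter> C)" using bags[OF t] by simp
    have eq: "?F t = (\<Union>x\<in>Bg t \<inter> C. {f \<in> edges G. x \<in> ends G f})" by auto
    have "card (?F t) \<le> (\<Sum>x\<in>Bg t \<inter> C. degree G x)"
      unfolding eq degree_def by (rule card_UN_le[OF fin])
    also have "\<dots> \<le> (\<Sum>x\<in>Bg t \<inter> C. d)" by (rule sum_mono) (use deg in auto)
    also have "\<dots> \<le> w * d"
    proof -
      have "card (Bg t \<inter> C) \<le> card (Bg t)" using bags[OF t] by (intro card_mono) auto
      then show ?thesis using bags[OF t] by (simp add: mult_le_mono1)
    qed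
    finally show ?thesis .
  qed
  have crossing: "\<exists>x y. ends G f = {x, y} \<and> x \<in> C \<and> y \<in> C \<and> \<not> linked T (edges T - {e}) (\<phi> x) (\<phi> y)"
    if e: "e \<in> edges T" and f: "f \<in> inner_cut G C (?Z e)" for e f
  proof -
    have fG: "f \<in> edges G" using f by (auto simp: inner_cut_def cut_def)
    obtain a b where ab: "ends G f = {a, b}" "a \<noteq> b" using wf_ends_pair[OF G fG] .
    have aC: "a \<in> C" "b \<in> C" using f ab by (auto simp: inner_cut_def)
    have "a \<in> ?Z e \<longleftrightarrow> b \<notin> ?Z e" using f cut_iff[OF fG ab] by (auto simp: inner_cut_def)
    then have "\<phi> a \<in> away T \<rho> e \<longleftrightarrow> \<phi> b \<notin> away T \<rho> e" using aC by simp
    then have "\<not> linked T (edges T - {e}) (\<phi> a) (\<phi> b)"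
      using \<phi> aC linked_trans linked_sym unfolding away_def by (metis (no_types, lifting) mem_Collect_eq)
    then show ?thesis using ab aC by blast
  qed
  have inF: "inner_cut G C (?Z e) \<subseteq> ?F t" if e: "e \<in> edges T" "t \<in> ends T e" for e t
  proof
    fix f assume f: "f \<in> inner_cut G C (?Z e)"
    obtain x y where xy: "ends G f = {x, y}" "x \<in> C" "y \<in> C" "\<not> linked T (edges T - {e}) (\<phi> x) (\<phi> y)"
      using crossing[OF e(1) f] by blast
    have fG: "f \<in> edges G" using f by (auto simp: inner_cut_def cut_def)
    then obtain q where q: "q \<in> verts T" "ends G f \<subseteq> Bg q" using sep unfolding bag_separation_def by blast
    have S: "Bg s \<inter> Bg q \<subseteq> Bg t" if "s \<in> verts T" "\<not> linked T (edges T - {e}) s q" for s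
      using sep e q(1) that unfolding bag_separation_def by blast
    have "\<not> linked T (edges T - {e}) (\<phi> x) q \<or> \<not> linked T (edges T - {e}) (\<phi> y) q"
      using xy(4) linked_trans linked_sym by metis
    then have "x \<in> Bg t \<or> y \<in> Bg t"
    proof
      assume "\<not> linked T (edges T - {e}) (\<phi> x) q"
      then show ?thesis using S[of "\<phi> x"] \<phi> xy q(2) by blast
    next
      assume "\<not> linked T (edges T - {e}) (\<phi> y) q"
      then show ?thesis using S[of "\<phi> y"] \<phi> xy q(2) by blast
    qed
    then show "f \<in> ?F t" using fG xy by auto
  qed
  have cuts: "card (cut G (region T ?X \<rho> e)) \<le> n" if e: "e \<in> edges T" for e
  proof -
    obtain t where t: "t \<in> ends T e" "t \<in> verts T" using wf_ends_pair[OF is_tree_wf[OF T] e] by blast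
    have "cut G (?Z e) \<subseteq> inner_cut G C (?Z e) \<union> cut G C"
    proof
      fix f assume f: "f \<in> cut G (?Z e)"
      then have fG: "f \<in> edges G" by (simp add: cut_def)
      obtain a b where ab: "ends G f = {a, b}" "a \<noteq> b" using wf_ends_pair[OF G fG] .
      show "f \<in> inner_cut G C (?Z e) \<union> cut G C"
        using f ab unfolding inner_cut_def cut_iff[OF fG ab] by (auto simp: cut_iff[OF fG ab])
    qed
    then have "card (cut G (?Z e)) \<le> card (inner_cut G C (?Z e) \<union> cut G C)"
      using finite_inner_cut[OF G] finite_cut[OF G] by (intro card_mono) auto
    also have "\<dots> \<le> card (inner_cut G C (?Z e)) + card (cut G C)" by (rule card_Un_le)
    also have "card (inner_cut G C (?Z e)) \<le> card (?F t)"
      using inF[OF e t(1)] finG by (intro card_mono) auto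
    finally show ?thesis using cardF[OF t(2)] n(1) unfolding reg by linarith
  qed
  have load: "load G T ?X \<rho> t \<le> w + 2 * (w * d)" if t: "t \<in> verts T" for t
  proof -
    let ?S = "\<lambda>q. {e \<in> edges T. t \<in> ends T e \<and> \<not> linked T (edges T - {e}) q t}"
    let ?B = "{e \<in> edges T. t \<in> ends T e \<and> 3 \<le> card (cut G (region T ?X \<rho> e))}"
    have "?B \<subseteq> (\<Union>f\<in>?F t. \<Union>x\<in>ends G f \<inter> C. ?S (\<phi> x))"
    proof
      fix e assume e: "e \<in> ?B"
      then have "?Z e \<noteq> {}" unfolding reg by (metis (no_types, lifting) card.empty cut_empty mem_Collect_eq not_numeral_le_zero)
      moreover have "x0 \<notin> ?Z e" using root_not_away[of \<rho> T e] by (simp add: \<rho>_def)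
      ultimately have "inner_cut G C (?Z e) \<noteq> {}" using conn_inner_cut[OF C(1), of "?Z e"] x0 by blast
      then obtain f where f: "f \<in> inner_cut G C (?Z e)" by blast
      then have fF: "f \<in> ?F t" using inF[of e t] e by blast
      obtain x y where xy: "ends G f = {x, y}" "x \<in> C" "y \<in> C" "\<not> linked T (edges T - {e}) (\<phi> x) (\<phi> y)"
        using crossing[OF _ f] e by blast
      then have "\<not> linked T (edges T - {e}) (\<phi> x) t \<or> \<not> linked T (edges T - {e}) (\<phi> y) t"
        using linked_trans linked_sym by metis
      then have "\<exists>x\<in>ends G f \<inter> C. e \<in> ?S (\<phi> x)" using e xy(1-3) by auto
      then show "e \<in> (\<Union>f\<in>?F t. \<Union>x\<in>ends G f \<inter> C. ?S (\<phi> x))" using fF by blast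
    qed
    then have "card ?B \<le> card (\<Union>f\<in>?F t. \<Union>x\<in>ends G f \<inter> C. ?S (\<phi> x))"
      by (rule card_mono[rotated]) (rule finite_subset[OF _ finT], auto)
    also have "\<dots> \<le> (\<Sum>f\<in>?F t. card (\<Union>x\<in>ends G f \<inter> C. ?S (\<phi> x)))"
      by (rule card_UN_le) (use finG in simp)
    also have "\<dots> \<le> (\<Sum>f\<in>?F t. 2)"
    proof (rule sum_mono)
      fix f assume "f \<in> ?F t"
      then have c2: "card (ends G f) = 2" using G by (simp add: wf_mgraph_def)
      then have fin: "finite (ends G f)" by (intro card_ge_0_finite) simp
      have "card (\<Union>x\<in>ends G f \<inter> C. ?S (\<phi> x)) \<le> (\<Sum>x\<in>ends G f \<inter> C. card (?S (\<phi> x)))"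
        by (rule card_UN_le) (use fin in simp)
      also have "\<dots> \<le> (\<Sum>x\<in>ends G f \<inter> C. 1)"
        by (rule sum_mono) (use one_separating_edge[OF T _ t] \<phi> in blast)
      also have "\<dots> \<le> 2" using card_mono[OF fin, of "ends G f \<inter> C"] c2 by simp
      finally show "card (\<Union>x\<in>ends G f \<inter> C. ?S (\<phi> x)) \<le> 2" .
    qed
    also have "\<dots> = 2 * card (?F t)" by simp
    finally have "card ?B \<le> 2 * (w * d)" using cardF[OF t] by linarith
    moreover have "card (?X t) \<le> w"
    proof -
      have "?X t \<subseteq> Bg t" using \<phi> by auto
      then have "card (?X t) \<le> card (Bg t)" using bags[OF t] by (intro card_mono) auto
      then show ?thesis using bags[OF t] by simp
    qed
    ultimately show ?thesis unfolding load_def by linarith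
  qed
  have "rooted_decomposition G n T ?X \<rho> (w + 2 * (w * d))"
    unfolding rooted_decomposition_def
  proof (intro conjI ballI)
    fix t assume "t \<in> verts T - {\<rho>}"
    then show "load G T ?X \<rho> t \<le> n" using load[of t] n(2) by simp
  qed (use T r cuts load in \<open>auto simp: disjoint_family_on_def\<close>)
  moreover have "(\<Union>t\<in>verts T. ?X t) = C" using \<phi> by auto
  ultimately show ?thesis unfolding decomposable_def by blast
qed

definition component_in :: "('v, 'e) mgraph \<Rightarrow> 'v set \<Rightarrow> 'v set \<Rightarrow> bool" where
  "component_in G U C \<longleftrightarrow> conn G C \<and> C \<subseteq> U \<and>
     (\<forall>e\<in>edges G. ends G e \<subseteq> U \<longrightarrow> ends G e \<inter> C \<noteq> {} \<longrightarrow> ends G e \<subseteq> C)"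

lemma component_in_subset:
  assumes G: "wf_mgraph G" and "component_in G U C" "component_in G U C'" "C \<inter> C' \<noteq> {}"
  shows "C \<subseteq> C'"
proof (rule ccontr)
  assume "\<not> C \<subseteq> C'"
  then have "inner_cut G C C' \<noteq> {}" using conn_inner_cut[of G C C'] assms by (auto simp: component_in_def)
  then obtain e where e: "e \<in> edges G" "ends G e \<subseteq> C" "card (ends G e \<inter> C') = 1"
    by (auto simp: inner_cut_def cut_def)
  then have "ends G e \<inter> C' \<noteq> {}" by auto
  then have "ends G e \<subseteq> C'" using assms(2,3) e unfolding component_in_def by blast
  then have "card (ends G e) = 1" using e(3) by (simp add: Int_absorb2)
  then show False using G e(1) by (simp add: wf_mgraph_def)
qed

lemma disjoint_components: "wf_mgraph G \<Longrightarrow> disjoint {C. component_in G U C}"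
  using component_in_subset unfolding disjoint_def by blast

lemma component_exists:
  assumes G: "wf_mgraph G" and U: "finite U" and x: "x \<in> U"
  shows "\<exists>C. component_in G U C \<and> x \<in> C"
proof -
  let ?S = "{C. conn G C \<and> C \<subseteq> U \<and> x \<in> C}"
  have "finite ?S" using U by (intro finite_subset[of ?S "Pow U"]) auto
  moreover have "{x} \<in> ?S" using x conn.single[of G x] by simp
  ultimately have "\<exists>C\<in>?S. \<forall>D\<in>?S. C \<subseteq> D \<longrightarrow> C = D" by (intro finite_has_maximal) auto
  then obtain C where C: "C \<in> ?S" "\<forall>D\<in>?S. C \<subseteq> D \<longrightarrow> C = D" ..
  have "b \<in> C" if e: "e \<in> edges G" "ends G e = {b, a}" "a \<in> C" "b \<in> U" for e a b
  proof (rule ccontr)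
    assume b: "b \<notin> C"
    have "conn G (insert b C)" using conn.leaf[of G C a b e] C(1) e b by blast
    then have "insert b C \<in> ?S" using C(1) e by auto
    then show False using C(2) b by blast
  qed
  then have "ends G e \<subseteq> C" if e: "e \<in> edges G" "ends G e \<subseteq> U" "ends G e \<inter> C \<noteq> {}" for e
  proof -
    obtain a b where ab: "ends G e = {a, b}" using wf_ends_pair[OF G e(1)] .
    have ba: "ends G e = {b, a}" using ab by (simp add: insert_commute)
    show ?thesis
      using \<open>\<And>b a e. e \<in> edges G \<Longrightarrow> ends G e = {b, a} \<Longrightarrow> a \<in> C \<Longrightarrow> b \<in> U \<Longrightarrow> b \<in> C\<close>[OF e(1) ab]
        \<open>\<And>b a e. e \<in> edges G \<Longrightarrow> ends G e = {b, a} \<Longrightarrow> a \<in> C \<Longrightarrow> b \<in> U \<Longrightarrow> b \<in> C\<close>[OF e(1) ba] e(2,3) ab by auto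
  qed
  then have "component_in G U C" using C(1) unfolding component_in_def by blast
  then show ?thesis using C(1) by blast
qed

lemma cut_component_joining:
  assumes G: "wf_mgraph G" and C: "component_in G (verts G - B) C"
  shows "cut G C \<subseteq> joining G C B"
proof
  fix e assume e: "e \<in> cut G C"
  then have eG: "e \<in> edges G" by (simp add: cut_def)
  obtain a b where ab: "ends G e = {a, b}" "a \<noteq> b" "a \<in> verts G" "b \<in> verts G" using wf_ends_pair[OF G eG] .
  have "a \<in> C \<longleftrightarrow> b \<notin> C" using e cut_iff[OF eG ab(1,2)] by simp
  moreover have "ends G e \<inter> B \<noteq> {}"
  proof
    assume "ends G e \<inter> B = {}"
    then have "ends G e \<subseteq> verts G - B" using ab by auto
    moreover have "ends G e \<inter> C \<noteq> {}" using ab \<open>a \<in> C \<longleftrightarrow> b \<notin> C\<close> by auto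
    ultimately have "ends G e \<subseteq> C" using C eG by (simp add: component_in_def)
    then show False using ab \<open>a \<in> C \<longleftrightarrow> b \<notin> C\<close> by auto
  qed
  ultimately show "e \<in> joining G C B" using eG ab unfolding joining_def by auto
qed

lemma decomposable_star:
  assumes "finite \<C>" "disjoint \<C>" "\<And>C. C \<in> \<C> \<Longrightarrow> C \<inter> B = {}"
    and "\<And>C. C \<in> \<C> \<Longrightarrow> decomposable G n C m \<and> card (cut G C) \<le> n" "m < n"
  shows "decomposable G n (B \<union> \<Union>\<C>) (card B + card {C \<in> \<C>. 3 \<le> card (cut G C)})"
  using assms(1-4)
proof (induction rule: finite_induct)
  case empty
  then show ?case using decomposable_single by simp
next
  case (insert C \<C>)
  have "decomposable G n (B \<union> \<Union>\<C>) (card B + card {C \<in> \<C>. 3 \<le> card (cut G C)})"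
    by (rule insert.IH) (use insert.prems in \<open>auto simp: disjoint_def\<close>)
  moreover have "(B \<union> \<Union>\<C>) \<inter> C = {}"
  proof -
    have "D \<inter> C = {}" if "D \<in> \<C>" for D
      using insert.prems(1) insert.hyps(2) that unfolding disjoint_def by (metis insertCI)
    then show ?thesis using insert.prems(2)[of C] by auto
  qed
  ultimately have "decomposable G n ((B \<union> \<Union>\<C>) \<union> C)
      (card B + card {C \<in> \<C>. 3 \<le> card (cut G C)} + (if 3 \<le> card (cut G C) then 1 else 0))"
    using insert.prems(3)[of C] assms(5) by (intro decomposable_join[where ?m2.0 = m]) auto
  moreover have "{D \<in> insert C \<C>. 3 \<le> card (cut G D)}
      = (if 3 \<le> card (cut G C) then insert C {D \<in> \<C>. 3 \<le> card (cut G D)} else {D \<in> \<C>. 3 \<le> card (cut G D)})"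
    by auto
  moreover have "(B \<union> \<Union>\<C>) \<union> C = B \<union> \<Union>(insert C \<C>)" by auto
  ultimately show ?case using insert.hyps by (auto simp: card_insert_if split: if_splits)
qed

section \<open>The main induction\<close>

text \<open>The tree is a star of trees: the centre has bag \<open>B\<close>, and each component of \<open>G - B\<close> gets a
  tree of its own. Components with at most two edges to \<open>B\<close> may be numerous, but they do not
  count at the centre; the others are pieces in the sense of \<open>few_pieces\<close>. The bound has room for the
  fewer than \<open>3 * r ^ 2 * w\<close> edges at a bag inside a component plus the at most \<open>6 * r ^ 4\<close> edges
  from the component to \<open>B\<close>.\<close>
lemma highly_connected_core_decomposable:
  fixes G :: "('v, 'e) mgraph" and r w :: nat
  assumes G: "wf_mgraph G" and no: "\<not> admits_weak_immersion G (wall r)"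
    and r: "r \<ge> 1" and w: "w \<ge> 1"
    and bags: "bag_separation G (T :: (nat, nat) mgraph) Bg"
      "\<And>t. t \<in> verts T \<Longrightarrow> finite (Bg t) \<and> card (Bg t) \<le> w"
    and B: "B = {x \<in> verts G. 3 * r ^ 2 \<le> degree G x}"
    and sep: "\<And>A. A \<inter> B \<noteq> {} \<Longrightarrow> \<not> B \<subseteq> A \<Longrightarrow> 3 * r ^ 2 \<le> card (cut G A)"
  shows "decomposable G (9 * r ^ 4 * w) (verts G) (9 * r ^ 4 * w)"
proof -
  let ?k = "3 * r ^ 2" and ?n = "9 * r ^ 4 * w" and ?U = "verts G - B"
  let ?m = "w + 2 * (w * (?k - 1))"
  have finU: "finite ?U" using G by (simp add: wf_mgraph_def)
  have Wne: "verts (wall r) \<noteq> {}" using r by (auto simp: wall_def)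
  have few: "card B + card \<P> < r ^ 2" if "finite \<P>" "disjoint \<P>"
      "\<And>Q. Q \<in> \<P> \<Longrightarrow> conn G Q \<and> Q \<subseteq> ?U \<and> 3 \<le> card (joining G Q B)" for \<P>
    unfolding card_verts_wall[symmetric]
    by (rule few_pieces[OF G wall_wf Wne degree_wall no]) (use B sep that in \<open>auto simp: card_verts_wall\<close>)
  let ?C = "{C. component_in G ?U C}"
  have finC: "finite ?C" using finU by (intro finite_subset[of ?C "Pow ?U"]) (auto simp: component_in_def)
  have disC: "disjoint ?C" by (rule disjoint_components[OF G])
  have deg: "degree G x \<le> ?k - 1" if "x \<in> ?U" for x using that B by auto
  have finE: "finite (edges G)" using G by (simp add: wf_mgraph_def)
  have cutC: "card (cut G C) \<le> 6 * r ^ 4" if C: "component_in G ?U C" for C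
  proof -
    have cC: "conn G C" "C \<subseteq> ?U" using C by (auto simp: component_in_def)
    let ?\<omega> = "\<lambda>x. card (joining G {x} B)"
    have joinX: "card (joining G X B) = sum ?\<omega> X" if "X \<subseteq> C" "finite X" for X
      by (rule card_joining[OF G that(2)]) (use that cC in blast)
    \<comment> \<open>Twice the degree: it pays for the weight and for the doubled inner degree.\<close>
    have "?\<omega> x + 2 * card {e \<in> edges G. ends G e \<subseteq> C \<and> x \<in> ends G e} \<le> 2 * (?k - 1)" if x: "x \<in> C" for x
    proof -
      let ?I = "{e \<in> edges G. ends G e \<subseteq> C \<and> x \<in> ends G e}"
      have "joining G {x} B \<inter> ?I = {}" using cC by (auto simp: joining_def)
      then have "?\<omega> x + card ?I = card (joining G {x} B \<union> ?I)"
        using finE finite_joining[OF G] by (simp add: card_Un_disjoint)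
      also have "\<dots> \<le> degree G x" unfolding degree_def
        using finE by (intro card_mono) (auto simp: joining_def)
      finally show ?thesis using deg[of x] x cC by force
    qed
    then obtain \<P> where P: "finite \<P>" "disjoint \<P>" "\<forall>Q\<in>\<P>. conn G Q \<and> Q \<subseteq> C \<and> 3 \<le> sum ?\<omega> Q"
      "sum ?\<omega> C \<le> 2 * (?k - 1) * card \<P> + 2"
      using split_into_pieces[OF G cC(1), of ?\<omega> "2 * (?k - 1)"] by blast
    have "card B + card \<P> < r ^ 2"
    proof (rule few[OF P(1,2)])
      fix Q assume Q: "Q \<in> \<P>"
      then have "conn G Q" "Q \<subseteq> C" "3 \<le> sum ?\<omega> Q" using P(3) by auto
      then show "conn G Q \<and> Q \<subseteq> ?U \<and> 3 \<le> card (joining G Q B)"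
        using joinX[of Q] conn_finite[of G Q] cC by auto
    qed
    then have "card \<P> + 1 \<le> r ^ 2" by simp
    have "card (cut G C) \<le> sum ?\<omega> C"
      using card_mono[OF finite_joining[OF G] cut_component_joining[OF G C]] joinX[of C] conn_finite[OF cC(1)] by simp
    also have "\<dots> \<le> 2 * ?k * card \<P> + 2 * ?k" using P(4) r
      by (intro order_trans[OF P(4)] add_mono mult_le_mono1) auto
    also have "\<dots> = 2 * ?k * (card \<P> + 1)" by simp
    also have "\<dots> \<le> 2 * ?k * r ^ 2" using \<open>card \<P> + 1 \<le> r ^ 2\<close> by (rule mult_le_mono2)
    also have "\<dots> = 6 * r ^ 4" by (simp add: power2_eq_square power4_eq_xxxx)
    finally show ?thesis .
  qed
  have r2: "r ^ 2 \<le> r ^ 4" "1 \<le> r ^ 2" using r by (auto intro: power_increasing)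
  have r2w: "r ^ 2 * w \<le> r ^ 4 * w" "r ^ 4 \<le> r ^ 4 * w" "1 \<le> r ^ 4 * w" using r2 w by auto
  have wk: "w * (?k - 1) + w = 3 * (r ^ 2 * w)"
  proof -
    have "?k - 1 + 1 = ?k" using r2 by simp
    then have "w * (?k - 1) + w = w * ?k" by (metis distrib_left mult.right_neutral)
    then show ?thesis by simp
  qed
  have dec: "decomposable G ?n C ?m \<and> card (cut G C) \<le> ?n" if C: "component_in G ?U C" for C
  proof
    show "card (cut G C) \<le> ?n" using cutC[OF C] r2w by linarith
    show "decomposable G ?n C ?m"
    proof (rule connected_set_decomposable[OF G bags])
      show "conn G C" "C \<subseteq> verts G" using C by (auto simp: component_in_def)
      show "degree G x \<le> ?k - 1" if "x \<in> C" for x using that C deg by (auto simp: component_in_def)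
      show "w * (?k - 1) + card (cut G C) \<le> ?n" using cutC[OF C] wk r2w by linarith
      show "?m \<le> ?n" using wk r2w by linarith
    qed
  qed
  have "?m < ?n" using wk r2w w by linarith
  then have star: "decomposable G ?n (B \<union> \<Union>?C) (card B + card {C \<in> ?C. 3 \<le> card (cut G C)})"
    by (intro decomposable_star[OF finC disC _ _, where m = ?m]) (use dec in \<open>auto simp: component_in_def\<close>)
  have all: "B \<union> \<Union>?C = verts G"
  proof -
    have "?U \<subseteq> \<Union>?C" using component_exists[OF G finU] by blast
    moreover have "\<Union>?C \<subseteq> ?U" by (auto simp: component_in_def)
    ultimately show ?thesis using B by auto
  qed
  have "card B + card {C \<in> ?C. 3 \<le> card (cut G C)} < r ^ 2"
  proof (rule few)
    show "finite {C \<in> ?C. 3 \<le> card (cut G C)}" using finC by simp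
    show "disjoint {C \<in> ?C. 3 \<le> card (cut G C)}" using disC by (auto simp: disjoint_def)
    fix Q assume Q: "Q \<in> {C \<in> ?C. 3 \<le> card (cut G C)}"
    then have "card (cut G Q) \<le> card (joining G Q B)"
      using card_mono[OF finite_joining[OF G] cut_component_joining[OF G]] by blast
    then show "conn G Q \<and> Q \<subseteq> ?U \<and> 3 \<le> card (joining G Q B)" using Q by (auto simp: component_in_def)
  qed
  then have "card B + card {C \<in> ?C. 3 \<le> card (cut G C)} \<le> ?n" using r2 r2w by linarith
  with star show ?thesis unfolding all by (rule decomposable_mono)
qed

text \<open>A minimum cut between two vertices with at least two vertices on each side splits the
  problem: both contractions are immersed in the graph and smaller. If there is
  no such cut of size below \<open>3 * r ^ 2\<close>, then vertices of at least this degree are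
  not separated by fewer edges.\<close>
lemma no_wall_decomposable:
  fixes G :: "('v, 'e) mgraph" and r w :: nat
  assumes wall: "\<And>K :: (nat, nat) mgraph. wf_mgraph K \<Longrightarrow> tree_width K \<ge> w \<Longrightarrow> contains_subdivision K (wall r)"
    and r: "r \<ge> 1" and w: "w \<ge> 1"
    and "wf_mgraph G" "\<not> admits_weak_immersion G (wall r)"
  shows "decomposable G (9 * r ^ 4 * w) (verts G) (9 * r ^ 4 * w)"
  using assms(4,5)
proof (induction "card (verts G)" arbitrary: G rule: less_induct)
  case (less G)
  let ?k = "3 * r ^ 2" and ?n = "9 * r ^ 4 * w"
  note G = less.prems(1)
  have finV: "finite (verts G)" using G by (simp add: wf_mgraph_def)
  let ?mincut = "\<lambda>u v A. A \<subseteq> verts G \<and> u \<in> A \<and> v \<in> verts G - A \<and>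
     (\<forall>A'. A' \<subseteq> verts G \<longrightarrow> u \<in> A' \<longrightarrow> v \<notin> A' \<longrightarrow> card (cut G A) \<le> card (cut G A'))"
  have kn: "?k \<le> ?n"
  proof -
    have "r ^ 2 \<le> r ^ 4" using r by (auto intro: power_increasing)
    also have "r ^ 4 \<le> r ^ 4 * w" using w by simp
    finally show ?thesis by linarith
  qed
  show ?case
  proof (cases "\<exists>u v A. ?mincut u v A \<and> card (cut G A) < ?k \<and> 2 \<le> card A \<and> 2 \<le> card (verts G - A)")
    case True
    then obtain u v A where A: "A \<subseteq> verts G" "u \<in> A" "v \<in> verts G - A"
      and min: "\<And>A'. A' \<subseteq> verts G \<Longrightarrow> u \<in> A' \<Longrightarrow> v \<notin> A' \<Longrightarrow> card (cut G A) \<le> card (cut G A')"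
      and small: "card (cut G A) < ?k" and two: "2 \<le> card A" "2 \<le> card (verts G - A)" by blast
    have cards: "card A + card (verts G - A) = card (verts G)"
      using A finV by (simp add: card_Diff_subset card_mono finite_subset)
    have finA: "finite A" using A finV finite_subset by blast
    have shrink: "decomposable G ?n (verts G - W) (?n - 1) \<and> ?n > 0"
      if W: "W \<subseteq> verts G" "x \<in> W" "2 \<le> card W"
        and m: "\<And>Z. x \<in> Z \<Longrightarrow> Z \<subseteq> W \<Longrightarrow> card (cut G W) \<le> card (cut G Z)" for W x
    proof -
      let ?C = "contract G W x"
      have C: "wf_mgraph ?C" using contract_wf[OF G W(2)] .
      have "card (verts ?C) < card (verts G)"
      proof -
        have "card (verts ?C) = Suc (card (verts G - W))" using finV W by (simp add: contract_def)
        moreover have "card (verts G - W) = card (verts G) - card W"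
          using W finV by (simp add: card_Diff_subset finite_subset)
        moreover have "card W \<le> card (verts G)" using W finV card_mono by blast
        ultimately show ?thesis using W(3) by linarith
      qed
      moreover have "\<not> admits_weak_immersion ?C (wall r)"
        using less.prems(2) admits_weak_immersion_trans[OF G C wall_wf] contract_immersed[OF G W(1,2) m] by blast
      ultimately have "decomposable ?C ?n (verts ?C) ?n" using less.hyps C by blast
      then show ?thesis using decomposable_uncontract[OF G W(2)] by blast
    qed
    have comp: "verts G - (verts G - A) = A" using A by blast
    have 1: "decomposable G ?n (verts G - (verts G - A)) (?n - 1) \<and> ?n > 0"
    proof (rule shrink[of _ v])
      fix Z assume Z: "v \<in> Z" "Z \<subseteq> verts G - A"
      have "card (cut G A) \<le> card (cut G (verts G - Z))" by (rule min) (use Z A in auto)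
      then show "card (cut G (verts G - A)) \<le> card (cut G Z)" by (simp add: cut_complement[OF G])
    qed (use A two in auto)
    have 2: "decomposable G ?n (verts G - A) (?n - 1) \<and> ?n > 0"
    proof (rule shrink[of A u, OF A(1,2) two(1)])
      fix Z assume "u \<in> Z" "Z \<subseteq> A"
      then show "card (cut G A) \<le> card (cut G Z)" by (intro min) (use A in auto)
    qed
    have le: "card (cut G A) \<le> ?n" using small kn by linarith
    have "decomposable G ?n (A \<union> (verts G - A)) ((?n - 1) + (if 3 \<le> card (cut G (verts G - A)) then 1 else 0))"
      by (rule decomposable_join[where ?m2.0 = "?n - 1"]) (use 1 2 comp le in \<open>auto simp: cut_complement[OF G]\<close>)
    moreover have "A \<union> (verts G - A) = verts G" using A by blast
    ultimately show ?thesis using decomposable_mono[of G ?n "verts G" _ ?n] 1 by auto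
  next
    case False
    define B where "B = {x \<in> verts G. ?k \<le> degree G x}"
    have sep: "?k \<le> card (cut G A)" if A: "A \<inter> B \<noteq> {}" "\<not> B \<subseteq> A" for A
    proof (rule ccontr)
      assume small: "\<not> ?thesis"
      obtain u v where uv: "u \<in> A" "u \<in> B" "v \<in> B" "v \<notin> A" using A by blast
      let ?P = "\<lambda>A'. A' \<subseteq> verts G \<and> u \<in> A' \<and> v \<notin> A'"
      have PA: "?P (A \<inter> verts G)" using uv by (auto simp: B_def)
      obtain A0 where A0: "?P A0" "\<And>A'. ?P A' \<Longrightarrow> card (cut G A0) \<le> card (cut G A')"
        using ex_has_least_nat[of ?P "A \<inter> verts G" "\<lambda>A. card (cut G A)"] PA by blast
      have "cut G (A \<inter> verts G) = cut G A"
      proof -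
        have "ends G e \<inter> (A \<inter> verts G) = ends G e \<inter> A" if "e \<in> edges G" for e
          using that G unfolding wf_mgraph_def by blast
        then show ?thesis unfolding cut_def by auto
      qed
      then have small0: "card (cut G A0) < ?k" using A0(2)[OF PA] small by simp
      have "?mincut u v A0" using A0 uv by (auto simp: B_def)
      then have "\<not> (2 \<le> card A0 \<and> 2 \<le> card (verts G - A0))" using False small0 by blast
      then consider "card A0 \<le> 1" | "card (verts G - A0) \<le> 1" by linarith
      then show False
      proof cases
        case 1
        have "finite A0" using A0(1) finV finite_subset by blast
        then have "A0 = {u}" using 1 A0(1) card_le_Suc0_iff_eq[of A0] by auto
        then show False using small0 uv card_cut_singleton[OF G, of u] by (simp add: B_def)
      next
        case 2
        have "verts G - A0 = {v}"
          using 2 A0(1) uv finV card_le_Suc0_iff_eq[of "verts G - A0"] by (auto simp: B_def)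
        then have "cut G A0 = cut G {v}" using cut_complement[OF G, of A0] by simp
        then show False using small0 uv card_cut_singleton[OF G, of v] by (simp add: B_def)
      qed
    qed
    obtain T :: "(nat, nat) mgraph" and Bg where T: "bag_separation G T Bg"
      "\<And>t. t \<in> verts T \<Longrightarrow> finite (Bg t) \<and> card (Bg t) \<le> w"
      using no_wall_bag_separation[OF wall G less.prems(2)] by metis
    show ?thesis
      by (rule highly_connected_core_decomposable[OF G less.prems(2) r w T B_def sep])
  qed
qed

theorem theorem17:
  fixes w :: "nat \<Rightarrow> nat" and G :: "('v, 'e) mgraph" and r :: nat
  assumes w_pos: "\<And>k. k \<ge> 1 \<Longrightarrow> w k \<ge> 1"
    and w_wall: "\<And>k (K :: (nat, nat) mgraph).
      k \<ge> 1 \<Longrightarrow> wf_mgraph K \<Longrightarrow> tree_width K \<ge> w k \<Longrightarrow> contains_subdivision K (wall k)"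
    and G: "wf_mgraph G"
    and r: "r \<ge> 1"
    and tcw: "tree_cut_width G \<ge> 4 * r ^ 10 * w r"
  shows "admits_weak_immersion G (wall r)"
proof (rule ccontr)
  assume no: "\<not> admits_weak_immersion G (wall r)"
  have w: "w r \<ge> 1" using w_pos r by blast
  show False
  proof (cases "r = 1")
    case True
    \<comment> \<open>The bounds of the general case are too weak for the one-vertex wall, but then \<open>G\<close> is empty.\<close>
    have "verts G = {}"
    proof (rule ccontr)
      assume "verts G \<noteq> {}"
      then obtain x where x: "x \<in> verts G" by blast
      have "verts (wall r) = {(1, 1)}" "edges (wall r) = {}" using True by (auto simp: wall_def)
      then have "links_immersion (wall r) G (\<lambda>_. x) (\<lambda>_. {})" using x by (simp add: links_immersion_def)
      then show False using no links_weak_immersion[OF G wall_wf] by blast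
    qed
    then have "decomposable G 0 (verts G) 0" using decomposable_single[of G 0 "{}"] by simp
    then have "tree_cut_width G \<le> 0" by (rule tree_cut_width_le[OF G])
    then show False using tcw w True by simp
  next
    case False
    have "decomposable G (9 * r ^ 4 * w r) (verts G) (9 * r ^ 4 * w r)"
      by (rule no_wall_decomposable[OF w_wall[OF r] r w G no])
    then have "tree_cut_width G \<le> 9 * r ^ 4 * w r" by (rule tree_cut_width_le[OF G])
    moreover have "9 * r ^ 4 * w r < 4 * r ^ 10 * w r"
    proof -
      have "2 \<le> r" using r False by simp
      then have "2 ^ 6 \<le> r ^ 6" by (rule power_mono) simp
      then have "r ^ 4 * 64 \<le> r ^ 4 * r ^ 6" by (intro mult_le_mono2) simp
      also have "r ^ 4 * r ^ 6 = r ^ 10" by (simp flip: power_add)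
      finally have "9 * r ^ 4 < 4 * r ^ 10" 
        using zero_less_power[of r 4] r by linarith
      then show ?thesis using w by simp
    qed
    ultimately show False using tcw by linarith
  qed
qed

end
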